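(* Assume the following. (1) (Local Lipschitz) For each $R>0$ there is $C_R>0$ such that $|f(x)-f(y)|+|g(x)-g(y)|\le C_R|x-y|$ for all $x,y\in\mathbb{R}^d$ with $|x|\vee|y|\le R$. (2) There exist constants $p\ge2$, $K_6>0$, $K_7\ge0$ such that $\langle x,f(x)\rangle+\frac{p-1}{2}|g(x)|^2\le -K_6|x|^2+K_7$ for all $x\in\mathbb{R}^d$. (3) There is $\delta_{\max}\in(0,\infty)$ such that the timestep function $\delta:\mathbb{R}^d\to(0,\delta_{\max}]$ is continuous, $\lim_{|x|\to\infty}\delta(x)=0$, and there is $\gamma\in(0,1/3]$ such that $|f(x)|(\delta(x))^\gamma\le 1+|x|$ and $|g(x)|^2(\delta(x))^\gamma\le(1+|x|)^2$ for all $x\in\mathbb{R}^d$. (4) There is a constant $\ell>0$ such that $\delta(x)\ge\ell(1+|x|^2)^{-p/2}$ for all $x\in\mathbb{R}^d$, with $p$ as in (2). (5) $g$ is uniformly nondegenerate: there is $\lambda>0$ such that $g(x)g^{\rm T}(x)\ge\lambda I_d$ for all $x\in\mathbb{R}^d$. Then the adaptive Euler--Maruyama numerical solution $\{Y_{t_n}\}_{n\ge0}$ is a $\mu^{Leb}$-irreducible, aperiodic Markov chain. Moreover, the chain is positive recurrent and admits a unique invariant probability measure $\mu^\Delta$, and for every $x_0\in\mathbb{R}^d$, $$\lim_{n\to\infty}\|P_Y^n(x_0,\cdot)-\mu^\Delta\|_{\rm TV}=0.$$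
   Context: $(\Omega,\mathcal{F},\mathbb{P})$ is a complete probability space with a filtration $\{\mathcal{F}_t\}_{t\ge0}$ satisfying the usual conditions, and $W$ is an $m$-dimensional Brownian motion with respect to it. $f:\mathbb{R}^d\to\mathbb{R}^d$, $g:\mathbb{R}^d\to\mathbb{R}^{d\times m}$. $|\cdot|$ is the Euclidean norm on $\mathbb{R}^d$ and the Frobenius norm on $\mathbb{R}^{d\times m}$; $a\vee b=\max\{a,b\}$; $I_d$ is the identity matrix and $\ge$ between matrices is the Loewner order. Adaptive time-stepping Euler--Maruyama scheme with timestep function $\delta$: $t_0=0$, $Y_{t_0}=x_0\in\mathbb{R}^d$, and for $n\ge0$, $\delta_n=\delta(Y_{t_n})$, $t_{n+1}=t_n+\delta_n$, $Y_{t_{n+1}}=Y_{t_n}+f(Y_{t_n})\delta_n+g(Y_{t_n})(W(t_{n+1})-W(t_n))$. $\{Y_{t_n}\}_{n\ge0}$ is a time-homogeneous Markov chain, with $n$-step transition kernel $P_Y^n(x,A)=\mathbb{P}(Y_{t_n}\in A\mid Y_0=x)$. $\mu^{Leb}$ is Lebesgue measure on $\mathbb{R}^d$; the chain is $\mu^{Leb}$-irreducible if for every $x$ and every Borel $A$ with $\mu^{Leb}(A)>0$ there is $n\ge1$ with $P_Y^n(x,A)>0$. Aperiodicity and positive recurrence are in the standard sense of Meyn and Tweedie for $\psi$-irreducible chains. $\|\mu-\nu\|_{\rm TV}=\sup_{A\in\mathcal{B}(\mathbb{R}^d)}|\mu(A)-\nu(A)|$. The superscript in $\mu^\Delta$ is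 only notation for the invariant measure of the numerical chain. *)

theory Defs
  imports "HOL-Probability.Probability"
begin

text \<open>Time is \<open>[0, \<infinity>)\<close>; the values of \<open>F\<close> and \<open>W\<close> at negative arguments are irrelevant.\<close>

locale usual_filtered_prob_space = prob_space M + complete_measure M
  for M :: "'w measure" and F :: "real \<Rightarrow> 'w measure" +
  assumes subalg: "0 \<le> t \<Longrightarrow> subalgebra M (F t)"
    and filtration_mono: "0 \<le> s \<Longrightarrow> s \<le> t \<Longrightarrow> sets (F s) \<subseteq> sets (F t)"
    and null_sets_init: "null_sets M \<subseteq> sets (F 0)"
    and right_continuous: "0 \<le> t \<Longrightarrow> sets (F t) = (\<Inter>u\<in>{t<..}. sets (F u))"

text \<open>The density below is that of the centred normal law on \<open>\<real>\<^sup>m\<close> with covariance matrix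
  \<open>(t - s) I\<close>.\<close>

locale brownian_motion = usual_filtered_prob_space M F
  for M :: "'w measure" and F :: "real \<Rightarrow> 'w measure" +
  fixes W :: "real \<Rightarrow> 'w \<Rightarrow> real ^ 'm"
  assumes adapted: "0 \<le> t \<Longrightarrow> W t \<in> F t \<rightarrow>\<^sub>M borel"
    and initial_zero: "AE \<omega> in M. W 0 \<omega> = 0"
    and continuous_paths: "AE \<omega> in M. continuous_on {0..} (\<lambda>t. W t \<omega>)"
    and normal_increments: "0 \<le> s \<Longrightarrow> s < t \<Longrightarrow>
      distributed M lborel (\<lambda>\<omega>. W t \<omega> - W s \<omega>)
        (\<lambda>x. ennreal (\<Prod>i\<in>UNIV. normal_density 0 (sqrt (t - s)) (x $ i)))"
    and indep_increments: "0 \<le> s \<Longrightarrow> s < t \<Longrightarrow>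
      indep_set (sets (F s))
        (sets (vimage_algebra (space M) (\<lambda>\<omega>. W t \<omega> - W s \<omega>) borel))"

text \<open>The grid is random, so the time \<open>t\<^sub>n\<close> and the state \<open>Y\<close> at time \<open>t\<^sub>n\<close> are computed
  together, path by path. On \<open>real ^ 'm ^ 'd\<close> (matrices with \<open>d\<close> rows and \<open>m\<close> columns),
  \<open>norm\<close> is the Frobenius norm.\<close>

primrec adaptive_em ::
    "(real ^ 'd \<Rightarrow> real ^ 'd) \<Rightarrow> (real ^ 'd \<Rightarrow> real ^ 'm ^ 'd) \<Rightarrow> (real ^ 'd \<Rightarrow> real)
      \<Rightarrow> (real \<Rightarrow> 'w \<Rightarrow> real ^ 'm) \<Rightarrow> real ^ 'd \<Rightarrow> nat \<Rightarrow> 'w \<Rightarrow> real \<times> (real ^ 'd)" where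
  "adaptive_em f g \<delta> W x0 0 \<omega> = (0, x0)"
| "adaptive_em f g \<delta> W x0 (Suc n) \<omega> =
    (let (t, y) = adaptive_em f g \<delta> W x0 n \<omega>
     in (t + \<delta> y, y + \<delta> y *\<^sub>R f y + g y *v (W (t + \<delta> y) \<omega> - W t \<omega>)))"

definition em_state ::
    "(real ^ 'd \<Rightarrow> real ^ 'd) \<Rightarrow> (real ^ 'd \<Rightarrow> real ^ 'm ^ 'd) \<Rightarrow> (real ^ 'd \<Rightarrow> real)
      \<Rightarrow> (real \<Rightarrow> 'w \<Rightarrow> real ^ 'm) \<Rightarrow> real ^ 'd \<Rightarrow> nat \<Rightarrow> 'w \<Rightarrow> real ^ 'd" where
  "em_state f g \<delta> W x0 n \<omega> = snd (adaptive_em f g \<delta> W x0 n \<omega>)"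

text \<open>The initial value is deterministic, so conditioning on \<open>Y\<^sub>0 = x\<close> means starting the
  scheme at \<open>x\<close>.\<close>

definition em_kernel ::
    "'w measure \<Rightarrow> (real ^ 'd \<Rightarrow> real ^ 'd) \<Rightarrow> (real ^ 'd \<Rightarrow> real ^ 'm ^ 'd)
      \<Rightarrow> (real ^ 'd \<Rightarrow> real) \<Rightarrow> (real \<Rightarrow> 'w \<Rightarrow> real ^ 'm)
      \<Rightarrow> nat \<Rightarrow> real ^ 'd \<Rightarrow> (real ^ 'd) measure" where
  "em_kernel M f g \<delta> W n x = distr M borel (em_state f g \<delta> W x n)"

definition positive_semidefinite :: "real ^ 'n ^ 'n \<Rightarrow> bool" where
  "positive_semidefinite A \<longleftrightarrow> transpose A = A \<and> (\<forall>v. 0 \<le> v \<bullet> (A *v v))"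

definition loewner_le :: "real ^ 'n ^ 'n \<Rightarrow> real ^ 'n ^ 'n \<Rightarrow> bool" where
  "loewner_le A B \<longleftrightarrow> positive_semidefinite (B - A)"

definition natural_filtration ::
    "'w measure \<Rightarrow> (nat \<Rightarrow> 'w \<Rightarrow> 'a::topological_space) \<Rightarrow> nat \<Rightarrow> 'w measure" where
  "natural_filtration M X n =
    sigma (space M) (\<Union>i\<in>{..n}. {X i -` A \<inter> space M | A. A \<in> sets borel})"

definition homogeneous_markov_chain ::
    "'w measure \<Rightarrow> (nat \<Rightarrow> 'w \<Rightarrow> 'a::topological_space) \<Rightarrow> ('a \<Rightarrow> 'a measure) \<Rightarrow> bool" where
  "homogeneous_markov_chain M X K \<longleftrightarrow>
    K \<in> borel \<rightarrow>\<^sub>M prob_algebra borel \<and>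
    (\<forall>n. X n \<in> M \<rightarrow>\<^sub>M borel) \<and>
    (\<forall>n. \<forall>A\<in>sets borel. AE \<omega> in M.
      real_cond_exp M (natural_filtration M X n) (indicator (X (Suc n) -` A \<inter> space M)) \<omega>
        = measure (K (X n \<omega>)) A)"

text \<open>The notions below follow Meyn and Tweedie, \<^emph>\<open>Markov Chains and Stochastic Stability\<close>;
  \<open>P n x\<close> is the \<open>n\<close>-step transition probability from \<open>x\<close>. As usual, irreducibility measures are nonzero Borel measures.\<close>

definition irreducible_chain ::
    "'a::topological_space measure \<Rightarrow> (nat \<Rightarrow> 'a \<Rightarrow> 'a measure) \<Rightarrow> bool" where
  "irreducible_chain \<phi> P \<longleftrightarrow>
    sets \<phi> = sets borel \<and> emeasure \<phi> UNIV > 0 \<and>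
    (\<forall>x. \<forall>A\<in>sets borel. emeasure \<phi> A > 0 \<longrightarrow> (\<exists>n\<ge>1. emeasure (P n x) A > 0))"

definition maximal_irreducibility_measure ::
    "'a::topological_space measure \<Rightarrow> (nat \<Rightarrow> 'a \<Rightarrow> 'a measure) \<Rightarrow> bool" where
  "maximal_irreducibility_measure \<psi> P \<longleftrightarrow>
    irreducible_chain \<psi> P \<and> (\<forall>\<phi>. irreducible_chain \<phi> P \<longrightarrow> absolutely_continuous \<psi> \<phi>)"

definition chain_cycle ::
    "'a::topological_space measure \<Rightarrow> (nat \<Rightarrow> 'a \<Rightarrow> 'a measure) \<Rightarrow> nat \<Rightarrow> (nat \<Rightarrow> 'a set) \<Rightarrow> bool"
  where
  "chain_cycle \<psi> P k D \<longleftrightarrow>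
    k \<ge> 1 \<and> (\<forall>i<k. D i \<in> sets borel) \<and> disjoint_family_on D {..<k} \<and>
    (\<forall>i<k. \<forall>x\<in>D i. emeasure (P 1 x) (D (Suc i mod k)) = 1) \<and>
    emeasure \<psi> (- (\<Union>i<k. D i)) = 0"

definition chain_period ::
    "'a::topological_space measure \<Rightarrow> (nat \<Rightarrow> 'a \<Rightarrow> 'a measure) \<Rightarrow> nat \<Rightarrow> bool" where
  "chain_period \<psi> P k \<longleftrightarrow>
    (\<exists>D. chain_cycle \<psi> P k D) \<and> (\<forall>j D. chain_cycle \<psi> P j D \<longrightarrow> j \<le> k)"

text \<open>All maximal irreducibility measures have the same null sets, so the choice of \<open>\<psi>\<close> in
  the next two definitions is immaterial.\<close>

definition aperiodic_chain :: "(nat \<Rightarrow> 'a::topological_space \<Rightarrow> 'a measure) \<Rightarrow> bool" where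
  "aperiodic_chain P \<longleftrightarrow> (\<exists>\<psi>. maximal_irreducibility_measure \<psi> P \<and> chain_period \<psi> P 1)"

definition recurrent_chain :: "(nat \<Rightarrow> 'a::topological_space \<Rightarrow> 'a measure) \<Rightarrow> bool" where
  "recurrent_chain P \<longleftrightarrow>
    (\<exists>\<psi>. maximal_irreducibility_measure \<psi> P \<and>
      (\<forall>x. \<forall>A\<in>sets borel. emeasure \<psi> A > 0 \<longrightarrow> (\<Sum>n. emeasure (P (Suc n) x) A) = \<infinity>))"

definition invariant_probability ::
    "(nat \<Rightarrow> 'a::topological_space \<Rightarrow> 'a measure) \<Rightarrow> 'a measure \<Rightarrow> bool" where
  "invariant_probability P \<mu> \<longleftrightarrow>
    prob_space \<mu> \<and> sets \<mu> = sets borel \<and>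
    (\<forall>A\<in>sets borel. emeasure \<mu> A = (\<integral>\<^sup>+x. emeasure (P 1 x) A \<partial>\<mu>))"

definition positive_recurrent_chain :: "(nat \<Rightarrow> 'a::topological_space \<Rightarrow> 'a measure) \<Rightarrow> bool"
  where
  "positive_recurrent_chain P \<longleftrightarrow> recurrent_chain P \<and> (\<exists>\<mu>. invariant_probability P \<mu>)"

text \<open>Total variation distance with the normalisation without a factor 2; meant for probability
  measures, for which the supremum is over a bounded set.\<close>

definition tv_dist :: "'a::topological_space measure \<Rightarrow> 'a measure \<Rightarrow> real" where
  "tv_dist \<mu> \<nu> = (SUP A\<in>sets borel. \<bar>measure \<mu> A - measure \<nu> A\<bar>)"

end

theory Submission
  imports Defs
begin

text \<open>
Conditionally on the past up to the random time \<open>t\<^sub>n\<close>, the increment of \<open>W\<close> over the next step is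
a centred normal vector with covariance \<open>\<delta> Y I\<close>, where \<open>Y\<close> is the state at \<open>t\<^sub>n\<close>. This is the strong
Markov property of Brownian motion; it makes the scheme a homogeneous Markov chain whose one-step law
from \<open>y\<close>, called \<open>em_transition f g \<delta> y\<close>, is the image of the standard Gaussian law under the affine
map \<open>z \<mapsto> y + \<delta> y f y + (\<delta> y)\<^sup>1\<^sup>/\<^sup>2 g y z\<close> (lemma \<open>em_markov_property\<close>). Everything else is a statement
about this kernel, and two of its properties carry the theorem.

The first is nondegeneracy. Because \<open>g g\<^sup>T \<ge> lam I\<close>, the Cameron--Martin formula compares the one-step
laws with Lebesgue measure: they have exactly the Lebesgue null sets (\<open>em_transition_null_iff\<close>), and
from all points of a ball they dominate one and the same multiple of a uniform law
(\<open>em_transition_minorization\<close>). So Lebesgue measure is a maximal irreducibility measure, and the period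
is 1: a cycle of length at least 2 would contain a point from which some set of positive measure cannot
be reached in one step.

The second is a drift condition for \<open>V x = (1 + |x|\<^sup>2)\<^sup>p\<^sup>/\<^sup>2\<close>. The terms of order \<open>\<delta>\<close> in the expected change
of \<open>V\<close> over one step are controlled by the dissipativity condition and amount to at most a negative
multiple of \<open>\<delta> V\<close> far from the origin, which is bounded away from 0 by the lower bound on \<open>\<delta>\<close>. The
error terms, relative to \<open>V\<close>, are of order \<open>\<delta>\<^sup>2\<^sup>-\<^sup>2\<^sup>\<gamma>\<close>, because the symmetry of the Gaussian law cancels
the odd powers of the noise; as \<open>\<gamma> \<le> 1/3\<close> and \<open>\<delta>\<close> tends to 0 at infinity, they are negligible
(\<open>one_step_moment_bound\<close>, \<open>em_transition_drift\<close>).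

An invariant probability is obtained by regeneration. Removing from the kernel the part
\<open>\<epsilon> 1\<^sub>C \<otimes> \<nu>\<close> supplied by the minorization leaves a substochastic kernel \<open>Q\<close>; the measure \<open>\<Sum>\<^sub>n \<nu> Q\<^sup>n\<close> is
finite by the drift condition and turns out to be invariant (\<open>invariant_probability_from_drift\<close>).

A drift by a constant yields no geometric rate, so convergence is derived from the
invariant probability \<open>\<pi>\<close> itself. Two independent copies of the chain are merged whenever the product
minorization allows it. The probability \<open>h\<close> that they never merge is a fixed point of the residual
product kernel, and integration against \<open>\<pi> \<otimes> \<pi>\<close> shows that \<open>h\<close> has a zero; as all one-step laws have
the same null sets, this zero spreads to all pairs of starting points (\<open>kernel_merging\<close>). Hence
the laws of the chain from any two starting points approach each other in total variation, and
averaging one of the points over \<open>\<pi>\<close> gives the convergence to \<open>\<pi>\<close>. Uniqueness and recurrence are then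
immediate, since \<open>\<pi>\<close> charges every set of positive Lebesgue measure.
\<close>

section \<open>Regeneration: invariant probabilities from drift and minorization\<close>

text \<open>Subtracting from every \<open>K x\<close> the part \<open>s x \<cdot> \<nu>\<close> that it dominates leaves a substochastic kernel.
The decomposition is stated for integrals of nonnegative functions, so that \<open>R\<close> can be used as a
positive linear operator without any subtraction of extended reals.\<close>

lemma residual_kernel:
  fixes \<nu> :: "'b measure" and s :: "'a \<Rightarrow> ennreal"
  assumes K: "K \<in> S \<rightarrow>\<^sub>M subprob_algebra T"
    and \<nu>: "finite_measure \<nu>" "sets \<nu> = sets T"
    and s: "s \<in> borel_measurable S" "\<And>x. x \<in> space S \<Longrightarrow> s x < \<infinity>"
    and minor: "\<And>x A. x \<in> space S \<Longrightarrow> A \<in> sets T \<Longrightarrow> s x * emeasure \<nu> A \<le> emeasure (K x) A"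
  obtains R where "R \<in> S \<rightarrow>\<^sub>M subprob_algebra T"
    and "\<And>x h. x \<in> space S \<Longrightarrow> h \<in> borel_measurable T \<Longrightarrow>
      (\<integral>\<^sup>+y. h y \<partial>K x) = (\<integral>\<^sup>+y. h y \<partial>R x) + s x * (\<integral>\<^sup>+y. h y \<partial>\<nu>)"
proof -
  define R where "R x = diff_measure (K x) (scale_measure (s x) \<nu>)" for x
  have setsK: "sets (K x) = sets T" and spaceK: "space (K x) = space T"
    and subK: "subprob_space (K x)" if "x \<in> space S" for x
    using measurable_space[OF K that] by (auto simp: space_subprob_algebra dest: sets_eq_imp_space_eq)
  have em: "emeasure (R x) A = emeasure (K x) A - s x * emeasure \<nu> A"
    if x: "x \<in> space S" and A: "A \<in> sets T" for x A
  proof -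
    interpret subprob_space "K x" using subK[OF x] .
    have "finite_measure (scale_measure (s x) \<nu>)"
      using \<nu>(1) s(2)[OF x] sets_eq_imp_space_eq[OF \<nu>(2)]
      by (intro finite_measureI)
        (auto simp: ennreal_mult_eq_top_iff finite_measure.emeasure_finite)
    then show ?thesis
      unfolding R_def using x A setsK[OF x] \<nu> minor[OF x]
      by (subst emeasure_diff_measure) (auto simp: finite_measure_axioms)
  qed
  have setsR: "sets (R x) = sets T" "space (R x) = space T" if "x \<in> space S" for x
    using that setsK spaceK by (auto simp: R_def)
  have decomp: "emeasure (K x) A = emeasure (R x) A + s x * emeasure \<nu> A"
    if x: "x \<in> space S" and A: "A \<in> sets T" for x A
    using minor[OF x A] by (simp add: em[OF x A] diff_add_cancel_ennreal)
  have "R \<in> S \<rightarrow>\<^sub>M subprob_algebra T"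
  proof (rule measurable_subprob_algebra)
    fix x assume x: "x \<in> space S"
    have "space (K x) \<noteq> {}" using subK[OF x] by (simp add: subprob_space.subprob_not_empty)
    moreover have "emeasure (R x) (space (R x)) \<le> 1"
      using subprob_space.emeasure_space_le_1[OF subK[OF x]] decomp[OF x sets.top] spaceK[OF x] setsR[OF x]
      by (metis add.right_neutral add_left_mono le_zero_eq order_trans zero_le)
    ultimately show "subprob_space (R x)"
      using setsR[OF x] spaceK[OF x] by (intro subprob_spaceI) auto
    show "sets (R x) = sets T" using setsR x by simp
  next
    fix A assume A: "A \<in> sets T"
    have "(\<lambda>x. emeasure (K x) A - s x * emeasure \<nu> A) \<in> borel_measurable S"
      using K s(1) A by measurable
    then show "(\<lambda>x. emeasure (R x) A) \<in> borel_measurable S"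
      using em[OF _ A] by (simp cong: measurable_cong)
  qed
  moreover have "(\<integral>\<^sup>+y. h y \<partial>K x) = (\<integral>\<^sup>+y. h y \<partial>R x) + s x * (\<integral>\<^sup>+y. h y \<partial>\<nu>)"
    if x: "x \<in> space S" and h: "h \<in> borel_measurable T" for x h
  proof -
    have mK: "borel_measurable (K x) = borel_measurable T"
      and mR: "borel_measurable (R x) = borel_measurable T"
      and mN: "borel_measurable \<nu> = borel_measurable T"
      using setsK[OF x] setsR[OF x] \<nu>(2) by (auto intro!: measurable_cong_sets)
    show ?thesis
      using h
    proof (induction rule: borel_measurable_induct)
      case (cong f g)
      then show ?case
        using nn_integral_cong[of "K x" f g] nn_integral_cong[of "R x" f g] nn_integral_cong[of \<nu> f g]
          spaceK[OF x] setsR[OF x] sets_eq_imp_space_eq[OF \<nu>(2)] by auto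
    next
      case (set A)
      then show ?case using decomp[OF x] setsK[OF x] setsR[OF x] \<nu>(2) by auto
    next
      case (mult u c)
      then show ?case
        by (simp add: nn_integral_cmult mK mR mN distrib_left ac_simps)
    next
      case (add u v)
      then show ?case
        by (simp add: nn_integral_add mK mR mN distrib_left ac_simps)
    next
      case (seq U)
      have inc: "incseq (\<lambda>i. \<integral>\<^sup>+y. U i y \<partial>M)" for M
        using seq(3) by (auto intro!: nn_integral_mono simp: incseq_def le_fun_def)
      have eq: "(\<integral>\<^sup>+y. (SUP i. U i) y \<partial>M) = (SUP i. \<integral>\<^sup>+y. U i y \<partial>M)"
        if "sets M = sets T" for M
      proof -
        have "\<And>i. U i \<in> borel_measurable M" using seq(1) that by (simp cong: measurable_cong_sets)
        from nn_integral_monotone_convergence_SUP[OF seq(3) this] show ?thesis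
          by (simp add: SUP_apply image_image)
      qed
      have "(SUP i. (\<integral>\<^sup>+y. U i y \<partial>R x) + s x * (\<integral>\<^sup>+y. U i y \<partial>\<nu>)) =
        (SUP i. (\<integral>\<^sup>+y. U i y \<partial>R x)) + (SUP i. s x * (\<integral>\<^sup>+y. U i y \<partial>\<nu>))"
        by (rule ennreal_SUP_add) (use inc in \<open>auto simp: incseq_def intro!: mult_left_mono\<close>)
      then show ?case
        unfolding eq[OF setsK[OF x]] eq[OF setsR(1)[OF x]] eq[OF \<nu>(2)] by (simp add: seq.IH SUP_mult_left_ennreal)
    qed
  qed
  ultimately show ?thesis by (rule that)
qed

lemma prob_kernel_total:
  assumes "K \<in> S \<rightarrow>\<^sub>M prob_algebra T" "x \<in> space S"
  shows "emeasure (K x) (space T) = 1"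
  using measurable_space[OF assms] prob_space.emeasure_space_1[of "K x"] sets_eq_imp_space_eq[of "K x" T]
  by (auto simp: space_prob_algebra)

primrec kernel_power :: "'a measure \<Rightarrow> ('a \<Rightarrow> 'a measure) \<Rightarrow> nat \<Rightarrow> 'a \<Rightarrow> 'a measure" where
  "kernel_power S K 0 = return S"
| "kernel_power S K (Suc n) = (\<lambda>x. kernel_power S K n x \<bind> K)"

lemma measurable_kernel_power:
  assumes K: "K \<in> S \<rightarrow>\<^sub>M prob_algebra S"
  shows "kernel_power S K n \<in> S \<rightarrow>\<^sub>M prob_algebra S"
proof (induction n)
  case 0
  then show ?case by (simp add: measurable_return_prob_space)
next
  case (Suc n)
  show ?case unfolding kernel_power.simps
    by (rule measurable_bind_prob_space[OF Suc K])
qed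

text \<open>The definition adds a step at the end; arguments that condition on the first step need it in front.\<close>

lemma kernel_power_Suc_front:
  assumes K: "K \<in> S \<rightarrow>\<^sub>M prob_algebra S" and x: "x \<in> space S"
  shows "kernel_power S K (Suc n) x = K x \<bind> kernel_power S K n"
proof (induction n)
  case 0
  have "sets (K x) = sets S" using measurable_space[OF K x] by (simp add: space_prob_algebra)
  then show ?case
    using x measurable_prob_algebraD[OF K] by (simp add: bind_return[of K S S] bind_return'')
next
  case (Suc n)
  have s: "sets (K x) = sets S" using measurable_space[OF K x] by (simp add: space_prob_algebra)
  have "kernel_power S K (Suc (Suc n)) x = K x \<bind> kernel_power S K n \<bind> K"
    using Suc by simp
  also have "\<dots> = K x \<bind> (\<lambda>y. kernel_power S K n y \<bind> K)"
    using measurable_prob_algebraD[OF measurable_kernel_power[OF K, of n]] measurable_prob_algebraD[OF K] s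
    by (intro bind_assoc[where N=S and R=S]) (auto cong: measurable_cong_sets)
  finally show ?case by simp
qed

lemma emeasure_kernel_power_Suc:
  assumes K: "K \<in> S \<rightarrow>\<^sub>M prob_algebra S" and x: "x \<in> space S" and A: "A \<in> sets S"
  shows "emeasure (kernel_power S K (Suc n) x) A = (\<integral>\<^sup>+y. emeasure (kernel_power S K n y) A \<partial>K x)"
proof -
  have "sets (K x) = sets S" using measurable_space[OF K x] by (simp add: space_prob_algebra)
  moreover have "space S \<noteq> {}" using x by auto
  ultimately show ?thesis
    unfolding kernel_power_Suc_front[OF K x]
    using A measurable_prob_algebraD[OF measurable_kernel_power[OF K, of n]]
    by (intro emeasure_bind) (auto cong: measurable_cong_sets dest: sets_eq_imp_space_eq)
qed

text \<open>Let \<open>Q\<close> be the residual of \<open>K\<close> after removal of \<open>\<epsilon> 1\<^sub>C \<otimes> \<nu>\<close>. It describes the chain between two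
regenerations, and \<open>\<mu> = \<Sum>\<^sub>n \<nu> Q\<^sup>n\<close> is the expected occupation measure of one such excursion. The drift
condition bounds the expected length of the excursion, so \<open>\<mu>\<close> is finite. Moreover
\<open>\<mu> K + \<nu> = \<mu> + \<epsilon> \<mu>(C) \<nu>\<close>, and comparing total masses gives \<open>\<epsilon> \<mu>(C) = 1\<close>, so that \<open>\<mu>\<close> is invariant.\<close>

theorem invariant_probability_from_drift:
  fixes V :: "'a \<Rightarrow> ennreal" and b \<epsilon> :: ennreal
  assumes K: "K \<in> S \<rightarrow>\<^sub>M prob_algebra S"
    and \<nu>: "prob_space \<nu>" "sets \<nu> = sets S"
    and C: "C \<in> sets S" and \<epsilon>: "0 < \<epsilon>" "\<epsilon> < \<infinity>" and b: "b < \<infinity>"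
    and minor: "\<And>x A. x \<in> C \<Longrightarrow> A \<in> sets S \<Longrightarrow> \<epsilon> * emeasure \<nu> A \<le> emeasure (K x) A"
    and V: "V \<in> borel_measurable S" "(\<integral>\<^sup>+x. V x \<partial>\<nu>) < \<infinity>"
    and drift: "\<And>x. x \<in> space S \<Longrightarrow> (\<integral>\<^sup>+y. V y \<partial>K x) + 1 \<le> V x + b * indicator C x"
  obtains \<pi> where "prob_space \<pi>" "sets \<pi> = sets S" "\<And>A. A \<in> sets S \<Longrightarrow> emeasure \<pi> A = (\<integral>\<^sup>+x. emeasure (K x) A \<partial>\<pi>)"
    "emeasure \<pi> C > 0"
proof -
  note Ks = measurable_prob_algebraD[OF K]
  interpret \<nu>: prob_space \<nu> by fact
  have sp\<nu>: "space \<nu> = space S" using \<nu>(2) by (rule sets_eq_imp_space_eq)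
  have ne: "space S \<noteq> {}" using \<nu>.not_empty sp\<nu> by simp
  define s :: "'a \<Rightarrow> ennreal" where "s x = \<epsilon> * indicator C x" for x
  have s_meas[measurable]: "s \<in> borel_measurable S" unfolding s_def using C by measurable
  obtain Q where Q: "Q \<in> S \<rightarrow>\<^sub>M subprob_algebra S"
    and dec: "\<And>x h. x \<in> space S \<Longrightarrow> h \<in> borel_measurable S \<Longrightarrow>
      (\<integral>\<^sup>+y. h y \<partial>K x) = (\<integral>\<^sup>+y. h y \<partial>Q x) + s x * (\<integral>\<^sup>+y. h y \<partial>\<nu>)"
  proof (rule residual_kernel[OF Ks \<nu>.finite_measure_axioms \<nu>(2) s_meas])
    show "s x < \<infinity>" for x using \<epsilon> by (auto simp: s_def indicator_def)
    show "s x * emeasure \<nu> A \<le> emeasure (K x) A" if "A \<in> sets S" for x A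
      using minor[OF _ that] by (auto simp: s_def indicator_def)
  qed auto
  define N where "N n = ((\<lambda>\<mu>. \<mu> \<bind> Q) ^^ n) \<nu>" for n
  have N0: "N 0 = \<nu>" and NS: "N (Suc n) = N n \<bind> Q" for n by (auto simp: N_def)
  have N: "sets (N n) = sets S \<and> subprob_space (N n)" for n
  proof (induction n)
    case 0
    then show ?case using \<nu> N0 by (simp add: \<nu>.subprob_space_axioms)
  next
    case (Suc n)
    then interpret n: subprob_space "N n" by simp
    have Q': "Q \<in> N n \<rightarrow>\<^sub>M subprob_algebra S" using Q Suc by (simp cong: measurable_cong_sets)
    show ?case using Suc Q' ne sets_eq_imp_space_eq[of "N n" S] unfolding NS
      by (auto intro!: subprob_space_bind sets_bind sets_kernel[OF Q])
  qed
  have spN: "space (N n) = space S" for n using N sets_eq_imp_space_eq by blast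
  have mN: "borel_measurable (N n) = borel_measurable S" for n using N by (intro measurable_cong_sets) auto
  have int_NS: "(\<integral>\<^sup>+y. h y \<partial>N (Suc n)) = (\<integral>\<^sup>+x. \<integral>\<^sup>+y. h y \<partial>Q x \<partial>N n)"
    if "h \<in> borel_measurable S" for h n
    unfolding NS using that Q N by (intro nn_integral_bind[where B=S]) (auto cong: measurable_cong_sets)
  have measQ: "(\<lambda>x. \<integral>\<^sup>+y. h y \<partial>Q x) \<in> borel_measurable S"
   and measK: "(\<lambda>x. \<integral>\<^sup>+y. h y \<partial>K x) \<in> borel_measurable S"
    if "h \<in> borel_measurable S" for h
    using that Q Ks by (auto intro: measurable_compose[OF _ nn_integral_measurable_subprob_algebra])
  have step: "(\<integral>\<^sup>+x. \<integral>\<^sup>+y. h y \<partial>K x \<partial>N n) = (\<integral>\<^sup>+y. h y \<partial>N (Suc n)) + (\<integral>\<^sup>+x. s x \<partial>N n) * (\<integral>\<^sup>+y. h y \<partial>\<nu>)"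
    if h: "h \<in> borel_measurable S" for h n
  proof -
    have "(\<integral>\<^sup>+x. \<integral>\<^sup>+y. h y \<partial>K x \<partial>N n) = (\<integral>\<^sup>+x. (\<integral>\<^sup>+y. h y \<partial>Q x) + s x * (\<integral>\<^sup>+y. h y \<partial>\<nu>) \<partial>N n)"
      by (intro nn_integral_cong) (simp add: spN dec h)
    also have "\<dots> = (\<integral>\<^sup>+x. \<integral>\<^sup>+y. h y \<partial>Q x \<partial>N n) + (\<integral>\<^sup>+x. s x \<partial>N n) * (\<integral>\<^sup>+y. h y \<partial>\<nu>)"
    proof -
      have 1: "(\<lambda>x. \<integral>\<^sup>+y. h y \<partial>Q x) \<in> borel_measurable (N n)" "s \<in> borel_measurable (N n)"
        by (simp_all add: mN measQ h s_meas)
      then have "(\<lambda>x. s x * (\<integral>\<^sup>+y. h y \<partial>\<nu>)) \<in> borel_measurable (N n)" by simp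
      then show ?thesis using 1 by (simp only: nn_integral_add nn_integral_multc)
    qed
    finally show ?thesis by (simp add: int_NS h)
  qed
  \<comment> \<open>Adding the constant \<open>b / \<epsilon>\<close> to \<open>V\<close> turns the drift condition for \<open>K\<close> into a
    drift condition for the residual kernel \<open>Q\<close> without an exceptional set: on \<open>C\<close>
    the kernel \<open>Q\<close> loses the mass \<open>\<epsilon>\<close>.\<close>
  define U where "U x = V x + b / \<epsilon>" for x
  have U: "U \<in> borel_measurable S" unfolding U_def using V by measurable
  have U_drift: "(\<integral>\<^sup>+y. U y \<partial>Q x) + 1 \<le> U x" if x: "x \<in> space S" for x
  proof -
    have e: "b / \<epsilon> * s x = b * indicator C x"
      using \<epsilon> unfolding s_def by (cases "x \<in> C") (simp_all add: ennreal_divide_times less_top)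
    have spQ: "space (Q x) = space S" and sQ: "sets (Q x) = sets S"
      using measurable_space[OF Q x] by (auto simp: space_subprob_algebra dest: sets_eq_imp_space_eq)
    have "emeasure (K x) (space S) = 1"
      by (rule prob_kernel_total[OF K x])
    moreover have "emeasure (K x) (space S) = emeasure (Q x) (space S) + s x"
      using dec[OF x, of "indicator (space S)"] sQ \<nu>(2) \<nu>.emeasure_space_1 sp\<nu> Ks x by (simp add: sets_kernel[OF Ks])
    ultimately have q1: "emeasure (Q x) (space S) + s x = 1" by simp
    have "(\<integral>\<^sup>+y. U y \<partial>Q x) = (\<integral>\<^sup>+y. V y \<partial>Q x) + b / \<epsilon> * emeasure (Q x) (space S)"
      unfolding U_def using V(1) sQ spQ by (subst nn_integral_add) (auto cong: measurable_cong_sets)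
    then have "(\<integral>\<^sup>+y. U y \<partial>Q x) + 1 + b * indicator C x = (\<integral>\<^sup>+y. V y \<partial>Q x) + 1 + b / \<epsilon> * (emeasure (Q x) (space S) + s x)"
      by (simp only: distrib_left e[symmetric] ac_simps)
    also have "\<dots> = (\<integral>\<^sup>+y. V y \<partial>Q x) + 1 + b / \<epsilon>" by (simp add: q1)
    also have "\<dots> \<le> (\<integral>\<^sup>+y. V y \<partial>K x) + 1 + b / \<epsilon>"
      unfolding dec[OF x V(1)] by (intro add_right_mono) (simp add: )
    also have "\<dots> \<le> V x + b * indicator C x + b / \<epsilon>" using drift[OF x] by (intro add_right_mono)
    also have "\<dots> = U x + b * indicator C x" by (simp add: U_def ac_simps)
    finally have "b * indicator C x + ((\<integral>\<^sup>+y. U y \<partial>Q x) + 1) \<le> b * indicator C x + U x" by (simp add: ac_simps)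
    moreover have "b * indicator C x \<noteq> \<top>" using b by (auto simp: indicator_def)
    ultimately show ?thesis by (simp only: ennreal_add_left_cancel_le) simp
  qed
  have U_fin: "(\<integral>\<^sup>+x. U x \<partial>\<nu>) < \<infinity>"
  proof -
    have "(\<integral>\<^sup>+x. U x \<partial>\<nu>) = (\<integral>\<^sup>+x. V x \<partial>\<nu>) + b / \<epsilon>"
      unfolding U_def using V(1) \<nu>(2) \<nu>.emeasure_space_1
      by (subst nn_integral_add) (auto cong: measurable_cong_sets)
    then show ?thesis using V(2) b \<epsilon> by (auto simp: ennreal_divide_eq_top_iff less_top[symmetric])
  qed
  have tele: "(\<Sum>k<n. emeasure (N k) (space S)) + (\<integral>\<^sup>+x. U x \<partial>N n) \<le> (\<integral>\<^sup>+x. U x \<partial>\<nu>)" for n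
  proof (induction n)
    case 0
    then show ?case by (simp add: N0)
  next
    case (Suc n)
    have "(\<integral>\<^sup>+x. U x \<partial>N (Suc n)) + emeasure (N n) (space S) = (\<integral>\<^sup>+x. (\<integral>\<^sup>+y. U y \<partial>Q x) + 1 \<partial>N n)"
      using measQ[OF U] by (subst nn_integral_add) (simp_all add: int_NS U mN spN)
    also have "\<dots> \<le> (\<integral>\<^sup>+x. U x \<partial>N n)"
      by (intro nn_integral_mono) (simp add: spN U_drift)
    finally have "(\<Sum>k<n. emeasure (N k) (space S)) + ((\<integral>\<^sup>+x. U x \<partial>N (Suc n)) + emeasure (N n) (space S)) \<le> (\<integral>\<^sup>+x. U x \<partial>\<nu>)"
      using Suc by (meson add_left_mono order_trans)
    then show ?case by (simp add: ac_simps)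
  qed
  have sum_fin: "(\<Sum>k. emeasure (N k) (space S)) < \<infinity>"
  proof -
    have "(\<Sum>k. emeasure (N k) (space S)) \<le> (\<integral>\<^sup>+x. U x \<partial>\<nu>)"
          proof (intro suminf_le_const summableI)
      show "(\<Sum>k<n. emeasure (N k) (space S)) \<le> (\<integral>\<^sup>+x. U x \<partial>\<nu>)" for n
        by (rule order_trans[OF _ tele[of n]]) simp
    qed
    then show ?thesis using U_fin by (rule order_le_less_trans)
  qed
  \<comment> \<open>Binding over the counting measure on the naturals sums the measures \<open>N n\<close>.\<close>
  define \<mu> where "\<mu> = (count_space (UNIV::nat set)) \<bind> N"
  have Nm: "N \<in> count_space UNIV \<rightarrow>\<^sub>M subprob_algebra S"
    using N by (auto simp: space_subprob_algebra)
  have sets\<mu>: "sets \<mu> = sets S" unfolding \<mu>_def by (rule sets_bind) (use N in auto)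
  have sp\<mu>: "space \<mu> = space S" using sets\<mu> by (rule sets_eq_imp_space_eq)
  have int\<mu>: "(\<integral>\<^sup>+x. h x \<partial>\<mu>) = (\<Sum>n. \<integral>\<^sup>+x. h x \<partial>N n)" if "h \<in> borel_measurable S" for h
    unfolding \<mu>_def by (subst nn_integral_bind[OF that Nm]) (simp add: nn_integral_count_space_nat)
  have em\<mu>: "emeasure \<mu> A = (\<Sum>n. emeasure (N n) A)" if "A \<in> sets S" for A
    unfolding \<mu>_def by (subst emeasure_bind[OF _ Nm that]) (simp_all add: nn_integral_count_space_nat)
  have \<mu>fin: "emeasure \<mu> (space S) < \<infinity>" using sum_fin by (simp add: em\<mu>)
  have \<mu>fin': "emeasure \<mu> A \<noteq> \<infinity>" for A
    using \<mu>fin emeasure_space[of \<mu> A] by (auto simp: sp\<mu> top_unique)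
  have inv0: "(\<integral>\<^sup>+x. emeasure (K x) A \<partial>\<mu>) + emeasure \<nu> A = emeasure \<mu> A + (\<integral>\<^sup>+x. s x \<partial>\<mu>) * emeasure \<nu> A"
    if A: "A \<in> sets S" for A
  proof -
    have hA: "indicator A \<in> borel_measurable S" using A by simp
    have eK: "(\<integral>\<^sup>+x. \<integral>\<^sup>+y. indicator A y \<partial>K x \<partial>N n) = (\<integral>\<^sup>+x. emeasure (K x) A \<partial>N n)" for n
      using A by (intro nn_integral_cong nn_integral_indicator) (simp add: spN sets_kernel[OF Ks])
    have "(\<integral>\<^sup>+x. emeasure (K x) A \<partial>\<mu>) = (\<Sum>n. \<integral>\<^sup>+x. emeasure (K x) A \<partial>N n)"
      using A Ks by (intro int\<mu>) measurable
    also have "\<dots> = (\<Sum>n. emeasure (N (Suc n)) A + (\<integral>\<^sup>+x. s x \<partial>N n) * emeasure \<nu> A)"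
      using step[OF hA] A N \<nu>(2) by (simp add: eK)
    also have "\<dots> = (\<Sum>n. emeasure (N (Suc n)) A) + (\<integral>\<^sup>+x. s x \<partial>\<mu>) * emeasure \<nu> A"
      by (subst suminf_add[symmetric]) (auto simp: int\<mu>)
    finally have "(\<integral>\<^sup>+x. emeasure (K x) A \<partial>\<mu>) = (\<Sum>n. emeasure (N (Suc n)) A) + (\<integral>\<^sup>+x. s x \<partial>\<mu>) * emeasure \<nu> A" .
    moreover have "emeasure \<mu> A = (\<Sum>n. emeasure (N (Suc n)) A) + emeasure \<nu> A"
      unfolding em\<mu>[OF A] using suminf_offset[of "\<lambda>n. emeasure (N n) A" 1] by (simp add: N0 ac_simps)
    ultimately show ?thesis by (simp add: ac_simps)
  qed
  \<comment> \<open>Total masses are compared in \<open>inv0\<close>: those of \<open>\<mu> K\<close> and \<open>\<mu>\<close> agree, so the coefficient of \<open>\<nu>\<close> is 1.\<close>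
  have s1: "(\<integral>\<^sup>+x. s x \<partial>\<mu>) = 1"
  proof -
    have "(\<integral>\<^sup>+x. emeasure (K x) (space S) \<partial>\<mu>) = (\<integral>\<^sup>+x. 1 \<partial>\<mu>)"
      by (intro nn_integral_cong prob_kernel_total[OF K]) (simp add: sp\<mu>)
    then have "emeasure \<mu> (space S) + 1 = emeasure \<mu> (space S) + (\<integral>\<^sup>+x. s x \<partial>\<mu>)"
      using inv0[OF sets.top] \<nu>.emeasure_space_1 by (simp add: sp\<nu> sp\<mu>)
    then show ?thesis using \<mu>fin by (metis ennreal_add_left_cancel infinity_ennreal_def less_irrefl)
  qed
  have inv: "(\<integral>\<^sup>+x. emeasure (K x) A \<partial>\<mu>) = emeasure \<mu> A" if A: "A \<in> sets S" for A
  proof -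
    have "emeasure \<nu> A + (\<integral>\<^sup>+x. emeasure (K x) A \<partial>\<mu>) = emeasure \<nu> A + emeasure \<mu> A"
      using inv0[OF A] by (simp add: s1 ac_simps)
    then show ?thesis using \<nu>.emeasure_finite[of A] by (metis ennreal_add_left_cancel infinity_ennreal_def)
  qed
  have \<mu>C: "emeasure \<mu> C > 0"
  proof -
    have "(\<integral>\<^sup>+x. s x \<partial>\<mu>) = \<epsilon> * emeasure \<mu> C" unfolding s_def using C sets\<mu> by (simp add: nn_integral_cmult)
    then show ?thesis using s1 by (metis mult_zero_right not_gr_zero zero_neq_one)
  qed
  define m where "m = emeasure \<mu> (space S)"
  have m: "0 < m" "m < \<infinity>"
    using \<mu>C \<mu>fin emeasure_mono[of C "space S" \<mu>] sets.sets_into_space[OF C] sets\<mu>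
    by (auto simp: m_def)
  define \<pi> where "\<pi> = scale_measure (1 / m) \<mu>"
  show ?thesis
  proof (rule that)
    show sets: "sets \<pi> = sets S" by (simp add: \<pi>_def sets\<mu>)
    show "prob_space \<pi>"
      using m by (intro prob_spaceI) (simp add: \<pi>_def sp\<mu> m_def[symmetric] space_scale_measure ennreal_divide_times divide_ennreal_def ennreal_inverse_mult mult.commute ennreal_divide_self[unfolded divide_ennreal_def])
    show "emeasure \<pi> A = (\<integral>\<^sup>+x. emeasure (K x) A \<partial>\<pi>)" if A: "A \<in> sets S" for A
    proof -
      have "(\<lambda>x. emeasure (K x) A) \<in> borel_measurable \<mu>"
        using Ks A by (simp add: sets\<mu> cong: measurable_cong_sets) 
      then show ?thesis unfolding \<pi>_def by (simp add: nn_integral_scale_measure inv[OF A])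
    qed
    show "emeasure \<pi> C > 0"
      using \<mu>C m by (simp add: \<pi>_def ennreal_zero_less_mult_iff ennreal_zero_less_divide)
  qed
qed

section \<open>Merging of two copies and convergence in total variation\<close>

lemma invariant_nn_integral:
  assumes K: "K \<in> S \<rightarrow>\<^sub>M prob_algebra S"
    and \<pi>: "prob_space \<pi>" "sets \<pi> = sets S"
    and inv: "\<And>A. A \<in> sets S \<Longrightarrow> emeasure \<pi> A = (\<integral>\<^sup>+x. emeasure (K x) A \<partial>\<pi>)"
    and h: "h \<in> borel_measurable S"
  shows "(\<integral>\<^sup>+x. \<integral>\<^sup>+y. h y \<partial>K x \<partial>\<pi>) = (\<integral>\<^sup>+y. h y \<partial>\<pi>)"
proof -
  note Ks = measurable_prob_algebraD[OF K]
  interpret \<pi>: prob_space \<pi> by fact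
  have sp\<pi>: "space \<pi> = space S" using \<pi>(2) by (rule sets_eq_imp_space_eq)
  have "\<pi> = \<pi> \<bind> K"
  proof (rule measure_eqI)
    show "sets \<pi> = sets (\<pi> \<bind> K)"
      using \<pi> sets_kernel[OF Ks] sp\<pi> \<pi>.not_empty by (subst sets_bind) auto
    show "emeasure \<pi> A = emeasure (\<pi> \<bind> K) A" if "A \<in> sets \<pi>" for A
      using that \<pi>(2) Ks inv \<pi>.not_empty
      by (subst emeasure_bind[where N=S]) (auto cong: measurable_cong_sets)
  qed
  then have "(\<integral>\<^sup>+y. h y \<partial>\<pi>) = (\<integral>\<^sup>+y. h y \<partial>(\<pi> \<bind> K))" by simp
  also have "\<dots> = (\<integral>\<^sup>+x. \<integral>\<^sup>+y. h y \<partial>K x \<partial>\<pi>)"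
    using h \<pi>(2) Ks by (intro nn_integral_bind[where B=S]) (auto cong: measurable_cong_sets)
  finally show ?thesis by simp
qed

text \<open>Run two independent copies of the chain, with product kernel \<open>P\<close>, and let \<open>R\<close> be the residual of \<open>P\<close>
after removal of \<open>s \<otimes> (\<nu> \<otimes> \<nu>)\<close> with \<open>s = \<epsilon>\<^sup>2 1\<^sub>C\<^sub>\<times>\<^sub>C\<close>. Under \<open>\<nu> \<otimes> \<nu>\<close> both coordinates have the same
law, so only \<open>R\<close> can keep the two copies apart, and \<open>r n = R\<^sup>n 1\<close> bounds their distance after \<open>n\<close> steps.

The limit \<open>h\<close> of \<open>r n\<close> satisfies \<open>h = R h\<close>, that is, \<open>P h = h + s \<cdot> (\<nu> \<otimes> \<nu>)(h)\<close>. Integrating against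
the invariant probability \<open>\<pi> \<otimes> \<pi>\<close> of \<open>P\<close> cancels \<open>h\<close> and leaves \<open>(\<nu> \<otimes> \<nu>)(h) = 0\<close>. Therefore
\<open>h\<close> has a zero and satisfies \<open>P h = h\<close>. At the zero this says that \<open>h = 0\<close> almost surely after one
step; as all one-step laws have the same null sets, the same is true from every other point, and
\<open>h = P h = 0\<close> everywhere.\<close>

theorem kernel_merging:
  fixes \<epsilon> :: ennreal and K :: "'a \<Rightarrow> 'a measure"
  assumes K: "K \<in> S \<rightarrow>\<^sub>M prob_algebra S"
    and \<nu>: "prob_space \<nu>" "sets \<nu> = sets S"
    and C: "C \<in> sets S" and \<epsilon>: "0 < \<epsilon>" "\<epsilon> < \<infinity>"
    and minor: "\<And>x A. x \<in> C \<Longrightarrow> A \<in> sets S \<Longrightarrow> \<epsilon> * emeasure \<nu> A \<le> emeasure (K x) A"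
    and \<pi>: "prob_space \<pi>" "sets \<pi> = sets S" "emeasure \<pi> C > 0"
    and inv: "\<And>A. A \<in> sets S \<Longrightarrow> emeasure \<pi> A = (\<integral>\<^sup>+x. emeasure (K x) A \<partial>\<pi>)"
    and equiv: "\<And>x y A. x \<in> space S \<Longrightarrow> y \<in> space S \<Longrightarrow> A \<in> sets S \<Longrightarrow>
      emeasure (K x) A = 0 \<Longrightarrow> emeasure (K y) A = 0"
  obtains r :: "nat \<Rightarrow> 'a \<times> 'a \<Rightarrow> ennreal"
  where "\<And>n. r n \<in> borel_measurable (S \<Otimes>\<^sub>M S)" "\<And>n z. r n z \<le> 1"
    and "\<And>x y. x \<in> space S \<Longrightarrow> y \<in> space S \<Longrightarrow> (\<lambda>n. r n (x, y)) \<longlonglongrightarrow> 0"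
    and "\<And>n x y A. x \<in> space S \<Longrightarrow> y \<in> space S \<Longrightarrow> A \<in> sets S \<Longrightarrow>
      emeasure (kernel_power S K n x) A \<le> emeasure (kernel_power S K n y) A + r n (x, y)"
proof -
  note Ks = measurable_prob_algebraD[OF K]
  interpret \<nu>: prob_space \<nu> by fact
  interpret \<pi>: prob_space \<pi> by fact
  have sp\<nu>: "space \<nu> = space S" using \<nu>(2) by (rule sets_eq_imp_space_eq)
  have sp\<pi>: "space \<pi> = space S" using \<pi>(2) by (rule sets_eq_imp_space_eq)
  have Kx: "sets (K x) = sets S" "space (K x) = space S" "prob_space (K x)" if "x \<in> space S" for x
    using measurable_space[OF K that] by (auto simp: space_prob_algebra dest: sets_eq_imp_space_eq)
  have CS: "C \<subseteq> space S" using C by (rule sets.sets_into_space)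
  have minor_int: "\<epsilon> * (\<integral>\<^sup>+y. h y \<partial>\<nu>) \<le> (\<integral>\<^sup>+y. h y \<partial>K x)" if "x \<in> C" "h \<in> borel_measurable S" for x h
  proof -
    have "(\<lambda>x. \<epsilon> * indicator C x) \<in> borel_measurable S" using C by measurable
    then obtain Q :: "'a \<Rightarrow> 'a measure" where "\<And>x h. x \<in> space S \<Longrightarrow> h \<in> borel_measurable S \<Longrightarrow>
      (\<integral>\<^sup>+y. h y \<partial>K x) = (\<integral>\<^sup>+y. h y \<partial>Q x) + \<epsilon> * indicator C x * (\<integral>\<^sup>+y. h y \<partial>\<nu>)"
    proof (rule residual_kernel[OF Ks \<nu>.finite_measure_axioms \<nu>(2)])
      show "\<epsilon> * indicator C x < \<infinity>" for x using \<epsilon> by (cases "x \<in> C") auto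
      show "\<epsilon> * indicator C x * emeasure \<nu> A \<le> emeasure (K x) A" if "A \<in> sets S" for x A
        using minor[OF _ that] by (cases "x \<in> C") auto
    qed blast
    from this[of x h]
    show ?thesis using that CS by auto
  qed
  define P where "P z = K (fst z) \<Otimes>\<^sub>M K (snd z)" for z
  define \<nu>2 where "\<nu>2 = \<nu> \<Otimes>\<^sub>M \<nu>"
  interpret \<nu>2: pair_prob_space \<nu> \<nu> ..
  have \<nu>2: "prob_space \<nu>2" "sets \<nu>2 = sets (S \<Otimes>\<^sub>M S)"
    using \<nu>2.prob_space_axioms \<nu>(2) by (auto simp: \<nu>2_def cong: sets_pair_measure_cong)
  interpret N2: prob_space \<nu>2 by fact
  have P: "P \<in> S \<Otimes>\<^sub>M S \<rightarrow>\<^sub>M subprob_algebra (S \<Otimes>\<^sub>M S)"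
    unfolding P_def by (intro measurable_pair_measure measurable_compose[OF measurable_fst Ks] measurable_compose[OF measurable_snd Ks])
  have intP: "(\<integral>\<^sup>+z. h z \<partial>P (x, y)) = (\<integral>\<^sup>+x'. \<integral>\<^sup>+y'. h (x', y') \<partial>K y \<partial>K x)"
    if "x \<in> space S" "y \<in> space S" "h \<in> borel_measurable (S \<Otimes>\<^sub>M S)" for x y h
  proof -
    interpret Ky: prob_space "K y" using Kx that by auto
    have "h \<in> borel_measurable (K x \<Otimes>\<^sub>M K y)"
      using that Kx[OF that(1)] Kx[OF that(2)] by (simp cong: measurable_cong_sets sets_pair_measure_cong)
    then show ?thesis unfolding P_def by (simp add: Ky.nn_integral_fst)
  qed
  have int\<nu>2: "(\<integral>\<^sup>+z. h z \<partial>\<nu>2) = (\<integral>\<^sup>+x'. \<integral>\<^sup>+y'. h (x', y') \<partial>\<nu> \<partial>\<nu>)"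
    if "h \<in> borel_measurable (S \<Otimes>\<^sub>M S)" for h
  proof -
    have "h \<in> borel_measurable (\<nu> \<Otimes>\<^sub>M \<nu>)"
      using that \<nu>(2) by (simp cong: measurable_cong_sets sets_pair_measure_cong)
    then show ?thesis unfolding \<nu>2_def by (simp add: \<nu>.nn_integral_fst)
  qed
  have meas2: "(\<lambda>x'. \<integral>\<^sup>+y'. h (x', y') \<partial>N) \<in> borel_measurable S"
    if "h \<in> borel_measurable (S \<Otimes>\<^sub>M S)" "prob_space N" "sets N = sets S" for h and N :: "'a measure"
  proof -
    interpret N: prob_space N by fact
    have "h \<in> borel_measurable (S \<Otimes>\<^sub>M N)" using that by (simp cong: measurable_cong_sets sets_pair_measure_cong)
    then show ?thesis using N.borel_measurable_nn_integral_fst[of h S] by simp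
  qed
  define s :: "'a \<times> 'a \<Rightarrow> ennreal" where "s z = \<epsilon> * \<epsilon> * indicator (C \<times> C) z" for z
  have CC: "C \<times> C \<in> sets (S \<Otimes>\<^sub>M S)" using C by simp
  have s_meas: "s \<in> borel_measurable (S \<Otimes>\<^sub>M S)" unfolding s_def using CC by measurable
  obtain R where R: "R \<in> S \<Otimes>\<^sub>M S \<rightarrow>\<^sub>M subprob_algebra (S \<Otimes>\<^sub>M S)"
    and dec: "\<And>z h. z \<in> space (S \<Otimes>\<^sub>M S) \<Longrightarrow> h \<in> borel_measurable (S \<Otimes>\<^sub>M S) \<Longrightarrow>
      (\<integral>\<^sup>+y. h y \<partial>P z) = (\<integral>\<^sup>+y. h y \<partial>R z) + s z * (\<integral>\<^sup>+y. h y \<partial>\<nu>2)"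
  proof (rule residual_kernel[OF P N2.finite_measure_axioms \<nu>2(2) s_meas])
    show "s z < \<infinity>" for z using \<epsilon> by (cases "z \<in> C \<times> C") (simp_all add: s_def ennreal_mult_less_top)
    show "s z * emeasure \<nu>2 A \<le> emeasure (P z) A"
      if z: "z \<in> space (S \<Otimes>\<^sub>M S)" and A: "A \<in> sets (S \<Otimes>\<^sub>M S)" for z A
    proof (cases "z \<in> C \<times> C")
      case True
      then obtain x y where xy: "z = (x, y)" "x \<in> C" "y \<in> C" by auto
      then have xyS: "x \<in> space S" "y \<in> space S" using CS by auto
      have sA: "A \<in> sets (P z)" using measurable_space[OF P z] A by (simp add: space_subprob_algebra)
      have iA: "indicator A \<in> borel_measurable (S \<Otimes>\<^sub>M S)" using A by simp
      have "\<epsilon> * \<epsilon> * emeasure \<nu>2 A = \<epsilon> * (\<epsilon> * (\<integral>\<^sup>+x'. \<integral>\<^sup>+y'. indicator A (x', y') \<partial>\<nu> \<partial>\<nu>))"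
        using int\<nu>2[OF iA] A \<nu>2(2) by (simp add: mult.assoc)
      also have "\<dots> \<le> \<epsilon> * (\<integral>\<^sup>+x'. \<integral>\<^sup>+y'. indicator A (x', y') \<partial>\<nu> \<partial>K x)"
        using xy(2) \<nu> by (intro mult_left_mono minor_int meas2[OF iA]) auto
      also have "\<dots> = (\<integral>\<^sup>+x'. \<epsilon> * (\<integral>\<^sup>+y'. indicator A (x', y') \<partial>\<nu>) \<partial>K x)"
        using meas2[OF iA \<nu>] Kx[OF xyS(1)] by (subst nn_integral_cmult) (auto cong: measurable_cong_sets)
      also have "\<dots> \<le> (\<integral>\<^sup>+x'. \<integral>\<^sup>+y'. indicator A (x', y') \<partial>K y \<partial>K x)"
        using xy(3) Kx[OF xyS(1)] iA by (intro nn_integral_mono minor_int) (auto intro: measurable_compose[OF measurable_Pair1' iA])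
      also have "\<dots> = emeasure (P z) A"
        using intP[OF xyS iA] sA xy by simp
      finally show ?thesis using True by (simp add: s_def)
    qed (simp add: s_def)
  qed auto
  have spR: "space (R z) = space (S \<Otimes>\<^sub>M S)" "sets (R z) = sets (S \<Otimes>\<^sub>M S)" "emeasure (R z) (space (S \<Otimes>\<^sub>M S)) \<le> 1"
    if "z \<in> space (S \<Otimes>\<^sub>M S)" for z
    using measurable_space[OF R that] subprob_space.emeasure_space_le_1[of "R z"]
    by (auto simp: space_subprob_algebra dest: sets_eq_imp_space_eq)
  have mR: "(\<lambda>z. \<integral>\<^sup>+z'. h z' \<partial>R z) \<in> borel_measurable (S \<Otimes>\<^sub>M S)" if "h \<in> borel_measurable (S \<Otimes>\<^sub>M S)" for h
    using that R by (auto intro: measurable_compose[OF _ nn_integral_measurable_subprob_algebra])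
  define r :: "nat \<Rightarrow> 'a \<times> 'a \<Rightarrow> ennreal"
    where "r n = ((\<lambda>h z. if z \<in> space (S \<Otimes>\<^sub>M S) then \<integral>\<^sup>+z'. h z' \<partial>R z else 0) ^^ n) (\<lambda>_. 1)" for n
  have r0: "r 0 = (\<lambda>_. 1)" by (simp add: r_def)
  have rS: "r (Suc n) z = (\<integral>\<^sup>+z'. r n z' \<partial>R z)" if "z \<in> space (S \<Otimes>\<^sub>M S)" for n z
    using that by (simp add: r_def)
  have r_meas: "r n \<in> borel_measurable (S \<Otimes>\<^sub>M S)" for n
  proof (induction n)
    case (Suc n)
    then show ?case using mR[OF Suc] rS by (simp cong: measurable_cong)
  qed (simp add: r0)
  have r_mono: "r (Suc n) z \<le> r n z" for n z
  proof (induction n arbitrary: z)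
    case 0
    show ?case
    proof (cases "z \<in> space (S \<Otimes>\<^sub>M S)")
      case True then show ?thesis using spR[OF True] by (simp add: r0 rS)
    qed (simp add: r_def)
  next
    case (Suc n)
    show ?case
    proof (cases "z \<in> space (S \<Otimes>\<^sub>M S)")
      case True then show ?thesis using Suc by (auto simp: rS intro!: nn_integral_mono)
    qed (simp add: r_def)
  qed
  have r_dec: "decseq (\<lambda>n. r n z)" for z by (rule decseq_SucI) (rule r_mono)
  have r_le1: "r n z \<le> 1" for n z using decseqD[OF r_dec, of 0 n z] by (simp add: r0)
  define h where "h z = (INF n. r n z)" for z
  have h_meas: "h \<in> borel_measurable (S \<Otimes>\<^sub>M S)" unfolding h_def using r_meas by measurable
  have h_le1: "h z \<le> 1" for z unfolding h_def using r_le1[of 0 z] by (auto intro: INF_lower2)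
  have r_lim: "(\<lambda>n. r n z) \<longlonglongrightarrow> h z" for z
    unfolding h_def by (rule LIMSEQ_INF) (rule r_dec)
  have hR: "h z = (\<integral>\<^sup>+z'. h z' \<partial>R z)" if z: "z \<in> space (S \<Otimes>\<^sub>M S)" for z
  proof -
    have "(\<lambda>n. \<integral>\<^sup>+z'. r n z' \<partial>R z) \<longlonglongrightarrow> (\<integral>\<^sup>+z'. h z' \<partial>R z)"
    proof (rule nn_integral_dominated_convergence[where w="\<lambda>_. 1"])
      show "(\<integral>\<^sup>+_. 1 \<partial>R z) < \<infinity>" using spR[OF z] by (simp add: le_less_trans[OF _ ennreal_one_less_top])
    qed (use r_meas h_meas spR[OF z] r_le1 r_lim in \<open>auto cong: measurable_cong_sets\<close>)
    moreover have "(\<lambda>n. \<integral>\<^sup>+z'. r n z' \<partial>R z) \<longlonglongrightarrow> h z"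
      using LIMSEQ_Suc[OF r_lim[of z]] by (simp add: rS[OF z])
    ultimately show ?thesis by (rule LIMSEQ_unique[rotated])
  qed
  have inv_int: "(\<integral>\<^sup>+x. \<integral>\<^sup>+y. h y \<partial>K x \<partial>\<pi>) = (\<integral>\<^sup>+y. h y \<partial>\<pi>)" if "h \<in> borel_measurable S" for h
    using inv that by (rule invariant_nn_integral[OF K \<pi>(1,2)])
  define \<pi>2 where "\<pi>2 = \<pi> \<Otimes>\<^sub>M \<pi>"
  interpret pp: pair_prob_space \<pi> \<pi> ..
  interpret \<pi>2: prob_space \<pi>2 unfolding \<pi>2_def by unfold_locales
  have sets\<pi>2: "sets \<pi>2 = sets (S \<Otimes>\<^sub>M S)" using \<pi>(2) by (auto simp: \<pi>2_def cong: sets_pair_measure_cong)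
  have sp\<pi>2: "space \<pi>2 = space (S \<Otimes>\<^sub>M S)" using sets\<pi>2 by (rule sets_eq_imp_space_eq)
  have int\<pi>2: "(\<integral>\<^sup>+z. h z \<partial>\<pi>2) = (\<integral>\<^sup>+x'. \<integral>\<^sup>+y'. h (x', y') \<partial>\<pi> \<partial>\<pi>)"
    if "h \<in> borel_measurable (S \<Otimes>\<^sub>M S)" for h
  proof -
    have "h \<in> borel_measurable (\<pi> \<Otimes>\<^sub>M \<pi>)"
      using that \<pi>(2) by (simp cong: measurable_cong_sets sets_pair_measure_cong)
    then show ?thesis unfolding \<pi>2_def by (simp add: \<pi>.nn_integral_fst)
  qed
  have inv2: "(\<integral>\<^sup>+z. \<integral>\<^sup>+z'. h z' \<partial>P z \<partial>\<pi>2) = (\<integral>\<^sup>+z. h z \<partial>\<pi>2)"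
  proof -
    have mP: "(\<lambda>z. \<integral>\<^sup>+z'. h z' \<partial>P z) \<in> borel_measurable (S \<Otimes>\<^sub>M S)"
      using h_meas P by (auto intro: measurable_compose[OF _ nn_integral_measurable_subprob_algebra])
    have mKy: "(\<lambda>(y, x'). \<integral>\<^sup>+y'. h (x', y') \<partial>K y) \<in> borel_measurable (S \<Otimes>\<^sub>M S)"
    proof -
      have "(\<lambda>z. \<integral>\<^sup>+y'. h (snd z, y') \<partial>K (fst z)) \<in> borel_measurable (S \<Otimes>\<^sub>M S)"
      proof (rule nn_integral_measurable_subprob_algebra2[where N=S])
        note h_meas[measurable]
        show "(\<lambda>(z, y'). h (snd z, y')) \<in> borel_measurable ((S \<Otimes>\<^sub>M S) \<Otimes>\<^sub>M S)" by measurable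
        show "(\<lambda>z. K (fst z)) \<in> S \<Otimes>\<^sub>M S \<rightarrow>\<^sub>M subprob_algebra S"
          by (rule measurable_compose[OF measurable_fst Ks])
      qed
      then show ?thesis by (simp add: case_prod_unfold)
    qed
    have "(\<integral>\<^sup>+z. \<integral>\<^sup>+z'. h z' \<partial>P z \<partial>\<pi>2) = (\<integral>\<^sup>+x. \<integral>\<^sup>+y. \<integral>\<^sup>+z'. h z' \<partial>P (x, y) \<partial>\<pi> \<partial>\<pi>)"
      by (rule int\<pi>2[OF mP])
    also have "\<dots> = (\<integral>\<^sup>+x. \<integral>\<^sup>+y. \<integral>\<^sup>+x'. \<integral>\<^sup>+y'. h (x', y') \<partial>K y \<partial>K x \<partial>\<pi> \<partial>\<pi>)"
      by (intro nn_integral_cong) (simp add: sp\<pi> intP h_meas)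
    also have "\<dots> = (\<integral>\<^sup>+x. \<integral>\<^sup>+x'. \<integral>\<^sup>+y. \<integral>\<^sup>+y'. h (x', y') \<partial>K y \<partial>\<pi> \<partial>K x \<partial>\<pi>)"
    proof (rule nn_integral_cong)
      fix x assume "x \<in> space \<pi>"
      then have x: "x \<in> space S" by (simp add: sp\<pi>)
      interpret Kx: prob_space "K x" using Kx[OF x] by simp
      interpret pair_sigma_finite \<pi> "K x" ..
      show "(\<integral>\<^sup>+y. \<integral>\<^sup>+x'. \<integral>\<^sup>+y'. h (x', y') \<partial>K y \<partial>K x \<partial>\<pi>) = (\<integral>\<^sup>+x'. \<integral>\<^sup>+y. \<integral>\<^sup>+y'. h (x', y') \<partial>K y \<partial>\<pi> \<partial>K x)"
        using mKy \<pi>(2) Kx(1)[OF x] Fubini[of "\<lambda>(y, x'). \<integral>\<^sup>+y'. h (x', y') \<partial>K y"]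
        by (simp cong: measurable_cong_sets sets_pair_measure_cong)
    qed
    also have "\<dots> = (\<integral>\<^sup>+x. \<integral>\<^sup>+x'. \<integral>\<^sup>+y'. h (x', y') \<partial>\<pi> \<partial>K x \<partial>\<pi>)"
    proof (rule nn_integral_cong, rule nn_integral_cong)
      fix x x' assume "x \<in> space \<pi>" "x' \<in> space (K x)"
      then have "x' \<in> space S" by (simp add: sp\<pi> Kx)
      then show "(\<integral>\<^sup>+y. \<integral>\<^sup>+y'. h (x', y') \<partial>K y \<partial>\<pi>) = (\<integral>\<^sup>+y'. h (x', y') \<partial>\<pi>)"
        using h_meas by (intro inv_int) (auto intro: measurable_compose[OF measurable_Pair1' h_meas])
    qed
    also have "\<dots> = (\<integral>\<^sup>+x'. \<integral>\<^sup>+y'. h (x', y') \<partial>\<pi> \<partial>\<pi>)"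
      by (rule inv_int[OF meas2[OF h_meas \<pi>(1,2)]])
    also have "\<dots> = (\<integral>\<^sup>+z. h z \<partial>\<pi>2)" by (rule int\<pi>2[OF h_meas, symmetric])
    finally show ?thesis .
  qed
  have \<pi>2s: "(\<integral>\<^sup>+z. s z \<partial>\<pi>2) > 0"
  proof -
    have "(\<integral>\<^sup>+z. s z \<partial>\<pi>2) = \<epsilon> * \<epsilon> * emeasure \<pi>2 (C \<times> C)"
      unfolding s_def using CC sets\<pi>2 by (simp add: nn_integral_cmult)
    also have "emeasure \<pi>2 (C \<times> C) = emeasure \<pi> C * emeasure \<pi> C"
      unfolding \<pi>2_def using C \<pi>(2) by (intro \<pi>.emeasure_pair_measure_Times) auto
    finally show ?thesis using \<epsilon> \<pi>(3) by (simp add: ennreal_zero_less_mult_iff)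
  qed
  \<comment> \<open>Since \<open>\<pi>2\<close> is invariant under \<open>P\<close> and \<open>P h = h + s \<cdot> \<nu>2(h)\<close>, the last term integrates to 0.\<close>
  have \<nu>2h: "(\<integral>\<^sup>+z. h z \<partial>\<nu>2) = 0"
  proof -
    have "(\<integral>\<^sup>+z. h z \<partial>\<pi>2) = (\<integral>\<^sup>+z. h z + s z * (\<integral>\<^sup>+z. h z \<partial>\<nu>2) \<partial>\<pi>2)"
      unfolding inv2[symmetric] by (intro nn_integral_cong) (simp add: sp\<pi>2 dec h_meas hR[symmetric])
    also have "\<dots> = (\<integral>\<^sup>+z. h z \<partial>\<pi>2) + (\<integral>\<^sup>+z. s z \<partial>\<pi>2) * (\<integral>\<^sup>+z. h z \<partial>\<nu>2)"
      using h_meas s_meas sets\<pi>2 by (simp add: nn_integral_add nn_integral_multc cong: measurable_cong_sets)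
    finally have "(\<integral>\<^sup>+z. h z \<partial>\<pi>2) + 0 = (\<integral>\<^sup>+z. h z \<partial>\<pi>2) + (\<integral>\<^sup>+z. s z \<partial>\<pi>2) * (\<integral>\<^sup>+z. h z \<partial>\<nu>2)" by simp
    moreover have "(\<integral>\<^sup>+z. h z \<partial>\<pi>2) \<noteq> \<infinity>"
    proof -
      have "(\<integral>\<^sup>+z. h z \<partial>\<pi>2) \<le> (\<integral>\<^sup>+z. 1 \<partial>\<pi>2)" by (intro nn_integral_mono h_le1)
      then show ?thesis by (auto simp: \<pi>2.emeasure_space_1 top_unique)
    qed
    ultimately have "(\<integral>\<^sup>+z. s z \<partial>\<pi>2) * (\<integral>\<^sup>+z. h z \<partial>\<nu>2) = 0"
      unfolding ennreal_add_left_cancel by simp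
    then show ?thesis using \<pi>2s by auto
  qed
  obtain x0 y0 where z0: "x0 \<in> space S" "y0 \<in> space S" "h (x0, y0) = 0"
  proof -
    have "AE z in \<nu>2. h z = 0"
      using \<nu>2h h_meas \<nu>2(2) by (subst (asm) nn_integral_0_iff_AE) (auto cong: measurable_cong_sets)
    have "\<exists>z\<in>space \<nu>2. h z = 0"
    proof (rule ccontr)
      assume "\<not> (\<exists>z\<in>space \<nu>2. h z = 0)"
      then have "AE z in \<nu>2. h z = 0 \<longrightarrow> False" by (intro AE_I2) auto
      with \<open>AE z in \<nu>2. h z = 0\<close> have "AE z in \<nu>2. False" by (rule AE_mp)
      then show False by simp
    qed
    then show ?thesis using that sets_eq_imp_space_eq[OF \<nu>2(2)] by (auto simp: space_pair_measure)
  qed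
  have h0: "h (x, y) = 0" if xy: "x \<in> space S" "y \<in> space S" for x y
  proof -
    have ae_equiv: "AE x' in K v. Q x'" if "AE x' in K u. Q x'" "u \<in> space S" "v \<in> space S" "{x'\<in>space S. \<not> Q x'} \<in> sets S" for u v Q
      using that equiv[of u v "{x'\<in>space S. \<not> Q x'}"] Kx by (simp add: AE_iff_measurable[OF _ refl])
    have sec: "(\<lambda>y'. h (x', y')) \<in> borel_measurable S" if "x' \<in> space S" for x'
      using that by (auto intro: measurable_compose[OF measurable_Pair1' h_meas])
    have P_zero_iff: "(\<integral>\<^sup>+z'. h z' \<partial>P (x, y)) = 0 \<longleftrightarrow> (AE x' in K x. (\<integral>\<^sup>+y'. h (x', y') \<partial>K y) = 0)"
      if "x \<in> space S" "y \<in> space S" for x y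
      unfolding intP[OF that h_meas] using meas2[OF h_meas, of "K y"] Kx[OF that(1)] Kx[OF that(2)]
      by (intro nn_integral_0_iff_AE) (simp cong: measurable_cong_sets)
    have sec_zero_iff: "(\<integral>\<^sup>+y'. h (x', y') \<partial>K y) = 0 \<longleftrightarrow> (AE y' in K y. h (x', y') = 0)"
      if "x' \<in> space S" "y \<in> space S" for x' y
      using Kx[OF that(2)] sec[OF that(1)] by (intro nn_integral_0_iff_AE) (simp cong: measurable_cong_sets)
    have bound: "(\<integral>\<^sup>+z'. h z' \<partial>P (u, v)) = h (u, v)" if "u \<in> space S" "v \<in> space S" for u v
      using dec[of "(u,v)" h] that h_meas hR[of "(u, v)"] \<nu>2h by (simp add: space_pair_measure)
    have "AE x' in K x0. (\<integral>\<^sup>+y'. h (x', y') \<partial>K y0) = 0"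
      using bound[OF z0(1,2)] z0(3) P_zero_iff[OF z0(1,2)] by simp
    then have "AE x' in K x0. (\<integral>\<^sup>+y'. h (x', y') \<partial>K y) = 0"
    proof (rule AE_mp, intro AE_I2 impI)
      fix x' assume "x' \<in> space (K x0)" and zero: "(\<integral>\<^sup>+y'. h (x', y') \<partial>K y0) = 0"
      then have x': "x' \<in> space S" using Kx z0 by simp
      have "AE y' in K y. h (x', y') = 0"
        using sec[OF x'] zero unfolding sec_zero_iff[OF x' z0(2)]
        by (intro ae_equiv[OF _ z0(2) xy(2)]) measurable
      then show "(\<integral>\<^sup>+y'. h (x', y') \<partial>K y) = 0" by (simp add: sec_zero_iff[OF x' xy(2)])
    qed
    then have "AE x' in K x. (\<integral>\<^sup>+y'. h (x', y') \<partial>K y) = 0"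
      using meas2[OF h_meas, of "K y"] Kx[OF xy(2)] by (intro ae_equiv[OF _ z0(1) xy(1)]) measurable
    then have "(\<integral>\<^sup>+z'. h z' \<partial>P (x, y)) = 0" by (simp add: P_zero_iff[OF xy])
    then show ?thesis using bound[OF xy] by simp
  qed
  have main: "emeasure (kernel_power S K n x) A \<le> emeasure (kernel_power S K n y) A + r n (x, y)"
    if xy: "x \<in> space S" "y \<in> space S" and A: "A \<in> sets S" for n x y A
    using xy
  proof (induction n arbitrary: x y)
    case 0
    then show ?case using A by (auto simp: r0 indicator_def)
  next
    case (Suc n)
    define a where "a x = emeasure (kernel_power S K n x) A" for x
    have a: "a \<in> borel_measurable S"
      unfolding a_def using measurable_prob_algebraD[OF measurable_kernel_power[OF K, of n]] A by measurable
    have a1: "(\<lambda>z. a (fst z)) \<in> borel_measurable (S \<Otimes>\<^sub>M S)" and a2: "(\<lambda>z. a (snd z)) \<in> borel_measurable (S \<Otimes>\<^sub>M S)"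
      using a by measurable
    have xy: "(x, y) \<in> space (S \<Otimes>\<^sub>M S)" using Suc.prems by (simp add: space_pair_measure)
    have Pa1: "(\<integral>\<^sup>+z. a (fst z) \<partial>P (x, y)) = (\<integral>\<^sup>+x'. a x' \<partial>K x)"
      using Suc.prems a1 Kx(2)[OF Suc.prems(2)] by (simp add: intP prob_kernel_total[OF K])
    have Pa2: "(\<integral>\<^sup>+z. a (snd z) \<partial>P (x, y)) = (\<integral>\<^sup>+y'. a y' \<partial>K y)"
      using Suc.prems a2 Kx(2)[OF Suc.prems(1)] by (simp add: intP prob_kernel_total[OF K])
    have N1: "(\<integral>\<^sup>+z. a (fst z) \<partial>\<nu>2) = (\<integral>\<^sup>+z. a (snd z) \<partial>\<nu>2)"
      using a1 a2 by (simp add: int\<nu>2 \<nu>.emeasure_space_1)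
    have "(\<integral>\<^sup>+z. a (fst z) \<partial>R (x, y)) \<le> (\<integral>\<^sup>+z. a (snd z) + r n z \<partial>R (x, y))"
      using Suc.IH spR[OF xy] by (intro nn_integral_mono) (auto simp: a_def space_pair_measure)
    also have "\<dots> = (\<integral>\<^sup>+z. a (snd z) \<partial>R (x, y)) + r (Suc n) (x, y)"
      using a2 r_meas[of n] spR[OF xy] rS[OF xy] by (subst nn_integral_add) (simp_all cong: measurable_cong_sets)
    finally have *: "(\<integral>\<^sup>+z. a (fst z) \<partial>R (x, y)) \<le> (\<integral>\<^sup>+z. a (snd z) \<partial>R (x, y)) + r (Suc n) (x, y)" .
    have "emeasure (kernel_power S K (Suc n) x) A = (\<integral>\<^sup>+z. a (fst z) \<partial>R (x, y)) + s (x, y) * (\<integral>\<^sup>+z. a (snd z) \<partial>\<nu>2)"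
      using Suc.prems emeasure_kernel_power_Suc[OF K _ A] by (simp add: Pa1[symmetric] a_def[symmetric] dec[OF xy a1] N1 del: kernel_power.simps)
    also have "\<dots> \<le> (\<integral>\<^sup>+z. a (snd z) \<partial>R (x, y)) + r (Suc n) (x, y) + s (x, y) * (\<integral>\<^sup>+z. a (snd z) \<partial>\<nu>2)"
      using * by (rule add_right_mono)
    also have "\<dots> = (\<integral>\<^sup>+z. a (snd z) \<partial>P (x, y)) + r (Suc n) (x, y)"
      using dec[OF xy a2] by (simp add: ac_simps)
    also have "\<dots> = emeasure (kernel_power S K (Suc n) y) A + r (Suc n) (x, y)"
      using Suc.prems emeasure_kernel_power_Suc[OF K _ A] by (simp add: Pa2 a_def[symmetric] del: kernel_power.simps)
    finally show ?case .
  qed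
  show ?thesis
  proof (rule that[of r])
    show "(\<lambda>n. r n (x, y)) \<longlonglongrightarrow> 0" if "x \<in> space S" "y \<in> space S" for x y
      using r_lim[of "(x, y)"] h0[OF that] by simp
  qed (use r_meas r_le1 main in auto)
qed

lemma invariant_kernel_power:
  assumes K: "K \<in> S \<rightarrow>\<^sub>M prob_algebra S"
    and \<pi>: "prob_space \<pi>" "sets \<pi> = sets S"
    and inv: "\<And>A. A \<in> sets S \<Longrightarrow> emeasure \<pi> A = (\<integral>\<^sup>+x. emeasure (K x) A \<partial>\<pi>)"
    and A: "A \<in> sets S"
  shows "(\<integral>\<^sup>+x. emeasure (kernel_power S K n x) A \<partial>\<pi>) = emeasure \<pi> A"
proof (induction n)
  case 0
  have "(\<integral>\<^sup>+x. emeasure (kernel_power S K 0 x) A \<partial>\<pi>) = (\<integral>\<^sup>+x. indicator A x \<partial>\<pi>)"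
    using A by simp
  then show ?case using A \<pi>(2) by simp
next
  case (Suc n)
  have sp: "space \<pi> = space S" using \<pi>(2) by (rule sets_eq_imp_space_eq)
  have "(\<integral>\<^sup>+x. emeasure (kernel_power S K (Suc n) x) A \<partial>\<pi>) =
      (\<integral>\<^sup>+x. \<integral>\<^sup>+y. emeasure (kernel_power S K n y) A \<partial>K x \<partial>\<pi>)"
    by (intro nn_integral_cong emeasure_kernel_power_Suc[OF K _ A]) (simp add: sp)
  also have "\<dots> = (\<integral>\<^sup>+x. emeasure (kernel_power S K n x) A \<partial>\<pi>)"
    by (intro invariant_nn_integral[OF K \<pi> inv] measurable_emeasure_kernel[OF
          measurable_prob_algebraD[OF measurable_kernel_power[OF K]] A])
  finally show ?case using Suc by simp
qed

text \<open>The bound of \<open>kernel_merging\<close> is averaged over a second starting point drawn from \<open>\<pi>\<close>; the copy started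
there has law \<open>\<pi>\<close> at all times. The bound \<open>e n\<close> is uniform in \<open>A\<close>, which is what convergence in total
variation asks for.\<close>

theorem kernel_power_tends_to_invariant:
  fixes \<epsilon> :: ennreal and K :: "'a \<Rightarrow> 'a measure"
  assumes K: "K \<in> S \<rightarrow>\<^sub>M prob_algebra S"
    and \<nu>: "prob_space \<nu>" "sets \<nu> = sets S"
    and C: "C \<in> sets S" and \<epsilon>: "0 < \<epsilon>" "\<epsilon> < \<infinity>"
    and minor: "\<And>x A. x \<in> C \<Longrightarrow> A \<in> sets S \<Longrightarrow> \<epsilon> * emeasure \<nu> A \<le> emeasure (K x) A"
    and \<pi>: "prob_space \<pi>" "sets \<pi> = sets S" "emeasure \<pi> C > 0"
    and inv: "\<And>A. A \<in> sets S \<Longrightarrow> emeasure \<pi> A = (\<integral>\<^sup>+x. emeasure (K x) A \<partial>\<pi>)"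
    and equiv: "\<And>x y A. x \<in> space S \<Longrightarrow> y \<in> space S \<Longrightarrow> A \<in> sets S \<Longrightarrow>
      emeasure (K x) A = 0 \<Longrightarrow> emeasure (K y) A = 0"
    and x: "x \<in> space S"
  obtains e :: "nat \<Rightarrow> real" where "e \<longlonglongrightarrow> 0"
    "\<And>n A. A \<in> sets S \<Longrightarrow> \<bar>measure (kernel_power S K n x) A - measure \<pi> A\<bar> \<le> e n"
proof -
  interpret \<pi>: prob_space \<pi> by fact
  have sp\<pi>: "space \<pi> = space S" using \<pi>(2) by (rule sets_eq_imp_space_eq)
  obtain r :: "nat \<Rightarrow> 'a \<times> 'a \<Rightarrow> ennreal"
    where r_meas: "\<And>n. r n \<in> borel_measurable (S \<Otimes>\<^sub>M S)" and r_le: "\<And>n z. r n z \<le> 1"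
    and r_lim: "\<And>x y. x \<in> space S \<Longrightarrow> y \<in> space S \<Longrightarrow> (\<lambda>n. r n (x, y)) \<longlonglongrightarrow> 0"
    and r: "\<And>n x y A. x \<in> space S \<Longrightarrow> y \<in> space S \<Longrightarrow> A \<in> sets S \<Longrightarrow>
      emeasure (kernel_power S K n x) A \<le> emeasure (kernel_power S K n y) A + r n (x, y)"
  proof (rule kernel_merging[OF K \<nu> C \<epsilon> _ \<pi>])
    show "\<And>x A. x \<in> C \<Longrightarrow> A \<in> sets S \<Longrightarrow> \<epsilon> * emeasure \<nu> A \<le> emeasure (K x) A" by (rule minor)
    show "\<And>A. A \<in> sets S \<Longrightarrow> emeasure \<pi> A = (\<integral>\<^sup>+x. emeasure (K x) A \<partial>\<pi>)" by (rule inv)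
    show "\<And>x y A. x \<in> space S \<Longrightarrow> y \<in> space S \<Longrightarrow> A \<in> sets S \<Longrightarrow>
      emeasure (K x) A = 0 \<Longrightarrow> emeasure (K y) A = 0" by (rule equiv)
  qed blast
  define q where "q n y = r n (x, y) + r n (y, x)" for n y
  have q_meas: "q n \<in> borel_measurable S" for n
    unfolding q_def using r_meas[of n] x
    by (intro borel_measurable_add measurable_compose[OF _ r_meas]) measurable
  have q_le: "q n y \<le> 2" for n y
    unfolding q_def using add_mono[OF r_le[of n "(x,y)"] r_le[of n "(y,x)"]] by simp
  define e where "e n = (\<integral>\<^sup>+y. q n y \<partial>\<pi>)" for n
  have e_lim: "e \<longlonglongrightarrow> 0"
  proof -
    have "(\<lambda>n. \<integral>\<^sup>+y. q n y \<partial>\<pi>) \<longlonglongrightarrow> (\<integral>\<^sup>+y. 0 \<partial>\<pi>)"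
    proof (rule nn_integral_dominated_convergence[where w="\<lambda>_. 2"])
      show "AE y in \<pi>. (\<lambda>n. q n y) \<longlonglongrightarrow> 0"
      proof (rule AE_I2)
        fix y assume "y \<in> space \<pi>"
        then have "(\<lambda>n. q n y) \<longlonglongrightarrow> 0 + 0"
          unfolding q_def using x by (intro tendsto_add r_lim) (simp_all add: sp\<pi>)
        then show "(\<lambda>n. q n y) \<longlonglongrightarrow> 0" by simp
      qed
    qed (use q_meas q_le \<pi>(2) \<pi>.emeasure_space_1 in \<open>simp_all cong: measurable_cong_sets\<close>)
    then show ?thesis by (simp add: e_def[abs_def])
  qed
  have e_le: "e n \<le> 2" for n
  proof -
    have "e n \<le> (\<integral>\<^sup>+y. 2 \<partial>\<pi>)" unfolding e_def by (intro nn_integral_mono q_le)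
    then show ?thesis by (simp add: \<pi>.emeasure_space_1)
  qed
  have e_fin: "e n < top" for n using e_le[of n] by (rule le_less_trans) simp
  have meas: "(\<lambda>y. emeasure (kernel_power S K n y) A) \<in> borel_measurable \<pi>" if "A \<in> sets S" for n A
    using measurable_emeasure_kernel[OF measurable_prob_algebraD[OF measurable_kernel_power[OF K]] that] \<pi>(2)
    by (simp cong: measurable_cong_sets)
  have q_meas': "q n \<in> borel_measurable \<pi>" for n using q_meas \<pi>(2) by (simp cong: measurable_cong_sets)
  have up: "emeasure (kernel_power S K n x) A \<le> emeasure \<pi> A + e n" if A: "A \<in> sets S" for n A
  proof -
    have "emeasure (kernel_power S K n x) A = (\<integral>\<^sup>+y. emeasure (kernel_power S K n x) A \<partial>\<pi>)"
      by (simp add: \<pi>.emeasure_space_1)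
    also have "\<dots> \<le> (\<integral>\<^sup>+y. emeasure (kernel_power S K n y) A + q n y \<partial>\<pi>)"
    proof (rule nn_integral_mono)
      fix y assume "y \<in> space \<pi>"
      then have "emeasure (kernel_power S K n x) A \<le> emeasure (kernel_power S K n y) A + r n (x, y)"
        using r[OF x _ A] by (simp add: sp\<pi>)
      also have "\<dots> \<le> emeasure (kernel_power S K n y) A + q n y"
        unfolding q_def by (intro add_left_mono) simp
      finally show "emeasure (kernel_power S K n x) A \<le> emeasure (kernel_power S K n y) A + q n y" .
    qed
    also have "\<dots> = emeasure \<pi> A + e n"
      using meas[OF A] q_meas' by (simp add: nn_integral_add e_def invariant_kernel_power[OF K \<pi>(1,2) inv A])
    finally show ?thesis .
  qed
  have down: "emeasure \<pi> A \<le> emeasure (kernel_power S K n x) A + e n" if A: "A \<in> sets S" for n A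
  proof -
    have "emeasure \<pi> A = (\<integral>\<^sup>+y. emeasure (kernel_power S K n y) A \<partial>\<pi>)"
      by (simp add: invariant_kernel_power[OF K \<pi>(1,2) inv A])
    also have "\<dots> \<le> (\<integral>\<^sup>+y. emeasure (kernel_power S K n x) A + q n y \<partial>\<pi>)"
    proof (rule nn_integral_mono)
      fix y assume "y \<in> space \<pi>"
      then have "emeasure (kernel_power S K n y) A \<le> emeasure (kernel_power S K n x) A + r n (y, x)"
        using r[OF _ x A] by (simp add: sp\<pi>)
      also have "\<dots> \<le> emeasure (kernel_power S K n x) A + q n y"
        unfolding q_def by (intro add_left_mono) simp
      finally show "emeasure (kernel_power S K n y) A \<le> emeasure (kernel_power S K n x) A + q n y" .
    qed
    also have "\<dots> = emeasure (kernel_power S K n x) A + e n"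
      using q_meas' by (simp add: nn_integral_add e_def \<pi>.emeasure_space_1)
    finally show ?thesis .
  qed
  show ?thesis
  proof (rule that)
    show "(\<lambda>n. enn2real (e n)) \<longlonglongrightarrow> 0"
      by (rule tendsto_enn2real) (simp_all add: e_lim)
    show "\<bar>measure (kernel_power S K n x) A - measure \<pi> A\<bar> \<le> enn2real (e n)" if A: "A \<in> sets S" for n A
    proof -
      interpret Kn: prob_space "kernel_power S K n x"
        using measurable_space[OF measurable_kernel_power[OF K, of n] x] by (simp add: space_prob_algebra)
      have e: "e n = ennreal (enn2real (e n))" using e_fin[of n] by simp
      have "ennreal (measure (kernel_power S K n x) A) \<le> ennreal (measure \<pi> A + enn2real (e n))"
        using up[OF A, of n] e by (simp add: Kn.emeasure_eq_measure \<pi>.emeasure_eq_measure)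
      moreover have "ennreal (measure \<pi> A) \<le> ennreal (measure (kernel_power S K n x) A + enn2real (e n))"
        using down[OF A, of n] e by (simp add: Kn.emeasure_eq_measure \<pi>.emeasure_eq_measure)
      ultimately have "measure (kernel_power S K n x) A \<le> measure \<pi> A + enn2real (e n)"
        "measure \<pi> A \<le> measure (kernel_power S K n x) A + enn2real (e n)"
        by (simp_all add: ennreal_plus[symmetric] del: ennreal_plus)
      then show ?thesis by linarith
    qed
  qed
qed

section \<open>The standard Gaussian law\<close>

text \<open>The density of the centred normal law with covariance \<open>\<sigma>\<^sup>2 I\<close>. Writing it in terms of the norm
makes its behaviour under translation and scaling visible.\<close>

definition gaussian_density :: "real \<Rightarrow> 'a::euclidean_space \<Rightarrow> real" where
  "gaussian_density \<sigma> z = (1 / sqrt (2 * pi * \<sigma>\<^sup>2)) ^ DIM('a) * exp (- (norm z)\<^sup>2 / (2 * \<sigma>\<^sup>2))"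

definition std_gaussian :: "'a::euclidean_space measure" where
  "std_gaussian = density lborel (\<lambda>z. ennreal (gaussian_density 1 z))"

lemma gaussian_density_prod:
  fixes z :: "'a::euclidean_space"
  shows "gaussian_density \<sigma> z = (\<Prod>b\<in>Basis. normal_density 0 \<sigma> (z \<bullet> b))"
proof -
  have "(norm z)\<^sup>2 = (\<Sum>b\<in>Basis. (z \<bullet> b)\<^sup>2)"
    unfolding power2_norm_eq_inner by (subst euclidean_inner) (simp add: power2_eq_square)
  then have "exp (- (norm z)\<^sup>2 / (2 * \<sigma>\<^sup>2)) = (\<Prod>b\<in>(Basis :: 'a set). exp (- (z \<bullet> b)\<^sup>2 / (2 * \<sigma>\<^sup>2)))"
    by (subst exp_sum[symmetric]) (simp_all add: sum_divide_distrib[symmetric] sum_negf)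
  then show ?thesis
    unfolding gaussian_density_def normal_density_def by (simp add: prod.distrib prod_dividef power_divide)
qed

text \<open>This is the form in which the law of a Brownian increment is given.\<close>

lemma gaussian_density_vec:
  fixes z :: "real ^ 'm"
  shows "gaussian_density \<sigma> z = (\<Prod>i\<in>UNIV. normal_density 0 \<sigma> (z $ i))"
proof -
  have "(norm z)\<^sup>2 = (\<Sum>i\<in>UNIV. (z $ i)\<^sup>2)"
    unfolding power2_norm_eq_inner by (simp add: inner_vec_def power2_eq_square)
  then have "exp (- (norm z)\<^sup>2 / (2 * \<sigma>\<^sup>2)) = (\<Prod>i\<in>UNIV. exp (- (z $ i)\<^sup>2 / (2 * \<sigma>\<^sup>2)))"
    by (subst exp_sum[symmetric]) (simp_all add: sum_divide_distrib[symmetric] sum_negf)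
  then show ?thesis
    unfolding gaussian_density_def normal_density_def by (simp add: prod.distrib prod_dividef power_divide)
qed

lemma gaussian_density_nonneg: "gaussian_density \<sigma> z \<ge> 0"
  by (simp add: gaussian_density_def)

lemma measurable_gaussian_density[measurable]: "gaussian_density \<sigma> \<in> borel_measurable borel"
  unfolding gaussian_density_def by measurable

lemma sets_std_gaussian[simp, measurable_cong]: "sets std_gaussian = sets borel"
  by (simp add: std_gaussian_def)

lemma space_std_gaussian[simp]: "space std_gaussian = UNIV"
  by (simp add: std_gaussian_def)

lemma nn_integral_std_gaussian:
  "F \<in> borel_measurable borel \<Longrightarrow>
    (\<integral>\<^sup>+z. F z \<partial>std_gaussian) = (\<integral>\<^sup>+z. ennreal (gaussian_density 1 z) * F z \<partial>lborel)"
  unfolding std_gaussian_def by (rule nn_integral_density) auto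

lemma prob_space_std_gaussian: "prob_space (std_gaussian :: 'a::euclidean_space measure)"
proof (rule prob_spaceI)
  have "emeasure (std_gaussian :: 'a measure) (space std_gaussian) = (\<integral>\<^sup>+z. ennreal (gaussian_density 1 (z::'a)) \<partial>lborel)"
    by (simp add: std_gaussian_def emeasure_density)
  also have "\<dots> = (\<integral>\<^sup>+z. (\<Prod>b\<in>Basis. ennreal (normal_density 0 1 ((z::'a) \<bullet> b))) \<partial>lborel)"
    by (simp add: gaussian_density_prod prod_ennreal)
  also have "\<dots> = (\<Prod>b\<in>(Basis::'a set). \<integral>\<^sup>+x. ennreal (normal_density 0 1 x) \<partial>lborel)"
    by (rule nn_integral_lborel_prod) auto
  also have "(\<integral>\<^sup>+x. ennreal (normal_density 0 1 x) \<partial>lborel) = 1"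
    by (subst nn_integral_eq_integral) (auto simp: integral_normal_density)
  finally show "emeasure (std_gaussian :: 'a measure) (space std_gaussian) = 1" by simp
qed

interpretation std_gaussian: prob_space "std_gaussian :: 'a::euclidean_space measure"
  by (rule prob_space_std_gaussian)

lemma nn_integral_lborel_scale:
  fixes F :: "'a::euclidean_space \<Rightarrow> ennreal"
  assumes [measurable]: "F \<in> borel_measurable borel" and c: "c \<noteq> 0"
  shows "(\<integral>\<^sup>+z. F z \<partial>lborel) = ennreal (\<bar>c\<bar> ^ DIM('a)) * (\<integral>\<^sup>+z. F (c *\<^sub>R z) \<partial>lborel)"
  by (subst lborel_affine[OF c, of 0]) (simp add: nn_integral_density nn_integral_distr nn_integral_cmult)

lemma nn_integral_lborel_shift:
  fixes F :: "'a::euclidean_space \<Rightarrow> ennreal"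
  assumes [measurable]: "F \<in> borel_measurable borel"
  shows "(\<integral>\<^sup>+z. F (a + z) \<partial>lborel) = (\<integral>\<^sup>+z. F z \<partial>lborel)"
  by (subst (2) lborel_distr_plus[symmetric, of a]) (simp add: nn_integral_distr)

lemma emeasure_distr_eq_nn_integral:
  "f \<in> M \<rightarrow>\<^sub>M N \<Longrightarrow> A \<in> sets N \<Longrightarrow> emeasure (distr M N f) A = (\<integral>\<^sup>+z. indicator A (f z) \<partial>M)"
  using nn_integral_distr[of f M N "indicator A"] by simp

lemma distr_std_gaussian_scale:
  assumes \<sigma>: "\<sigma> > 0"
  shows "distr std_gaussian borel (\<lambda>z. \<sigma> *\<^sub>R z) = density lborel (\<lambda>z::'a::euclidean_space. ennreal (gaussian_density \<sigma> z))"
proof (rule measure_eqI)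
  fix A :: "'a set" assume "A \<in> sets (distr std_gaussian borel (\<lambda>z. \<sigma> *\<^sub>R z))"
  then have [measurable]: "A \<in> sets borel" by simp
  have scale: "\<sigma> ^ DIM('a) * gaussian_density \<sigma> (\<sigma> *\<^sub>R z) = gaussian_density 1 z" for z :: 'a
  proof -
    have "\<sigma> * (1 / sqrt (2 * pi * \<sigma>\<^sup>2)) = 1 / sqrt (2 * pi)"
      using \<sigma> by (simp add: real_sqrt_mult)
    then show ?thesis
      using \<sigma> unfolding gaussian_density_def
      by (simp add: mult.assoc[symmetric] power_mult_distrib[symmetric] del: real_sqrt_mult) (simp add: power_mult_distrib)
  qed
  have "emeasure (density lborel (\<lambda>z. ennreal (gaussian_density \<sigma> z))) A =
      (\<integral>\<^sup>+z. ennreal (gaussian_density \<sigma> z) * indicator A z \<partial>lborel)"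
    by (simp add: emeasure_density)
  also have "\<dots> = ennreal (\<sigma> ^ DIM('a)) * (\<integral>\<^sup>+z. ennreal (gaussian_density \<sigma> (\<sigma> *\<^sub>R z)) * indicator A (\<sigma> *\<^sub>R z) \<partial>lborel)"
    using \<sigma> by (subst nn_integral_lborel_scale[of _ \<sigma>]) auto
  also have "\<dots> = (\<integral>\<^sup>+z. ennreal (gaussian_density 1 z) * indicator A (\<sigma> *\<^sub>R z) \<partial>lborel)"
    using \<sigma> by (subst nn_integral_cmult[symmetric])
      (auto simp: scale[symmetric] ennreal_mult gaussian_density_nonneg mult.assoc)
  also have "\<dots> = (\<integral>\<^sup>+z. indicator A (\<sigma> *\<^sub>R z) \<partial>std_gaussian)"
    by (simp add: nn_integral_std_gaussian)
  also have "\<dots> = emeasure (distr std_gaussian borel (\<lambda>z. \<sigma> *\<^sub>R z)) A"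
    by (rule emeasure_distr_eq_nn_integral[symmetric]) auto
  finally show "emeasure (distr std_gaussian borel (\<lambda>z. \<sigma> *\<^sub>R z)) A =
      emeasure (density lborel (\<lambda>z. ennreal (gaussian_density \<sigma> z))) A" ..
qed simp

lemma std_gaussian_symmetric:
  fixes F :: "'a::euclidean_space \<Rightarrow> ennreal"
  assumes [measurable]: "F \<in> borel_measurable borel"
  shows "(\<integral>\<^sup>+z. F (- z) \<partial>std_gaussian) = (\<integral>\<^sup>+z. F z \<partial>std_gaussian)"
proof -
  have "gaussian_density 1 (- z) = gaussian_density 1 z" for z :: 'a by (simp add: gaussian_density_def)
  then show ?thesis
    using nn_integral_lborel_scale[of "\<lambda>z. ennreal (gaussian_density 1 z) * F z" "-1"]
    by (simp add: nn_integral_std_gaussian)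
qed

text \<open>Translating the Gaussian law multiplies its density by an exponential. This identity alone yields the
exponential moments, hence bounds on all moments, and it is also the tool for comparing
linear images of the Gaussian law with Lebesgue measure.\<close>

lemma cameron_martin:
  fixes F :: "'a::euclidean_space \<Rightarrow> ennreal"
  assumes [measurable]: "F \<in> borel_measurable borel"
  shows "(\<integral>\<^sup>+z. F (a + z) \<partial>std_gaussian) = (\<integral>\<^sup>+z. F z * ennreal (exp (a \<bullet> z - (norm a)\<^sup>2 / 2)) \<partial>std_gaussian)"
proof -
  have shift: "gaussian_density 1 (z - a) = gaussian_density 1 z * exp (a \<bullet> z - (norm a)\<^sup>2 / 2)" for z :: 'a
    unfolding gaussian_density_def
    by (simp add: power2_norm_eq_inner inner_diff_left inner_diff_right inner_commute
        mult.assoc exp_add[symmetric] field_simps)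
  have "(\<integral>\<^sup>+z. F (a + z) \<partial>std_gaussian) = (\<integral>\<^sup>+z. ennreal (gaussian_density 1 ((a + z) - a)) * F (a + z) \<partial>lborel)"
    by (simp add: nn_integral_std_gaussian)
  also have "\<dots> = (\<integral>\<^sup>+z. ennreal (gaussian_density 1 (z - a)) * F z \<partial>lborel)"
    by (subst nn_integral_lborel_shift) auto
  also have "\<dots> = (\<integral>\<^sup>+z. F z * ennreal (exp (a \<bullet> z - (norm a)\<^sup>2 / 2)) \<partial>std_gaussian)"
    by (subst nn_integral_std_gaussian) (auto simp: shift ennreal_mult gaussian_density_nonneg ac_simps)
  finally show ?thesis .
qed

lemma std_gaussian_exp:
  fixes a :: "'a::euclidean_space"
  shows "(\<integral>\<^sup>+z. ennreal (exp (a \<bullet> z)) \<partial>std_gaussian) = ennreal (exp ((norm a)\<^sup>2 / 2))"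
proof -
  have "1 = (\<integral>\<^sup>+z. 1 \<partial>(std_gaussian :: 'a measure))" using std_gaussian.emeasure_space_1 by simp
  also have "\<dots> = (\<integral>\<^sup>+z. ennreal (exp (a \<bullet> z - (norm a)\<^sup>2 / 2)) \<partial>std_gaussian)"
    using cameron_martin[of "\<lambda>_. 1" a] by simp
  also have "\<dots> = (\<integral>\<^sup>+z. ennreal (exp (- (norm a)\<^sup>2 / 2)) * ennreal (exp (a \<bullet> z)) \<partial>std_gaussian)"
    by (intro nn_integral_cong) (simp add: ennreal_mult[symmetric] exp_add[symmetric])
  also have "\<dots> = ennreal (exp (- (norm a)\<^sup>2 / 2)) * (\<integral>\<^sup>+z. ennreal (exp (a \<bullet> z)) \<partial>std_gaussian)"
    by (rule nn_integral_cmult) measurable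
  finally have "ennreal (exp ((norm a)\<^sup>2 / 2)) * 1 =
     ennreal (exp ((norm a)\<^sup>2 / 2)) * (ennreal (exp (- (norm a)\<^sup>2 / 2)) * (\<integral>\<^sup>+z. ennreal (exp (a \<bullet> z)) \<partial>std_gaussian))" by simp
  then show ?thesis by (simp add: mult.assoc[symmetric] ennreal_mult[symmetric] exp_add[symmetric])
qed

lemma power_le_fact_exp:
  fixes y :: real
  assumes "0 \<le> y"
  shows "y ^ n \<le> fact n * exp y"
proof -
  have s: "(\<lambda>n. y ^ n /\<^sub>R fact n) sums exp y" by (rule exp_converges)
  have "(\<Sum>k\<in>{n}. y ^ k /\<^sub>R fact k) \<le> exp y"
    unfolding sums_unique[OF s] by (rule sum_le_suminf[OF sums_summable[OF s]]) (use assms in auto)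
  then show ?thesis by (simp add: field_simps)
qed

text \<open>The norm is at most \<open>d\<close> times the largest coordinate in absolute value, where \<open>d\<close> is the dimension, so
\<open>exp (norm z)\<close> is dominated by a sum of exponentials of linear functionals.\<close>

lemma std_gaussian_moment_finite:
  "(\<integral>\<^sup>+z. ennreal ((1 + norm (z :: 'a::euclidean_space)) ^ k) \<partial>std_gaussian) < \<infinity>"
proof -
  define d where "d = real DIM('a)"
  have exp_norm: "exp (norm z) \<le> (\<Sum>b\<in>Basis. exp ((d *\<^sub>R b) \<bullet> z) + exp ((- (d *\<^sub>R b)) \<bullet> z))" for z :: 'a
  proof -
    have "finite (Basis :: 'a set)" "(Basis :: 'a set) \<noteq> {}" by auto
    from obtains_MAX[OF this, of "\<lambda>b. \<bar>z \<bullet> b\<bar>"]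
    obtain b where b: "b \<in> Basis" "Max ((\<lambda>b. \<bar>z \<bullet> b\<bar>) ` Basis) = \<bar>z \<bullet> b\<bar>" by metis
    have "norm z \<le> (\<Sum>i\<in>Basis. \<bar>z \<bullet> i\<bar>)" by (rule norm_le_l1)
    also have "\<dots> \<le> (\<Sum>i\<in>(Basis::'a set). \<bar>z \<bullet> b\<bar>)"
      by (intro sum_mono) (simp add: b(2)[symmetric])
    also have "\<dots> = d * \<bar>z \<bullet> b\<bar>" by (simp add: d_def)
    finally have "exp (norm z) \<le> exp (d * \<bar>z \<bullet> b\<bar>)" by simp
    also have "\<dots> \<le> exp ((d *\<^sub>R b) \<bullet> z) + exp ((- (d *\<^sub>R b)) \<bullet> z)"
      by (cases "z \<bullet> b \<ge> 0") (auto simp: inner_commute abs_if)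
    also have "\<dots> \<le> (\<Sum>b\<in>Basis. exp ((d *\<^sub>R b) \<bullet> z) + exp ((- (d *\<^sub>R b)) \<bullet> z))"
      using b(1) by (intro member_le_sum) (auto intro: add_nonneg_nonneg)
    finally show ?thesis .
  qed
  have "(1 + norm z) ^ k \<le> fact k * exp 1 * (\<Sum>b\<in>Basis. exp ((d *\<^sub>R b) \<bullet> z) + exp ((- (d *\<^sub>R b)) \<bullet> z))" for z :: 'a
    using order_trans[OF power_le_fact_exp[of "1 + norm z" k]] mult_left_mono[OF exp_norm, of "fact k * exp 1" z]
    by (simp add: exp_add mult.assoc)
  then have "(\<integral>\<^sup>+z. ennreal ((1 + norm (z::'a)) ^ k) \<partial>std_gaussian) \<le>
    (\<integral>\<^sup>+z. ennreal (fact k * exp 1) * (\<Sum>b\<in>Basis. ennreal (exp ((d *\<^sub>R b) \<bullet> z)) + ennreal (exp ((- (d *\<^sub>R b)) \<bullet> (z :: 'a)))) \<partial>std_gaussian)"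
    by (intro nn_integral_mono) (simp add: ennreal_mult[symmetric] ennreal_plus[symmetric] sum_nonneg del: ennreal_plus)
  also have "\<dots> = ennreal (fact k * exp 1) *
     (\<Sum>b\<in>Basis. (\<integral>\<^sup>+z. ennreal (exp ((d *\<^sub>R b) \<bullet> z)) \<partial>std_gaussian) + (\<integral>\<^sup>+z. ennreal (exp ((- (d *\<^sub>R b)) \<bullet> (z :: 'a))) \<partial>std_gaussian))"
    by (subst nn_integral_cmult) (auto simp: nn_integral_sum nn_integral_add)
  also have "\<dots> < \<infinity>"
    unfolding std_gaussian_exp by (simp add: ennreal_mult_less_top of_nat_less_top ennreal_plus[symmetric] del: ennreal_plus)
  finally show ?thesis .
qed

lemma cosh_ge_quadratic: "1 + x\<^sup>2 / 2 \<le> cosh (x :: real)"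
proof -
  have "\<bar>x / 2\<bar> \<le> \<bar>sinh (x / 2)\<bar>"
    using real_le_abs_sinh[of "x / 2"] by (simp add: sinh_def exp_minus)
  then have "(x / 2)\<^sup>2 \<le> (sinh (x / 2))\<^sup>2" by (rule abs_le_square_iff[THEN iffD1])
  moreover have "cosh x = 1 + 2 * (sinh (x / 2))\<^sup>2"
    using cosh_double[of "x / 2"] cosh_square_eq[of "x / 2"] by simp
  ultimately show ?thesis by (simp add: power2_eq_square)
qed

text \<open>The inequality \<open>1 + s\<^sup>2 y\<^sup>2 / 2 \<le> cosh (s y)\<close> bounds the second moment of \<open>y = v \<bullet> z\<close> by the exponential
moments, whose values are known; the claim follows as \<open>s\<close> tends to 0.\<close>

lemma std_gaussian_second_moment_le:
  fixes v :: "'a::euclidean_space"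
  shows "(\<integral>\<^sup>+z. ennreal ((v \<bullet> z)\<^sup>2) \<partial>std_gaussian) \<le> ennreal ((norm v)\<^sup>2)"
proof -
  define I where "I = (\<integral>\<^sup>+z. ennreal ((v \<bullet> z)\<^sup>2) \<partial>std_gaussian)"
  have half: "ennreal ((a + b) / 2) = ennreal (1 / 2) * (ennreal a + ennreal b)" if "a \<ge> 0" "b \<ge> 0" for a b :: real
    using ennreal_mult'[of "1 / 2" "a + b"] that by (simp add: ennreal_plus[symmetric] del: ennreal_plus)
  have step: "1 + ennreal (s\<^sup>2 / 2) * I \<le> ennreal (exp (s\<^sup>2 * (norm v)\<^sup>2 / 2))" for s :: real
  proof -
    have "1 + ennreal (s\<^sup>2 / 2) * I = (\<integral>\<^sup>+z. ennreal (1 + (s * (v \<bullet> z))\<^sup>2 / 2) \<partial>std_gaussian)"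
      using std_gaussian.emeasure_space_1[where 'a='a]
      by (simp add: I_def nn_integral_cmult[symmetric] nn_integral_add power_mult_distrib ennreal_mult[symmetric] ac_simps)
    also have "\<dots> \<le> (\<integral>\<^sup>+z. ennreal (cosh (s * (v \<bullet> z))) \<partial>std_gaussian)"
      by (intro nn_integral_mono ennreal_leI cosh_ge_quadratic)
    also have "\<dots> = (\<integral>\<^sup>+z. ennreal (1 / 2) * (ennreal (exp ((s *\<^sub>R v) \<bullet> z)) + ennreal (exp ((- (s *\<^sub>R v)) \<bullet> z))) \<partial>std_gaussian)"
    proof (rule nn_integral_cong)
      from half[of "exp (s * (v \<bullet> z))" "exp (- (s * (v \<bullet> z)))" for z]
      show "ennreal (cosh (s * (v \<bullet> z))) = ennreal (1 / 2) * (ennreal (exp ((s *\<^sub>R v) \<bullet> z)) + ennreal (exp ((- (s *\<^sub>R v)) \<bullet> z)))" for z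
        by (simp add: cosh_def)
    qed
    also have "\<dots> = ennreal (1 / 2) * (ennreal (exp ((norm (s *\<^sub>R v))\<^sup>2 / 2)) + ennreal (exp ((norm (- (s *\<^sub>R v)))\<^sup>2 / 2)))"
      unfolding std_gaussian_exp[symmetric] by (subst nn_integral_cmult) (auto simp: nn_integral_add)
    also have "\<dots> = ennreal (exp (s\<^sup>2 * (norm v)\<^sup>2 / 2))"
      by (subst half[symmetric]) (simp_all add: power_mult_distrib)
    finally show ?thesis .
  qed
  have "I \<noteq> \<top>"
    using step[of 1] by (auto simp: ennreal_mult_top top_unique)
  then obtain i where i: "I = ennreal i" "i \<ge> 0" by (cases I) auto
  have real_step: "i \<le> (norm v)\<^sup>2 * exp (s\<^sup>2 * (norm v)\<^sup>2 / 2)" if "s > 0" for s :: real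
  proof -
    define x where "x = s\<^sup>2 * (norm v)\<^sup>2 / 2"
    have "1 + s\<^sup>2 / 2 * i \<le> exp x"
      using step[of s] i by (simp add: x_def ennreal_mult[symmetric] ennreal_plus[symmetric] ennreal_1[symmetric] del: ennreal_plus ennreal_1)
    also have "exp x \<le> 1 + x * exp x"
      using exp_ge_add_one_self[of "- x"] by (simp add: exp_minus field_simps)
    finally have "s\<^sup>2 / 2 * i \<le> s\<^sup>2 / 2 * ((norm v)\<^sup>2 * exp x)" by (simp add: x_def field_simps)
    then show ?thesis using that by (simp add: x_def mult_le_cancel_left)
  qed
  have "i \<le> (norm v)\<^sup>2"
  proof (rule tendsto_lowerbound)
    have "((\<lambda>s. (norm v)\<^sup>2 * exp (s\<^sup>2 * (norm v)\<^sup>2 / 2)) \<longlongrightarrow> (norm v)\<^sup>2 * exp (0\<^sup>2 * (norm v)\<^sup>2 / 2)) (at_right (0::real))"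
      by (intro tendsto_intros) simp
    then show "((\<lambda>s. (norm v)\<^sup>2 * exp (s\<^sup>2 * (norm v)\<^sup>2 / 2)) \<longlongrightarrow> (norm v)\<^sup>2) (at_right (0::real))" by simp
    show "\<forall>\<^sub>F s in at_right (0::real). i \<le> (norm v)\<^sup>2 * exp (s\<^sup>2 * (norm v)\<^sup>2 / 2)"
      using eventually_at_right_less[of "0::real"] by eventually_elim (rule real_step)
  qed simp
  then show ?thesis using i by (simp add: I_def[symmetric] ennreal_leI)
qed

lemma std_gaussian_integrable_power:
  "integrable (std_gaussian :: 'a::euclidean_space measure) (\<lambda>z. (1 + norm z) ^ k)"
  using std_gaussian_moment_finite[of k, where 'a='a] by (intro integrableI_nonneg) auto

lemma std_gaussian_linear_square:
  fixes v :: "'a::euclidean_space"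
  shows "integrable std_gaussian (\<lambda>z. (v \<bullet> z)\<^sup>2)"
    and "integral\<^sup>L std_gaussian (\<lambda>z. (v \<bullet> z)\<^sup>2) \<le> (norm v)\<^sup>2"
proof -
  show *: "integrable std_gaussian (\<lambda>z. (v \<bullet> z)\<^sup>2)"
    using std_gaussian_second_moment_le[of v] by (intro integrableI_nonneg) (auto simp: le_less_trans)
  have "ennreal (integral\<^sup>L std_gaussian (\<lambda>z. (v \<bullet> z)\<^sup>2)) \<le> ennreal ((norm v)\<^sup>2)"
    using std_gaussian_second_moment_le[of v] nn_integral_eq_integral[OF *] by simp
  then show "integral\<^sup>L std_gaussian (\<lambda>z. (v \<bullet> z)\<^sup>2) \<le> (norm v)\<^sup>2" by simp
qed

section \<open>Nondegenerate linear images of the Gaussian law\<close>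

text \<open>With \<open>T\<close> the inverse of the covariance \<open>L L\<^sup>*\<close>, the map \<open>L\<^sup>* T\<close> is a right inverse of \<open>L\<close>. Among all
right inverses it is the one for which the exponent \<open>L\<^sup>* (T v) \<bullet> z = T v \<bullet> L z\<close> in the Cameron--Martin
formula depends on \<open>z\<close> only through \<open>L z\<close>.\<close>

lemma nonsingular_covariance_shift:
  fixes L :: "'b::euclidean_space \<Rightarrow> 'a::euclidean_space"
  assumes L: "linear L" and lam: "lam > 0" and nondeg: "\<And>v. lam * (norm v)\<^sup>2 \<le> (norm (adjoint L v))\<^sup>2"
  obtains T where "linear T" "\<And>v. norm (T v) \<le> norm v / lam" "\<And>v. L (adjoint L (T v)) = v"
proof -
  have adj: "linear (adjoint L)" using L by (rule adjoint_linear)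
  have lin: "linear (L \<circ> adjoint L)" using L adj by (rule linear_compose[rotated])
  have quad: "v \<bullet> L (adjoint L v) = (norm (adjoint L v))\<^sup>2" for v
    using adjoint_works[OF L, of "adjoint L v" v] by (simp add: power2_norm_eq_inner inner_commute)
  have lower: "lam * norm v \<le> norm (L (adjoint L v))" for v
  proof (cases "v = 0")
    case False
    have "lam * (norm v)\<^sup>2 \<le> norm v * norm (L (adjoint L v))"
      using nondeg[of v] quad[of v] norm_cauchy_schwarz[of v "L (adjoint L v)"] by simp
    then have "norm v * (lam * norm v) \<le> norm v * norm (L (adjoint L v))" by (simp add: power2_eq_square ac_simps)
    then show ?thesis using False by (simp add: mult_le_cancel_left)
  qed simp
  have "inj (L \<circ> adjoint L)"
    unfolding linear_injective_0[OF lin]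
  proof (intro allI impI)
    fix v assume "(L \<circ> adjoint L) v = 0"
    then have "lam * norm v \<le> 0" using lower[of v] by simp
    then show "v = 0" using lam by (simp add: mult_le_0_iff)
  qed
  then obtain T where T: "linear T" "\<And>v. (L \<circ> adjoint L) (T v) = v"
    using linear_injective_isomorphism[OF lin] by blast
  show ?thesis
  proof (rule that[OF T(1)])
    show "L (adjoint L (T v)) = v" for v using T(2)[of v] by simp
    then show "norm (T v) \<le> norm v / lam" for v using lower[of "T v"] lam by (simp add: field_simps)
  qed
qed

lemma gaussian_image_shift:
  fixes L :: "'b::euclidean_space \<Rightarrow> 'a::euclidean_space" and A :: "'a set"
  assumes L: "linear L" and T: "\<And>v. L (adjoint L (T v)) = v" and [measurable]: "A \<in> sets borel"
  shows "(\<integral>\<^sup>+z. indicator A (m + L z + v) \<partial>std_gaussian) =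
    (\<integral>\<^sup>+z. indicator A (m + L z) * ennreal (exp (T v \<bullet> L z - (norm (adjoint L (T v)))\<^sup>2 / 2)) \<partial>std_gaussian)"
proof -
  have [measurable]: "L \<in> borel_measurable borel"
    using L by (intro borel_measurable_continuous_onI linear_continuous_on linear_conv_bounded_linear[THEN iffD1])
  have "adjoint L (T v) \<bullet> z = T v \<bullet> L z" for z
    using adjoint_works[OF L, of z "T v"] by (simp add: inner_commute)
  moreover have "m + L (adjoint L (T v) + z) = m + L z + v" for z
    by (simp add: linear_add[OF L] T)
  ultimately show ?thesis
    using cameron_martin[of "\<lambda>z. indicator A (m + L z)" "adjoint L (T v)"] by (simp add: add.assoc)
qed

text \<open>Let \<open>G v\<close> be the probability of \<open>m + L z + v \<in> A\<close>. By \<open>gaussian_image_shift\<close>, \<open>G v = 0\<close> for one \<open>v\<close> if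
and only if \<open>G v = 0\<close> for all \<open>v\<close>, and by Fubini the integral of \<open>G\<close> is the Lebesgue measure of \<open>A\<close>.\<close>

lemma gaussian_image_null_iff:
  fixes L :: "'b::euclidean_space \<Rightarrow> 'a::euclidean_space"
  assumes L: "linear L" and lam: "lam > 0" and nondeg: "\<And>v. lam * (norm v)\<^sup>2 \<le> (norm (adjoint L v))\<^sup>2"
    and A[measurable]: "A \<in> sets borel"
  shows "emeasure (distr std_gaussian borel (\<lambda>z. m + L z)) A = 0 \<longleftrightarrow> emeasure lborel A = 0"
proof -
  have Lm[measurable]: "L \<in> borel_measurable borel"
    using L by (intro borel_measurable_continuous_onI linear_continuous_on linear_conv_bounded_linear[THEN iffD1])
  obtain T where T: "\<And>v. L (adjoint L (T v)) = v"
    using nonsingular_covariance_shift[OF L lam nondeg] by metis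
  define G where "G v = (\<integral>\<^sup>+z. indicator A (m + L z + v) \<partial>(std_gaussian :: 'b measure))" for v :: 'a
  have em: "emeasure (distr std_gaussian borel (\<lambda>z. m + L z)) A = (\<integral>\<^sup>+z. indicator A (m + L z) \<partial>(std_gaussian :: 'b measure))"
    by (rule emeasure_distr_eq_nn_integral) auto
  have G0: "G v = 0 \<longleftrightarrow> emeasure (distr std_gaussian borel (\<lambda>z. m + L z)) A = 0" for v
    unfolding em G_def gaussian_image_shift[OF L T A]
    by (subst (1 2) nn_integral_0_iff_AE) (auto simp: indicator_def)
  have "(\<integral>\<^sup>+v. G v \<partial>lborel) = (\<integral>\<^sup>+z. \<integral>\<^sup>+v. indicator A (m + L z + v) \<partial>lborel \<partial>(std_gaussian :: 'b measure))"
  proof -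
    interpret pair_sigma_finite "std_gaussian :: 'b measure" "lborel :: 'a measure" ..
    show ?thesis unfolding G_def
      by (intro Fubini') measurable
  qed
  also have "\<dots> = (\<integral>\<^sup>+z. emeasure lborel A \<partial>(std_gaussian :: 'b measure))"
    by (intro nn_integral_cong) (simp add: nn_integral_lborel_shift)
  finally have "emeasure lborel A = (\<integral>\<^sup>+v. G v \<partial>lborel)"
    using std_gaussian.emeasure_space_1[where 'a='b] by simp
  moreover have "G \<in> borel_measurable lborel" unfolding G_def by measurable
  ultimately have "emeasure lborel A = 0 \<longleftrightarrow> (AE v in lborel. G v = 0)"
    by (simp add: nn_integral_0_iff_AE)
  also have "\<dots> \<longleftrightarrow> emeasure (distr std_gaussian borel (\<lambda>z. m + L z)) A = 0"
    unfolding G0 by (simp add: AE_iff_null null_sets_def)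
  finally show ?thesis ..
qed

text \<open>As long as \<open>m + L z\<close> stays in the ball of radius \<open>r\<close>, the density in \<open>gaussian_image_shift\<close> is at most a
constant \<open>D\<close> for all shifts \<open>v\<close> of length at most \<open>R\<close>. Averaging over these shifts turns the law of
\<open>m + L z\<close> into Lebesgue measure on that ball, except on an event for \<open>z\<close> of probability at most 1/2.
All constants depend on the bounds only; this makes the estimate uniform over compact sets of
starting points.\<close>

lemma gaussian_image_minorization:
  fixes r \<Lambda> lam :: real
  assumes lam: "lam > 0" and r: "r \<ge> 0" and \<Lambda>: "\<Lambda> \<ge> 0"
  obtains \<epsilon> where "\<epsilon> > 0"
    "\<And>(L :: 'b::euclidean_space \<Rightarrow> 'a::euclidean_space) m A.
      linear L \<Longrightarrow> (\<And>v. lam * (norm v)\<^sup>2 \<le> (norm (adjoint L v))\<^sup>2) \<Longrightarrow> (\<And>z. norm (L z) \<le> \<Lambda> * norm z) \<Longrightarrow>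
      norm m \<le> r \<Longrightarrow> A \<in> sets borel \<Longrightarrow> A \<subseteq> cball 0 r \<Longrightarrow>
      ennreal \<epsilon> * emeasure lborel A \<le> emeasure (distr std_gaussian borel (\<lambda>z. m + L z)) A"
proof -
  obtain k :: real where k: "k \<ge> 0" "emeasure (std_gaussian :: 'b measure) (cball 0 k) \<ge> ennreal (1/2)"
  proof -
    have "(\<lambda>n. emeasure (std_gaussian :: 'b measure) (cball 0 (real n))) \<longlonglongrightarrow> emeasure (std_gaussian :: 'b measure) (\<Union>n. cball 0 (real n))"
      by (rule Lim_emeasure_incseq) (auto simp: incseq_def)
    moreover have "(\<Union>n. cball 0 (real n)) = (UNIV :: 'b set)"
      by (auto simp: real_arch_simple)
    ultimately have "(\<lambda>n. emeasure (std_gaussian :: 'b measure) (cball 0 (real n))) \<longlonglongrightarrow> 1"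
      using std_gaussian.emeasure_space_1[where 'a='b] by simp
    moreover have "ennreal (1 / 2) < 1" unfolding ennreal_less_one_iff by simp
    ultimately have "\<forall>\<^sub>F n in sequentially. ennreal (1/2) < emeasure (std_gaussian :: 'b measure) (cball 0 (real n))"
      by (rule order_tendstoD(1))
    then obtain n where "ennreal (1/2) < emeasure (std_gaussian :: 'b measure) (cball 0 (real n))"
      unfolding eventually_sequentially by blast
    then show ?thesis using that[of "real n"] by simp
  qed
  \<comment> \<open>If \<open>|z| \<le> k\<close>, then shifts of length at most \<open>R\<close> carry \<open>m + L z\<close> to every point of the ball of radius \<open>r\<close>.\<close>
  define R where "R = 2 * r + \<Lambda> * k + 1"
  have R: "R > 0" using r \<Lambda> k by (simp add: R_def add_nonneg_pos)
  define vol where "vol = measure lborel (cball (0::'a) R)"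
  have vol: "emeasure lborel (cball (0::'a) R) = ennreal vol" "vol > 0"
    unfolding vol_def using emeasure_lborel_cball_finite[of "0::'a" R] content_cball_pos[OF R]
    by (auto simp: emeasure_eq_ennreal_measure less_top)
  define D where "D = exp (R / lam * (2 * r))"
  define \<epsilon> where "\<epsilon> = 1 / (2 * D * vol)"
  have D: "D > 0" by (simp add: D_def)
  show ?thesis
  proof (rule that[of \<epsilon>])
    show "\<epsilon> > 0" using D vol by (simp add: \<epsilon>_def)
    fix L :: "'b \<Rightarrow> 'a" and m :: 'a and A :: "'a set"
    assume L: "linear L" and nondeg: "\<And>v. lam * (norm v)\<^sup>2 \<le> (norm (adjoint L v))\<^sup>2"
      and bound: "\<And>z. norm (L z) \<le> \<Lambda> * norm z" and m: "norm m \<le> r"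
      and A[measurable]: "A \<in> sets borel" and Ar: "A \<subseteq> cball 0 r"
    have Lm[measurable]: "L \<in> borel_measurable borel"
      using L by (intro borel_measurable_continuous_onI linear_continuous_on linear_conv_bounded_linear[THEN iffD1])
    obtain T where T: "\<And>v. L (adjoint L (T v)) = v" "\<And>v. norm (T v) \<le> norm v / lam"
      using nonsingular_covariance_shift[OF L lam nondeg] by metis
    define \<mu> where "\<mu> = emeasure (distr std_gaussian borel (\<lambda>z. m + L z)) A"
    have em: "\<mu> = (\<integral>\<^sup>+z. indicator A (m + L z) \<partial>(std_gaussian :: 'b measure))"
      unfolding \<mu>_def by (rule emeasure_distr_eq_nn_integral) auto
    have upper: "(\<integral>\<^sup>+z. indicator A (m + L z + v) \<partial>(std_gaussian :: 'b measure)) \<le> ennreal D * \<mu>"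
      if v: "norm v \<le> R" for v
    proof -
      have "indicator A (m + L z) * ennreal (exp (T v \<bullet> L z - (norm (adjoint L (T v)))\<^sup>2 / 2)) \<le> ennreal D * indicator A (m + L z)" for z
      proof (cases "m + L z \<in> A")
        case True
        then have "norm (m + L z) \<le> r" using Ar by auto
        then have "norm (L z) \<le> 2 * r" using m norm_triangle_ineq4[of "m + L z" m] by simp
        moreover have "norm (T v) \<le> R / lam" using T(2)[of v] v lam by (meson divide_right_mono less_imp_le order_trans)
        ultimately have "T v \<bullet> L z \<le> R / lam * (2 * r)"
          using norm_cauchy_schwarz[of "T v" "L z"] mult_mono[of "norm (T v)" "R / lam" "norm (L z)" "2 * r"] R lam by simp
        then have "T v \<bullet> L z - (norm (adjoint L (T v)))\<^sup>2 / 2 \<le> R / lam * (2 * r)"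
          using zero_le_power2[of "norm (adjoint L (T v))"] by linarith
        then show ?thesis using True by (simp add: D_def ennreal_leI)
      qed simp
      then have "(\<integral>\<^sup>+z. indicator A (m + L z + v) \<partial>(std_gaussian :: 'b measure)) \<le> (\<integral>\<^sup>+z. ennreal D * indicator A (m + L z) \<partial>(std_gaussian :: 'b measure))"
        unfolding gaussian_image_shift[OF L T(1) A] by (intro nn_integral_mono)
      then show ?thesis unfolding em by (simp add: nn_integral_cmult)
    qed
    have "emeasure lborel A * ennreal (1 / 2) \<le> emeasure lborel A * emeasure (std_gaussian :: 'b measure) (cball 0 k)"
      using k(2) by (rule mult_left_mono) simp
    also have "\<dots> = (\<integral>\<^sup>+z. emeasure lborel A * indicator (cball 0 k) z \<partial>(std_gaussian :: 'b measure))"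
      by (simp add: nn_integral_cmult_indicator)
    also have "\<dots> \<le> (\<integral>\<^sup>+z. \<integral>\<^sup>+v. indicator A (m + L z + v) * indicator (cball 0 R) v \<partial>lborel \<partial>(std_gaussian :: 'b measure))"
    proof (rule nn_integral_mono)
      fix z :: 'b
      show "emeasure lborel A * indicator (cball 0 k) z \<le> (\<integral>\<^sup>+v. indicator A (m + L z + v) * indicator (cball 0 R) v \<partial>lborel)"
      proof (cases "z \<in> cball 0 k")
        case True
        have "emeasure lborel A = (\<integral>\<^sup>+v. indicator A (m + L z + v) \<partial>lborel)"
          by (simp add: nn_integral_lborel_shift)
        also have "\<dots> \<le> (\<integral>\<^sup>+v. indicator A (m + L z + v) * indicator (cball 0 R) v \<partial>lborel)"
        proof (intro nn_integral_mono)
          fix v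
          have "norm v \<le> R" if "m + L z + v \<in> A"
          proof -
            have "norm (m + L z + v) \<le> r" using that Ar by auto
            moreover have "norm (L z) \<le> \<Lambda> * k"
              using bound[of z] True \<Lambda> mult_left_mono[of "norm z" k \<Lambda>] by (simp add: dist_norm)
            moreover have "norm v \<le> norm (m + L z + v) + norm m + norm (L z)"
              using norm_triangle_ineq4[of "m + L z + v" "m + L z"] norm_triangle_ineq[of m "L z"] by simp
            ultimately show ?thesis using m by (simp add: R_def)
          qed
          then show "indicator A (m + L z + v) \<le> indicator A (m + L z + v) * (indicator (cball 0 R) v :: ennreal)"
            by (auto simp: indicator_def)
        qed
        finally show ?thesis using True by simp
      qed simp
    qed
    also have "\<dots> = (\<integral>\<^sup>+v. \<integral>\<^sup>+z. indicator A (m + L z + v) * indicator (cball 0 R) v \<partial>(std_gaussian :: 'b measure) \<partial>lborel)"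
    proof -
      interpret pair_sigma_finite "std_gaussian :: 'b measure" "lborel :: 'a measure" ..
      have [measurable]: "cball (0::'a) R \<in> sets borel" by simp
      show ?thesis by (intro Fubini'[symmetric]) measurable
    qed
    also have "\<dots> \<le> (\<integral>\<^sup>+v. (ennreal D * \<mu>) * indicator (cball (0::'a) R) v \<partial>lborel)"
      using upper by (intro nn_integral_mono) (auto simp: indicator_def)
    also have "\<dots> = ennreal D * \<mu> * ennreal vol" by (simp add: nn_integral_cmult_indicator vol)
    finally have main: "emeasure lborel A * ennreal (1 / 2) \<le> ennreal D * \<mu> * ennreal vol" .
    have "ennreal \<epsilon> * emeasure lborel A = ennreal (1 / (D * vol)) * (emeasure lborel A * ennreal (1 / 2))"
    proof -
      have "ennreal \<epsilon> = ennreal (1 / (D * vol)) * ennreal (1 / 2)"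
        using D vol by (subst ennreal_mult[symmetric]) (simp_all add: \<epsilon>_def)
      then show ?thesis by (simp only: ac_simps)
    qed
    also have "\<dots> \<le> ennreal (1 / (D * vol)) * (ennreal D * \<mu> * ennreal vol)"
      using main by (rule mult_left_mono) simp
    also have "\<dots> = (ennreal (1 / (D * vol)) * (ennreal D * ennreal vol)) * \<mu>" by (simp add: ac_simps)
    also have "\<dots> = \<mu>" using D vol by (simp add: ennreal_mult[symmetric])
    finally show "ennreal \<epsilon> * emeasure lborel A \<le> emeasure (distr std_gaussian borel (\<lambda>z. m + L z)) A"
      by (simp add: \<mu>_def)
  qed
qed

section \<open>Moments of one Euler--Maruyama step\<close>

text \<open>The remainder has two terms: \<open>\<xi>\<^sup>4\<close> for small \<open>\<xi>\<close>, and a high even power for large \<open>\<xi>\<close>, where it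
dominates both \<open>(1 + \<xi>)\<^sup>q\<close> and the polynomial. The expansion goes up to order 3 because the noise is only of
order \<open>\<delta>\<^sup>(\<^sup>1\<^sup>-\<^sup>\<gamma>\<^sup>)\<^sup>/\<^sup>2\<close>: an error of order \<open>|\<xi>|\<^sup>3\<close> would be of order \<open>\<delta>\<close> for \<open>\<gamma> = 1/3\<close> and could not be absorbed.\<close>

lemma powr_taylor_bound:
  fixes q :: real
  assumes q: "q \<ge> 1"
  obtains C :: real and N :: nat where "C \<ge> 0" "N \<ge> 2"
    "\<And>\<xi>. \<xi> \<ge> -1 \<Longrightarrow> (1 + \<xi>) powr q \<le> 1 + q * \<xi> + q * (q - 1) / 2 * \<xi>\<^sup>2 + q * (q - 1) * (q - 2) / 6 * \<xi> ^ 3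
       + C * (\<xi> ^ 4 + \<xi> ^ (2 * N))"
proof -
  define c3 where "c3 = q * (q - 1) * (q - 2) / 6"
  define c4 where "c4 = q * (q - 1) * (q - 2) * (q - 3) / 24"
  define N where "N = nat \<lceil>q\<rceil> + 2"
  define C1 where "C1 = \<bar>c4\<bar> * 2 powr \<bar>q - 4\<bar>"
  define C2 where "C2 = 6 ^ (2 * N) + (1 + q + q * (q - 1) / 2 + \<bar>c3\<bar>) * 2 ^ (2 * N)"
  have "q \<le> real N" using real_nat_ceiling_ge[of q] unfolding N_def of_nat_add by linarith
  then have Nq: "q \<le> real (2 * N)" "2 * N \<ge> 3"
    unfolding of_nat_mult by (linarith, simp add: N_def)
  have C1: "C1 \<ge> 0" by (simp add: C1_def)
  have C2: "C2 \<ge> 0" unfolding C2_def using q by (intro add_nonneg_nonneg mult_nonneg_nonneg) auto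
  have even_pow: "\<xi> ^ (2 * N) \<ge> 0" "\<xi> ^ 4 \<ge> 0" for \<xi> :: real by (simp_all add: power_mult)
  have small: "(1 + \<xi>) powr q \<le> 1 + q * \<xi> + q * (q - 1) / 2 * \<xi>\<^sup>2 + c3 * \<xi> ^ 3 + C1 * \<xi> ^ 4"
    if \<xi>: "\<bar>\<xi>\<bar> \<le> 1 / 2" for \<xi>
  proof (cases "\<xi> = 0")
    case False
    define diff where "diff m t = (\<Prod>i<m. q - real i) * (1 + t) powr (q - real m)" for m t
    have "\<exists>t. (if \<xi> < 0 then \<xi> < t \<and> t < 0 else 0 < t \<and> t < \<xi>) \<and>
        (1 + \<xi>) powr q = (\<Sum>m<4. diff m 0 / fact m * (\<xi> - 0) ^ m) + diff 4 t / fact 4 * (\<xi> - 0) ^ 4"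
    proof (rule Taylor[where a="-1/2" and b="1/2"])
      show "diff 0 = (\<lambda>\<xi>. (1 + \<xi>) powr q)" by (simp add: diff_def fun_eq_iff)
      show "\<forall>m t. m < 4 \<and> -1/2 \<le> t \<and> t \<le> 1/2 \<longrightarrow> DERIV (diff m) t :> diff (Suc m) t"
      proof (intro allI impI)
        fix m :: nat and t :: real assume "m < 4 \<and> -1/2 \<le> t \<and> t \<le> 1/2"
        then have "1 + t > 0" by linarith
        then have "((\<lambda>t. (1 + t) powr (q - real m)) has_real_derivative (q - real m) * (1 + t) powr (q - real m - 1)) (at t)"
          by (auto intro!: derivative_eq_intros)
        then have "(diff m has_real_derivative (\<Prod>i<m. q - real i) * ((q - real m) * (1 + t) powr (q - real m - 1))) (at t)"
          unfolding diff_def by (rule DERIV_cmult)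
        then show "DERIV (diff m) t :> diff (Suc m) t"
          by (simp add: diff_def algebra_simps)
      qed
    qed (use \<xi> False in auto)
    then obtain t where t0: "if \<xi> < 0 then \<xi> < t \<and> t < 0 else 0 < t \<and> t < \<xi>"
      and eq: "(1 + \<xi>) powr q = (\<Sum>m<4. diff m 0 / fact m * \<xi> ^ m) + diff 4 t / fact 4 * \<xi> ^ 4"
      unfolding diff_zero by blast
    have t: "\<bar>t\<bar> \<le> 1 / 2" using t0 \<xi> by (auto split: if_splits)
    have sum: "(\<Sum>m<4. diff m 0 / fact m * \<xi> ^ m) = 1 + q * \<xi> + q * (q - 1) / 2 * \<xi>\<^sup>2 + c3 * \<xi> ^ 3"
      by (simp add: eval_nat_numeral diff_def c3_def fact_numeral) 
    have "(1 + t) powr (q - 4) \<le> 2 powr \<bar>q - 4\<bar>"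
    proof (cases "q \<ge> 4")
      case True
      then show ?thesis using t by (auto intro!: powr_mono2)
    next
      case False
      have "(1 + t) powr (q - 4) = 1 / (1 + t) powr (4 - q)"
        using t by (simp add: powr_minus_divide[symmetric])
      also have "\<dots> \<le> 1 / (1 / 2) powr (4 - q)"
        using t False by (intro divide_left_mono powr_mono2) auto
      also have "\<dots> = 2 powr \<bar>q - 4\<bar>" using False by (simp add: powr_divide)
      finally show ?thesis .
    qed
    then have "c4 * (1 + t) powr (q - 4) \<le> C1"
      unfolding C1_def using mult_mono[of c4 "\<bar>c4\<bar>" "(1 + t) powr (q - 4)" "2 powr \<bar>q - 4\<bar>"] by simp
    moreover have "diff 4 t / fact 4 = c4 * (1 + t) powr (q - 4)"
      by (simp add: eval_nat_numeral diff_def c4_def fact_numeral)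
    ultimately have "diff 4 t / fact 4 * \<xi> ^ 4 \<le> C1 * \<xi> ^ 4"
      using even_pow by (intro mult_right_mono) auto
    then show ?thesis using eq sum by simp
  qed simp
  have large: "(1 + \<xi>) powr q \<le> 1 + q * \<xi> + q * (q - 1) / 2 * \<xi>\<^sup>2 + c3 * \<xi> ^ 3 + C2 * \<xi> ^ (2 * N)"
    if \<xi>: "\<bar>\<xi>\<bar> \<ge> 1 / 2" "\<xi> \<ge> -1" for \<xi>
  proof -
    have pow: "\<bar>\<xi>\<bar> ^ k \<le> (2 * \<bar>\<xi>\<bar>) ^ (2 * N)" if "k \<le> 3" for k
    proof -
      have "\<bar>\<xi>\<bar> ^ k \<le> (2 * \<bar>\<xi>\<bar>) ^ k" by (rule power_mono) auto
      also have "\<dots> \<le> (2 * \<bar>\<xi>\<bar>) ^ (2 * N)" using \<xi> Nq that by (intro power_increasing) auto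
      finally show ?thesis .
    qed
    have "(1 + \<xi>) powr q \<le> (6 * \<bar>\<xi>\<bar>) powr q" using \<xi> q by (intro powr_mono2) auto
    also have "\<dots> \<le> (6 * \<bar>\<xi>\<bar>) powr real (2 * N)" using \<xi> Nq by (intro powr_mono) auto
    also have "\<dots> = (6 * \<bar>\<xi>\<bar>) ^ (2 * N)" using \<xi> by (intro powr_realpow) auto
    also have "\<dots> = 6 ^ (2 * N) * \<xi> ^ (2 * N)" by (simp add: power_mult_distrib power_even_abs)
    finally have 1: "(1 + \<xi>) powr q \<le> 6 ^ (2 * N) * \<xi> ^ (2 * N)" .
    define P where "P = (2 * \<bar>\<xi>\<bar>) ^ (2 * N)"
    have P: "P = 2 ^ (2 * N) * \<xi> ^ (2 * N)" by (simp add: P_def power_mult_distrib power_even_abs)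
    have "- (1 + q * \<xi> + q * (q - 1) / 2 * \<xi>\<^sup>2 + c3 * \<xi> ^ 3) \<le>
        \<bar>\<xi>\<bar> ^ 0 + q * \<bar>\<xi>\<bar> ^ 1 + q * (q - 1) / 2 * \<bar>\<xi>\<bar> ^ 2 + \<bar>c3\<bar> * \<bar>\<xi>\<bar> ^ 3"
    proof -
      have "- (q * \<xi>) \<le> q * \<bar>\<xi>\<bar>" using q by (auto simp: abs_if mult_le_0_iff)
      moreover have "0 \<le> q * (q - 1) / 2 * \<xi>\<^sup>2" using q by simp
      moreover have "- (c3 * \<xi> ^ 3) \<le> \<bar>c3\<bar> * \<bar>\<xi>\<bar> ^ 3" by (metis abs_ge_minus_self abs_mult power_abs)
      ultimately show ?thesis by simp
    qed
    also have "\<dots> \<le> P + q * P + q * (q - 1) / 2 * P + \<bar>c3\<bar> * P"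
      unfolding P_def using q by (intro add_mono mult_left_mono pow) auto
    also have "\<dots> = (1 + q + q * (q - 1) / 2 + \<bar>c3\<bar>) * 2 ^ (2 * N) * \<xi> ^ (2 * N)"
      by (simp add: P algebra_simps)
    finally show ?thesis using 1 by (simp add: C2_def distrib_right)
  qed
  show ?thesis
  proof (rule that[of "C1 + C2" N])
    show "C1 + C2 \<ge> 0" using C1 C2 by simp
    show "N \<ge> 2" by (simp add: N_def)
    fix \<xi> :: real assume \<xi>: "\<xi> \<ge> -1"
    have "C1 * \<xi> ^ 4 \<le> (C1 + C2) * (\<xi> ^ 4 + \<xi> ^ (2 * N))" "C2 * \<xi> ^ (2 * N) \<le> (C1 + C2) * (\<xi> ^ 4 + \<xi> ^ (2 * N))"
      using C1 C2 even_pow[of \<xi>] by (auto intro!: mult_mono)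
    then show "(1 + \<xi>) powr q \<le> 1 + q * \<xi> + q * (q - 1) / 2 * \<xi>\<^sup>2 + q * (q - 1) * (q - 2) / 6 * \<xi> ^ 3
       + (C1 + C2) * (\<xi> ^ 4 + \<xi> ^ (2 * N))"
      using small[of \<xi>] large[of \<xi>] \<xi> unfolding c3_def by (cases "\<bar>\<xi>\<bar> \<le> 1 / 2") auto
  qed
qed

lemma power_add_le:
  fixes a b :: real
  shows "(a + b) ^ (2 * n) \<le> 2 ^ (2 * n) * (a ^ (2 * n) + b ^ (2 * n))"
proof -
  define c where "c = max \<bar>a\<bar> \<bar>b\<bar>"
  have "(a + b) ^ (2 * n) = \<bar>a + b\<bar> ^ (2 * n)" by (simp add: power_even_abs)
  also have "\<dots> \<le> (2 * c) ^ (2 * n)" by (rule power_mono) (auto simp: c_def)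
  also have "\<dots> = 2 ^ (2 * n) * c ^ (2 * n)" by (simp add: power_mult_distrib)
  also have "c ^ (2 * n) \<le> a ^ (2 * n) + b ^ (2 * n)"
  proof -
    have "c ^ (2 * n) = a ^ (2 * n) \<or> c ^ (2 * n) = b ^ (2 * n)"
      unfolding c_def max_def by (auto simp: power_even_abs)
    moreover have "a ^ (2 * n) \<ge> 0" "b ^ (2 * n) \<ge> 0" by (simp_all add: power_mult)
    ultimately show ?thesis by linarith
  qed
  finally show ?thesis by simp
qed

text \<open>Averaging over the sign of \<open>\<beta>\<close> removes the odd powers of \<open>\<beta>\<close>. What remains of the cubic term is
\<open>\<eta>\<^sup>3 + 3 \<eta> \<beta>\<^sup>2\<close>, which is dominated by the error terms. In the application \<open>\<eta>\<close> is of order \<open>a\<close> and \<open>\<beta>\<close> of order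
\<open>a\<^sup>1\<^sup>/\<^sup>2\<close> for a small \<open>a\<close>, so that every error term is of order \<open>a\<^sup>2\<close>.\<close>

lemma symmetrized_powr_bound:
  fixes q :: real
  assumes q: "q \<ge> 1"
  obtains C :: real and N :: nat where "C \<ge> 0" "N \<ge> 2"
    "\<And>\<eta> \<beta>. \<bar>\<beta>\<bar> \<le> 1 + \<eta> \<Longrightarrow> ((1 + \<eta> + \<beta>) powr q + (1 + \<eta> - \<beta>) powr q) / 2 \<le>
      1 + q * \<eta> + q * (q - 1) / 2 * \<beta>\<^sup>2 + C * (\<eta>\<^sup>2 + \<beta> ^ 4 + \<eta> ^ (2 * N) + \<beta> ^ (2 * N))"
proof -
  obtain C :: real and N :: nat where C: "C \<ge> 0" and N: "N \<ge> 2"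
    and bound: "\<And>\<xi>. \<xi> \<ge> -1 \<Longrightarrow> (1 + \<xi>) powr q \<le> 1 + q * \<xi> + q * (q - 1) / 2 * \<xi>\<^sup>2 + q * (q - 1) * (q - 2) / 6 * \<xi> ^ 3
       + C * (\<xi> ^ 4 + \<xi> ^ (2 * N))"
    by (rule powr_taylor_bound[OF q]) blast
  define c2 where "c2 = q * (q - 1) / 2"
  define c3 where "c3 = q * (q - 1) * (q - 2) / 6"
  define C' where "C' = c2 + 4 * \<bar>c3\<bar> + C * (32 + 2 ^ (2 * N))"
  have c2: "c2 \<ge> 0" using q by (simp add: c2_def)
  show ?thesis
  proof (rule that[of C' N])
    show "C' \<ge> 0" using c2 C by (simp add: C'_def)
    show "N \<ge> 2" by fact
    fix \<eta> \<beta> :: real assume le: "\<bar>\<beta>\<bar> \<le> 1 + \<eta>"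
    define S where "S = \<eta>\<^sup>2 + \<beta> ^ 4 + \<eta> ^ (2 * N) + \<beta> ^ (2 * N)"
    have nn: "\<eta>\<^sup>2 \<ge> 0" "\<beta> ^ 4 \<ge> 0" "\<eta> ^ (2 * N) \<ge> 0" "\<beta> ^ (2 * N) \<ge> 0" by (simp_all add: power_mult)
    have eta4: "\<eta> ^ 4 \<le> \<eta>\<^sup>2 + \<eta> ^ (2 * N)"
    proof (cases "\<bar>\<eta>\<bar> \<le> 1")
      case True
      then have "\<bar>\<eta>\<bar> ^ 4 \<le> \<bar>\<eta>\<bar> ^ 2" by (intro power_decreasing) auto
      then have "\<eta> ^ 4 \<le> \<eta>\<^sup>2" by (simp add: power_even_abs)
      then show ?thesis using nn by linarith
    next
      case False
      then have "\<bar>\<eta>\<bar> ^ 4 \<le> \<bar>\<eta>\<bar> ^ (2 * N)" using N by (intro power_increasing) auto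
      then have "\<eta> ^ 4 \<le> \<eta> ^ (2 * N)" by (simp add: power_even_abs)
      then show ?thesis using nn by linarith
    qed
    have cube: "\<bar>\<eta> ^ 3 + 3 * \<eta> * \<beta>\<^sup>2\<bar> \<le> 4 * S"
    proof -
      have "\<bar>\<eta> ^ 3\<bar> \<le> (\<eta>\<^sup>2 + \<eta> ^ 4) / 2"
        using sum_squares_bound[of "\<bar>\<eta>\<bar>" "\<eta>\<^sup>2"] by (simp add: eval_nat_numeral abs_mult)
      moreover have "\<bar>3 * \<eta> * \<beta>\<^sup>2\<bar> \<le> 3 / 2 * (\<eta>\<^sup>2 + \<beta> ^ 4)"
        using sum_squares_bound[of "\<bar>\<eta>\<bar>" "\<beta>\<^sup>2"] by (simp add: eval_nat_numeral abs_mult)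
      ultimately have "\<bar>\<eta> ^ 3 + 3 * \<eta> * \<beta>\<^sup>2\<bar> \<le> (\<eta>\<^sup>2 + \<eta> ^ 4) / 2 + 3 / 2 * (\<eta>\<^sup>2 + \<beta> ^ 4)" by linarith
      then show ?thesis using eta4 nn unfolding S_def by argo
    qed
    have four: "(\<eta> + \<beta>) ^ 4 + (\<eta> - \<beta>) ^ 4 \<le> 64 * S"
    proof -
      have "(\<eta> + \<beta>) ^ 4 \<le> 16 * (\<eta> ^ 4 + \<beta> ^ 4)" "(\<eta> - \<beta>) ^ 4 \<le> 16 * (\<eta> ^ 4 + \<beta> ^ 4)"
        using power_add_le[of \<eta> \<beta> 2] power_add_le[of \<eta> "- \<beta>" 2] by simp_all
      then show ?thesis using eta4 nn unfolding S_def by argo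
    qed
    have high: "(\<eta> + \<beta>) ^ (2 * N) + (\<eta> - \<beta>) ^ (2 * N) \<le> 2 * 2 ^ (2 * N) * S"
    proof -
      have "(\<eta> + \<beta>) ^ (2 * N) + (\<eta> - \<beta>) ^ (2 * N) \<le> 2 * 2 ^ (2 * N) * (\<eta> ^ (2 * N) + \<beta> ^ (2 * N))"
        using power_add_le[of \<eta> \<beta> N] power_add_le[of \<eta> "- \<beta>" N] by simp
      also have "\<dots> \<le> 2 * 2 ^ (2 * N) * S"
        using nn by (intro mult_left_mono) (auto simp: S_def)
      finally show ?thesis .
    qed
    have "(1 + \<eta> + \<beta>) powr q + (1 + \<eta> - \<beta>) powr q \<le>
       (1 + q * (\<eta> + \<beta>) + c2 * (\<eta> + \<beta>)\<^sup>2 + c3 * (\<eta> + \<beta>) ^ 3 + C * ((\<eta> + \<beta>) ^ 4 + (\<eta> + \<beta>) ^ (2 * N)))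
       + (1 + q * (\<eta> - \<beta>) + c2 * (\<eta> - \<beta>)\<^sup>2 + c3 * (\<eta> - \<beta>) ^ 3 + C * ((\<eta> - \<beta>) ^ 4 + (\<eta> - \<beta>) ^ (2 * N)))"
      using bound[of "\<eta> + \<beta>"] bound[of "\<eta> - \<beta>"] le unfolding c2_def c3_def
      by (intro add_mono) (auto simp: add_diff_eq add.assoc)
    also have "\<dots> = 2 * (1 + q * \<eta> + c2 * \<beta>\<^sup>2) + 2 * (c2 * \<eta>\<^sup>2) + 2 * (c3 * (\<eta> ^ 3 + 3 * \<eta> * \<beta>\<^sup>2))
        + C * (((\<eta> + \<beta>) ^ 4 + (\<eta> - \<beta>) ^ 4) + ((\<eta> + \<beta>) ^ (2 * N) + (\<eta> - \<beta>) ^ (2 * N)))"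
      by (simp add: algebra_simps power2_eq_square power3_eq_cube)
    also have "\<dots> \<le> 2 * (1 + q * \<eta> + c2 * \<beta>\<^sup>2) + 2 * (c2 * S) + 2 * (\<bar>c3\<bar> * (4 * S)) + C * (64 * S + 2 * 2 ^ (2 * N) * S)"
    proof (intro add_mono order_refl mult_left_mono four high)
      show "\<eta>\<^sup>2 \<le> S" using nn by (simp add: S_def)
      show "c3 * (\<eta> ^ 3 + 3 * \<eta> * \<beta>\<^sup>2) \<le> \<bar>c3\<bar> * (4 * S)"
        using mult_left_mono[OF cube abs_ge_zero[of c3]] abs_ge_self[of "c3 * (\<eta> ^ 3 + 3 * \<eta> * \<beta>\<^sup>2)"]
        unfolding abs_mult[of c3] by linarith
    qed (use c2 C in auto)
    also have "\<dots> = 2 * (1 + q * \<eta> + c2 * \<beta>\<^sup>2 + C' * S)" by (simp add: C'_def algebra_simps)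
    finally show "((1 + \<eta> + \<beta>) powr q + (1 + \<eta> - \<beta>) powr q) / 2 \<le>
      1 + q * \<eta> + q * (q - 1) / 2 * \<beta>\<^sup>2 + C' * (\<eta>\<^sup>2 + \<beta> ^ 4 + \<eta> ^ (2 * N) + \<beta> ^ (2 * N))"
      by (simp add: S_def c2_def)
  qed
qed

lemma norm_matrix_sq: "(norm (A :: real ^ 'm ^ 'd))\<^sup>2 = (\<Sum>i\<in>UNIV. (norm (A $ i))\<^sup>2)"
  by (simp add: norm_vec_def L2_set_def sum_nonneg)

lemma norm_matrix_vector_sq:
  "(norm ((A :: real ^ 'm ^ 'd) *v z))\<^sup>2 = (\<Sum>i\<in>UNIV. (A $ i \<bullet> z)\<^sup>2)"
  by (simp add: norm_vec_def L2_set_def sum_nonneg matrix_vector_mul_component)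

lemma norm_matrix_vector_le: "norm ((A :: real ^ 'm ^ 'd) *v z) \<le> norm A * norm z"
proof (rule power2_le_imp_le)
  have "(norm (A *v z))\<^sup>2 \<le> (\<Sum>i\<in>UNIV. (norm (A $ i) * norm z)\<^sup>2)"
    unfolding norm_matrix_vector_sq
    by (intro sum_mono abs_le_square_iff[THEN iffD1]) (simp add: Cauchy_Schwarz_ineq2)
  also have "\<dots> = (norm A * norm z)\<^sup>2"
    by (simp add: norm_matrix_sq power_mult_distrib sum_distrib_right)
  finally show "(norm (A *v z))\<^sup>2 \<le> (norm A * norm z)\<^sup>2" .
qed simp

lemma norm_transpose_matrix: "norm (transpose A) = norm (A :: real ^ 'm ^ 'd)"
proof -
  have "(norm (transpose A))\<^sup>2 = (norm A)\<^sup>2"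
    unfolding norm_matrix_sq norm_vec_def L2_set_def transpose_def
    by (simp add: sum_nonneg) (rule sum.swap)
  then show ?thesis by (rule power2_eq_imp_eq) simp_all
qed

text \<open>The number \<open>a\<close> stands for \<open>h\<^sup>1\<^sup>-\<^sup>\<gamma>\<close>. One step with noise \<open>z\<close> or \<open>- z\<close> multiplies \<open>1 + |x|\<^sup>2\<close> by
\<open>1 + \<eta> \<plusminus> \<beta>\<close>, where \<open>\<beta>\<close> is linear in \<open>z\<close> and \<open>\<eta>\<close> contains the drift and the quadratic term. By the symmetry
of the Gaussian law only the average over both signs matters. The mean of \<open>\<eta>\<close> contributes
\<open>|g|\<^sup>2\<close> to the bracket and the mean of \<open>\<beta>\<^sup>2\<close> contributes \<open>(2 q - 2) |g|\<^sup>2\<close>; with \<open>q = p / 2\<close> their sum is the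
\<open>(p - 1) |g|\<^sup>2\<close> of the dissipativity condition.\<close>

lemma one_step_moment_bound:
  fixes q A :: real
  assumes q: "q \<ge> 1" and A: "A \<ge> 0"
  obtains D where "D \<ge> 0"
    "\<And>(x :: real ^ 'd) (f :: real ^ 'd) (g :: real ^ 'm ^ 'd) h a. 0 < h \<Longrightarrow> 0 \<le> a \<Longrightarrow> a \<le> A \<Longrightarrow>
      h * norm f \<le> (1 + norm x) * a \<Longrightarrow> h * (norm g)\<^sup>2 \<le> (1 + norm x)\<^sup>2 * a \<Longrightarrow>
      (\<integral>\<^sup>+z. ennreal ((1 + (norm (x + h *\<^sub>R f + g *v (sqrt h *\<^sub>R z)))\<^sup>2) powr q) \<partial>std_gaussian) \<le>
        ennreal ((1 + (norm x)\<^sup>2) powr q *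
          (1 + 2 * q * h / (1 + (norm x)\<^sup>2) * (x \<bullet> f + (2 * q - 1) / 2 * (norm g)\<^sup>2) + D * a\<^sup>2))"
proof -
  obtain C :: real and N :: nat where C: "C \<ge> 0" and N: "N \<ge> 2"
    and bound: "\<And>\<eta> \<beta>. \<bar>\<beta>\<bar> \<le> 1 + \<eta> \<Longrightarrow> ((1 + \<eta> + \<beta>) powr q + (1 + \<eta> - \<beta>) powr q) / 2 \<le>
      1 + q * \<eta> + q * (q - 1) / 2 * \<beta>\<^sup>2 + C * (\<eta>\<^sup>2 + \<beta> ^ 4 + \<eta> ^ (2 * N) + \<beta> ^ (2 * N))"
    by (rule symmetrized_powr_bound[OF q]) blast
  define K where "K = 4 * N"
  define B where "B = 6 + 2 * A"
  define B2 where "B2 = 16 * (1 + A)\<^sup>2"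
  define D1 where "D1 = B\<^sup>2 + B2\<^sup>2 + A ^ (2 * N - 2) * B ^ (2 * N) + A ^ (N - 2) * B2 ^ N"
  define M where "M = integral\<^sup>L (std_gaussian :: (real ^ 'm) measure) (\<lambda>z. (1 + norm z) ^ K)"
  define D where "D = 2 * q + 4 * q * (q - 1) * (4 + 2 * A) + C * D1 * M"
  have B: "B \<ge> 0" "B2 \<ge> 0" using A by (simp_all add: B_def B2_def)
  have M: "M \<ge> 0" unfolding M_def by (rule integral_nonneg_AE) auto
  have D1: "D1 \<ge> 0" unfolding D1_def using A B by (intro add_nonneg_nonneg mult_nonneg_nonneg) auto
  show ?thesis
  proof (rule that[of D])
    show "D \<ge> 0" unfolding D_def using A C D1 M q by (intro add_nonneg_nonneg mult_nonneg_nonneg) auto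
    fix x f :: "real ^ 'd" and g :: "real ^ 'm ^ 'd" and h a :: real
    assume h: "0 < h" and a: "0 \<le> a" "a \<le> A" and f: "h * norm f \<le> (1 + norm x) * a"
      and g: "h * (norm g)\<^sup>2 \<le> (1 + norm x)\<^sup>2 * a"
    define u where "u = 1 + (norm x)\<^sup>2"
    define m where "m = x + h *\<^sub>R f"
    define Z where "Z z = g *v (sqrt h *\<^sub>R z)" for z
    \<comment> \<open>The contributions of the drift and of the noise, relative to \<open>u\<close>; each is of order \<open>a\<close>, and \<open>\<Phi>\<close> is of order \<open>a\<^sup>2\<close>.\<close>
    define X where "X = h * (x \<bullet> f) / u"
    define \<Phi> where "\<Phi> = h\<^sup>2 * (norm f)\<^sup>2 / u"
    define G where "G = h * (norm g)\<^sup>2 / u"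
    have u: "u \<ge> 1" "u > 0" by (simp_all add: u_def add_pos_nonneg)
    have xu: "(1 + norm x)\<^sup>2 \<le> 2 * u"
      using zero_le_power2[of "1 - norm x"] by (simp add: u_def power2_eq_square algebra_simps)
    have \<Phi>: "\<Phi> \<ge> 0" "\<Phi> \<le> 2 * a\<^sup>2"
    proof -
      show "\<Phi> \<ge> 0" using u by (simp add: \<Phi>_def)
      have "h\<^sup>2 * (norm f)\<^sup>2 \<le> ((1 + norm x) * a)\<^sup>2"
        using power_mono[OF f, of 2] h by (simp add: power_mult_distrib)
      also have "\<dots> \<le> 2 * u * a\<^sup>2" using mult_right_mono[OF xu, of "a\<^sup>2"] by (simp add: power_mult_distrib)
      finally show "\<Phi> \<le> 2 * a\<^sup>2" using u by (simp add: \<Phi>_def field_simps)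
    qed
    have G: "G \<ge> 0" "G \<le> 2 * a"
    proof -
      show "G \<ge> 0" using u h by (simp add: G_def)
      have "h * (norm g)\<^sup>2 \<le> 2 * u * a" using order_trans[OF g mult_right_mono[OF xu a(1)]] .
      then show "G \<le> 2 * a" using u by (simp add: G_def field_simps)
    qed
    have X: "\<bar>X\<bar> \<le> 2 * a"
    proof -
      have "\<bar>h * (x \<bullet> f)\<bar> \<le> h * (norm x * norm f)"
        using Cauchy_Schwarz_ineq2[of x f] h by (simp add: abs_mult)
      also have "\<dots> = norm x * (h * norm f)" by simp
      also have "\<dots> \<le> (1 + norm x) * ((1 + norm x) * a)" by (rule mult_mono) (use f h in auto)
      also have "\<dots> \<le> 2 * u * a" using mult_right_mono[OF xu a(1)] by (simp add: power2_eq_square mult.assoc)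
      finally show ?thesis using u by (simp add: X_def abs_divide field_simps)
    qed
    have a2: "a\<^sup>2 \<le> A * a" using a by (simp add: power2_eq_square mult_right_mono)
    have m_sq: "(norm m)\<^sup>2 = (norm x)\<^sup>2 + u * (2 * X + \<Phi>)"
      using u unfolding m_def X_def \<Phi>_def power2_norm_eq_inner
      by (simp add: inner_add_left inner_add_right inner_commute field_simps power2_eq_square)
    have m_le: "(norm m)\<^sup>2 \<le> u * (1 + (4 + 2 * A) * a)"
    proof -
      have "2 * X + \<Phi> \<le> (4 + 2 * A) * a" using X \<Phi> a2 by (simp add: distrib_right)
      then have "u * (2 * X + \<Phi>) \<le> u * ((4 + 2 * A) * a)" using u by simp
      then show ?thesis unfolding m_sq by (simp add: distrib_left u_def)
    qed
    have Z_le: "(norm (Z z))\<^sup>2 \<le> 2 * u * a * (1 + norm z)\<^sup>2" for z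
    proof -
      have "(norm (Z z))\<^sup>2 \<le> (norm g * norm (sqrt h *\<^sub>R z))\<^sup>2"
        unfolding Z_def by (intro power_mono norm_matrix_vector_le) simp
      also have "\<dots> = h * (norm g)\<^sup>2 * (norm z)\<^sup>2" using h by (simp add: power_mult_distrib)
      also have "\<dots> \<le> (2 * u * a) * (1 + norm z)\<^sup>2"
        using order_trans[OF g mult_right_mono[OF xu a(1)]] u a h by (intro mult_mono[of "h * (norm g)\<^sup>2"] power_mono) auto
      finally show ?thesis .
    qed
    define \<eta> where "\<eta> z = 2 * X + \<Phi> + (norm (Z z))\<^sup>2 / u" for z
    define \<beta> where "\<beta> z = 2 * (m \<bullet> Z z) / u" for z
    have plus: "1 + (norm (m + Z z))\<^sup>2 = u * (1 + \<eta> z + \<beta> z)" for z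
    proof -
      have "(norm (m + Z z))\<^sup>2 = (norm m)\<^sup>2 + 2 * (m \<bullet> Z z) + (norm (Z z))\<^sup>2"
        unfolding power2_norm_eq_inner by (simp add: inner_add_left inner_add_right inner_commute)
      then show ?thesis using u unfolding m_sq \<eta>_def \<beta>_def by (simp add: distrib_left u_def[symmetric])
    qed
    have minus: "1 + (norm (m - Z z))\<^sup>2 = u * (1 + \<eta> z - \<beta> z)" for z
    proof -
      have "(norm (m - Z z))\<^sup>2 = (norm m)\<^sup>2 - 2 * (m \<bullet> Z z) + (norm (Z z))\<^sup>2"
        unfolding power2_norm_eq_inner by (simp add: inner_diff_left inner_diff_right inner_commute)
      then show ?thesis using u unfolding m_sq \<eta>_def \<beta>_def
        by (simp add: distrib_left right_diff_distrib u_def[symmetric])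
    qed
    have pos: "0 \<le> 1 + \<eta> z + \<beta> z" "0 \<le> 1 + \<eta> z - \<beta> z" for z
    proof -
      have "0 \<le> u * (1 + \<eta> z + \<beta> z)" "0 \<le> u * (1 + \<eta> z - \<beta> z)"
        unfolding plus[symmetric] minus[symmetric] by simp_all
      then show "0 \<le> 1 + \<eta> z + \<beta> z" "0 \<le> 1 + \<eta> z - \<beta> z" using u by (simp_all add: zero_le_mult_iff)
    qed
    have err: "(\<eta> z)\<^sup>2 + \<beta> z ^ 4 + \<eta> z ^ (2 * N) + \<beta> z ^ (2 * N) \<le> D1 * a\<^sup>2 * (1 + norm z) ^ K" for z
    proof -
      define r where "r = 1 + norm z"
      have r: "r \<ge> 1" by (simp add: r_def)
      have r2: "r\<^sup>2 \<ge> 1" using r by (simp add: one_le_power)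
      have "\<bar>\<eta> z\<bar> \<le> a * B * r\<^sup>2"
      proof -
        have "(norm (Z z))\<^sup>2 / u \<le> 2 * a * r\<^sup>2" using Z_le[of z] u by (simp add: r_def field_simps)
        then have "\<bar>\<eta> z\<bar> \<le> 4 * a + 2 * (A * a) + 2 * a * r\<^sup>2"
          using X[unfolded abs_le_iff] \<Phi> a2 divide_nonneg_pos[OF zero_le_power2 u(2), of "norm (Z z)"]
          unfolding \<eta>_def abs_le_iff by linarith
        also have "4 * a + 2 * (A * a) \<le> (4 * a + 2 * (A * a)) * r\<^sup>2"
          using mult_left_mono[OF r2, of "4 * a + 2 * (A * a)"] a A by simp
        finally show ?thesis by (simp add: B_def algebra_simps)
      qed
      then have eta2: "(\<eta> z)\<^sup>2 \<le> (a * B * r\<^sup>2)\<^sup>2" by (metis abs_ge_zero power2_abs power_mono)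
      have "(\<beta> z)\<^sup>2 \<le> a * B2 * r\<^sup>2"
      proof -
        have "norm m \<le> (1 + norm x) * (1 + A)"
        proof -
          have "norm m \<le> norm x + h * norm f" unfolding m_def using h norm_triangle_ineq[of x "h *\<^sub>R f"] by simp
          also have "\<dots> \<le> (1 + norm x) + (1 + norm x) * A"
            using f mult_left_mono[OF a(2), of "1 + norm x"] by simp
          finally show ?thesis by (simp add: distrib_left)
        qed
        then have "(norm m)\<^sup>2 \<le> ((1 + norm x) * (1 + A))\<^sup>2" by (intro power_mono) auto
        also have "\<dots> \<le> 2 * u * (1 + A)\<^sup>2"
          using mult_right_mono[OF xu, of "(1 + A)\<^sup>2"] by (simp add: power_mult_distrib)
        finally have m2: "(norm m)\<^sup>2 \<le> 2 * u * (1 + A)\<^sup>2" .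
        have "(m \<bullet> Z z)\<^sup>2 \<le> (norm m)\<^sup>2 * (norm (Z z))\<^sup>2"
          using power_mono[OF Cauchy_Schwarz_ineq2[of m "Z z"], of 2] by (simp add: power_mult_distrib)
        also have "\<dots> \<le> (2 * u * (1 + A)\<^sup>2) * (2 * u * a * r\<^sup>2)"
          using m2 Z_le[of z] u unfolding r_def by (intro mult_mono) auto
        finally have "(m \<bullet> Z z)\<^sup>2 \<le> (2 * u * (1 + A)\<^sup>2) * (2 * u * a * r\<^sup>2)" .
        moreover have "4 * ((2 * u * (1 + A)\<^sup>2) * (2 * u * a * r\<^sup>2)) = u\<^sup>2 * (a * B2 * r\<^sup>2)"
          by (simp add: B2_def power2_eq_square)
        ultimately have "4 * (m \<bullet> Z z)\<^sup>2 \<le> u\<^sup>2 * (a * B2 * r\<^sup>2)" by linarith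
        then have "4 * (m \<bullet> Z z)\<^sup>2 / u\<^sup>2 \<le> a * B2 * r\<^sup>2" using u by (simp add: divide_le_eq ac_simps)
        then show ?thesis by (simp add: \<beta>_def power_divide power_mult_distrib)
      qed
      note beta2 = this
      have pK: "r ^ k \<le> r ^ K" if "k \<le> K" for k using r that by (rule power_increasing[rotated])
      have aB: "0 \<le> a * B" "0 \<le> a * B2" using a B by auto
      have 1: "(\<eta> z)\<^sup>2 \<le> B\<^sup>2 * a\<^sup>2 * r ^ K"
      proof -
        have "(a * B * r\<^sup>2)\<^sup>2 = B\<^sup>2 * a\<^sup>2 * r ^ 4" by (simp add: power_mult_distrib power_mult[symmetric])
        also have "\<dots> \<le> B\<^sup>2 * a\<^sup>2 * r ^ K" using N by (intro mult_left_mono pK) (auto simp: K_def)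
        finally show ?thesis using eta2 by simp
      qed
      have 2: "\<beta> z ^ 4 \<le> B2\<^sup>2 * a\<^sup>2 * r ^ K"
      proof -
        have "\<beta> z ^ 4 = ((\<beta> z)\<^sup>2)\<^sup>2" by (simp add: power_mult[symmetric])
        also have "\<dots> \<le> (a * B2 * r\<^sup>2)\<^sup>2" using beta2 by (rule power_mono) simp
        also have "\<dots> = B2\<^sup>2 * a\<^sup>2 * r ^ 4" by (simp add: power_mult_distrib power_mult[symmetric])
        also have "\<dots> \<le> B2\<^sup>2 * a\<^sup>2 * r ^ K" using N by (intro mult_left_mono pK) (auto simp: K_def)
        finally show ?thesis .
      qed
      have apow: "a ^ k \<le> A ^ (k - 2) * a\<^sup>2" if "k \<ge> 2" for k
      proof -
        have "a ^ k = a ^ (k - 2) * a\<^sup>2" using power_add[of a "k - 2" 2] that by (simp only: le_add_diff_inverse2)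
        also have "\<dots> \<le> A ^ (k - 2) * a\<^sup>2" using a by (intro mult_right_mono power_mono) auto
        finally show ?thesis .
      qed
      have 3: "\<eta> z ^ (2 * N) \<le> A ^ (2 * N - 2) * B ^ (2 * N) * a\<^sup>2 * r ^ K"
      proof -
        have "\<eta> z ^ (2 * N) = ((\<eta> z)\<^sup>2) ^ N" by (simp add: power_mult)
        also have "\<dots> \<le> ((a * B * r\<^sup>2)\<^sup>2) ^ N" using eta2 by (rule power_mono) simp
        also have "\<dots> = a ^ (2 * N) * (B ^ (2 * N) * r ^ K)"
          by (simp add: power_mult_distrib power_mult[symmetric] K_def ac_simps)
        also have "\<dots> \<le> (A ^ (2 * N - 2) * a\<^sup>2) * (B ^ (2 * N) * r ^ K)"
          using N B r by (intro mult_right_mono apow mult_nonneg_nonneg) auto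
        finally show ?thesis by (simp add: ac_simps)
      qed
      have 4: "\<beta> z ^ (2 * N) \<le> A ^ (N - 2) * B2 ^ N * a\<^sup>2 * r ^ K"
      proof -
        have "\<beta> z ^ (2 * N) = ((\<beta> z)\<^sup>2) ^ N" by (simp add: power_mult)
        also have "\<dots> \<le> (a * B2 * r\<^sup>2) ^ N" using beta2 by (rule power_mono) simp
        also have "\<dots> = a ^ N * (B2 ^ N * r ^ (2 * N))" by (simp add: power_mult_distrib power_mult[symmetric])
        also have "\<dots> \<le> (A ^ (N - 2) * a\<^sup>2) * (B2 ^ N * r ^ K)"
          using N B r A a by (intro mult_mono apow mult_nonneg_nonneg pK) (auto simp: K_def)
        finally show ?thesis by (simp add: ac_simps)
      qed
      show ?thesis using 1 2 3 4 unfolding D1_def r_def[symmetric] by (simp add: distrib_right)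
    qed
    define H where "H z = u powr q * (1 + q * (2 * X + \<Phi>) + q / u * (norm (Z z))\<^sup>2
        + 2 * q * (q - 1) / u\<^sup>2 * (m \<bullet> Z z)\<^sup>2 + C * D1 * a\<^sup>2 * (1 + norm z) ^ K)" for z
    have sym: "((1 + (norm (m + Z z))\<^sup>2) powr q + (1 + (norm (m - Z z))\<^sup>2) powr q) / 2 \<le> H z" for z
    proof -
      have "((1 + (norm (m + Z z))\<^sup>2) powr q + (1 + (norm (m - Z z))\<^sup>2) powr q) / 2 =
          u powr q * (((1 + \<eta> z + \<beta> z) powr q + (1 + \<eta> z - \<beta> z) powr q) / 2)"
      proof -
        have "(u * (1 + \<eta> z + \<beta> z)) powr q = u powr q * (1 + \<eta> z + \<beta> z) powr q"
          "(u * (1 + \<eta> z - \<beta> z)) powr q = u powr q * (1 + \<eta> z - \<beta> z) powr q"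
          using u pos[of z] by (auto intro!: powr_mult)
        then show ?thesis unfolding plus minus by (simp only: distrib_left[symmetric] times_divide_eq_right)
      qed
      also have "\<dots> \<le> u powr q * (1 + q * \<eta> z + q * (q - 1) / 2 * (\<beta> z)\<^sup>2
          + C * ((\<eta> z)\<^sup>2 + \<beta> z ^ 4 + \<eta> z ^ (2 * N) + \<beta> z ^ (2 * N)))"
        using pos[of z] by (intro mult_left_mono bound) auto
      also have "\<dots> \<le> u powr q * (1 + q * \<eta> z + q * (q - 1) / 2 * (\<beta> z)\<^sup>2 + C * (D1 * a\<^sup>2 * (1 + norm z) ^ K))"
        using C err[of z] by (intro mult_left_mono add_left_mono) auto
      also have "\<dots> = H z"
      proof -
        have "q * (q - 1) / 2 * (\<beta> z)\<^sup>2 = 2 * q * (q - 1) / u\<^sup>2 * (m \<bullet> Z z)\<^sup>2"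
          by (simp add: \<beta>_def power_divide power_mult_distrib)
        moreover have "q * \<eta> z = q * (2 * X + \<Phi>) + q / u * (norm (Z z))\<^sup>2"
          by (simp add: \<eta>_def distrib_left)
        ultimately show ?thesis by (simp only: H_def add.assoc mult.assoc)
      qed
      finally show ?thesis .
    qed
    have int_m: "integrable std_gaussian (\<lambda>z. (m \<bullet> Z z)\<^sup>2)"
      "integral\<^sup>L std_gaussian (\<lambda>z. (m \<bullet> Z z)\<^sup>2) \<le> h * (norm g)\<^sup>2 * (norm m)\<^sup>2"
    proof -
      have eq: "m \<bullet> Z z = (sqrt h *\<^sub>R (transpose g *v m)) \<bullet> z" for z
        unfolding Z_def by (simp add: matrix_vector_mult_scaleR dot_lmul_matrix[symmetric] transpose_matrix_vector)
      show "integrable std_gaussian (\<lambda>z. (m \<bullet> Z z)\<^sup>2)"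
        unfolding eq by (rule std_gaussian_linear_square)
      have "integral\<^sup>L std_gaussian (\<lambda>z. (m \<bullet> Z z)\<^sup>2) \<le> (norm (sqrt h *\<^sub>R (transpose g *v m)))\<^sup>2"
        unfolding eq by (rule std_gaussian_linear_square)
      also have "\<dots> = h * (norm (transpose g *v m))\<^sup>2" using h by (simp add: power_mult_distrib)
      also have "\<dots> \<le> h * (norm g * norm m)\<^sup>2"
        using h norm_matrix_vector_le[of "transpose g" m] norm_transpose_matrix[of g]
        by (intro mult_left_mono power_mono) auto
      finally show "integral\<^sup>L std_gaussian (\<lambda>z. (m \<bullet> Z z)\<^sup>2) \<le> h * (norm g)\<^sup>2 * (norm m)\<^sup>2"
        by (simp add: power_mult_distrib)
    qed
    have int_Z: "integrable std_gaussian (\<lambda>z. (norm (Z z))\<^sup>2)"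
      "integral\<^sup>L std_gaussian (\<lambda>z. (norm (Z z))\<^sup>2) \<le> h * (norm g)\<^sup>2"
    proof -
      have eq: "(norm (Z z))\<^sup>2 = (\<Sum>i\<in>UNIV. ((sqrt h *\<^sub>R g $ i) \<bullet> z)\<^sup>2)" for z
        unfolding Z_def norm_matrix_vector_sq by simp
      show "integrable std_gaussian (\<lambda>z. (norm (Z z))\<^sup>2)"
        unfolding eq by (intro Bochner_Integration.integrable_sum std_gaussian_linear_square)
      have "integral\<^sup>L std_gaussian (\<lambda>z. (norm (Z z))\<^sup>2) =
          (\<Sum>i\<in>UNIV. integral\<^sup>L std_gaussian (\<lambda>z. ((sqrt h *\<^sub>R g $ i) \<bullet> z)\<^sup>2))"
        unfolding eq by (intro Bochner_Integration.integral_sum std_gaussian_linear_square)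
      also have "\<dots> \<le> (\<Sum>i\<in>UNIV. (norm (sqrt h *\<^sub>R g $ i))\<^sup>2)"
        by (intro sum_mono std_gaussian_linear_square)
      also have "\<dots> = h * (norm g)\<^sup>2"
        using h by (simp add: norm_matrix_sq power_mult_distrib sum_distrib_left)
      finally show "integral\<^sup>L std_gaussian (\<lambda>z. (norm (Z z))\<^sup>2) \<le> h * (norm g)\<^sup>2" .
    qed
    note ints = integrable_mult_right[OF int_Z(1), of "q / u"] integrable_mult_right[OF int_m(1), of "2 * q * (q - 1) / u\<^sup>2"]
      integrable_mult_right[OF std_gaussian_integrable_power[of K], of "C * D1 * a\<^sup>2"]
      std_gaussian.integrable_const[of "1 + q * (2 * X + \<Phi>)"]
    have int_H: "integrable std_gaussian H"
      unfolding H_def by (intro integrable_mult_right Bochner_Integration.integrable_add ints)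
    have E_H: "integral\<^sup>L std_gaussian H = u powr q * (1 + q * (2 * X + \<Phi>)
        + q / u * integral\<^sup>L std_gaussian (\<lambda>z. (norm (Z z))\<^sup>2)
        + 2 * q * (q - 1) / u\<^sup>2 * integral\<^sup>L std_gaussian (\<lambda>z. (m \<bullet> Z z)\<^sup>2) + C * D1 * a\<^sup>2 * M)"
      unfolding H_def M_def integral_mult_right_zero
      by (simp only: Bochner_Integration.integral_add Bochner_Integration.integrable_add ints
          integral_mult_right_zero lebesgue_integral_const std_gaussian.prob_space scaleR_one)
    have E_le: "integral\<^sup>L std_gaussian H \<le> u powr q * (1 + 2 * q * h / u * (x \<bullet> f + (2 * q - 1) / 2 * (norm g)\<^sup>2) + D * a\<^sup>2)"
    proof -
      have t1: "q / u * integral\<^sup>L std_gaussian (\<lambda>z. (norm (Z z))\<^sup>2) \<le> q * G"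
        using mult_left_mono[OF int_Z(2), of "q / u"] u q by (simp add: G_def)
      have t2: "2 * q * (q - 1) / u\<^sup>2 * integral\<^sup>L std_gaussian (\<lambda>z. (m \<bullet> Z z)\<^sup>2) \<le> 2 * q * (q - 1) * G + 4 * q * (q - 1) * (4 + 2 * A) * a\<^sup>2"
      proof -
        have "2 * q * (q - 1) / u\<^sup>2 * integral\<^sup>L std_gaussian (\<lambda>z. (m \<bullet> Z z)\<^sup>2) \<le>
            2 * q * (q - 1) / u\<^sup>2 * (h * (norm g)\<^sup>2 * (norm m)\<^sup>2)"
          using int_m(2) q by (intro mult_left_mono) auto
        also have "\<dots> = 2 * q * (q - 1) * (G * ((norm m)\<^sup>2 / u))"
          by (simp add: G_def power2_eq_square)
        also have "\<dots> \<le> 2 * q * (q - 1) * (G * (1 + (4 + 2 * A) * a))"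
          using m_le u G q by (intro mult_left_mono) (auto simp: divide_le_eq ac_simps)
        also have "\<dots> \<le> 2 * q * (q - 1) * (G + (4 + 2 * A) * (2 * a\<^sup>2))"
        proof (rule mult_left_mono)
          have "G * ((4 + 2 * A) * a) \<le> 2 * a * ((4 + 2 * A) * a)"
            using G a A by (intro mult_right_mono) auto
          then show "G * (1 + (4 + 2 * A) * a) \<le> G + (4 + 2 * A) * (2 * a\<^sup>2)"
            by (simp add: distrib_left power2_eq_square ac_simps)
        qed (use q in simp)
        also have "\<dots> = 2 * q * (q - 1) * G + 4 * q * (q - 1) * (4 + 2 * A) * a\<^sup>2"
          by (simp add: distrib_left)
        finally show ?thesis .
      qed
      have t3: "q * \<Phi> \<le> 2 * q * a\<^sup>2" using mult_left_mono[OF \<Phi>(2), of q] q by simp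
      have "2 * q * h / u * (x \<bullet> f + (2 * q - 1) / 2 * (norm g)\<^sup>2) = 2 * q * X + q * G + 2 * q * (q - 1) * G"
        unfolding X_def G_def using u by (simp add: field_simps)
      then show ?thesis
        unfolding E_H using t1 t2 t3 by (intro mult_left_mono) (auto simp: D_def algebra_simps)
    qed
    define V where "V y = (1 + (norm (y :: real ^ 'd))\<^sup>2) powr q" for y
    have Zm[measurable]: "Z \<in> borel_measurable borel" unfolding Z_def
      by (intro borel_measurable_continuous_onI continuous_intros linear_continuous_on
          linear_conv_bounded_linear[THEN iffD1] linear_compose[unfolded o_def, OF _ matrix_vector_mul_linear])
        (auto simp: linear_iff algebra_simps)
    have Vm[measurable]: "V \<in> borel_measurable borel" unfolding V_def by measurable
    define I where "I = (\<integral>\<^sup>+z. ennreal (V (m + Z z)) \<partial>std_gaussian)"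
    have "Z (- z) = - Z z" for z by (simp add: Z_def linear_neg[OF matrix_vector_mul_linear])
    then have I2: "(\<integral>\<^sup>+z. ennreal (V (m - Z z)) \<partial>std_gaussian) = I"
      unfolding I_def using std_gaussian_symmetric[of "\<lambda>z. ennreal (V (m + Z z))"] by simp
    have "I + I = (\<integral>\<^sup>+z. ennreal (V (m + Z z)) + ennreal (V (m - Z z)) \<partial>std_gaussian)"
      using I2 by (subst nn_integral_add) (auto simp: I_def)
    also have "\<dots> \<le> (\<integral>\<^sup>+z. ennreal (2 * H z) \<partial>std_gaussian)"
    proof (rule nn_integral_mono)
      show "ennreal (V (m + Z z)) + ennreal (V (m - Z z)) \<le> ennreal (2 * H z)" for z
        using sym[of z] by (simp add: V_def ennreal_plus[symmetric] ennreal_leI del: ennreal_plus)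
    qed
    also have "\<dots> = ennreal (2 * integral\<^sup>L std_gaussian H)"
    proof (subst nn_integral_eq_integral)
      have "0 \<le> H z" for z
        by (rule order_trans[OF _ sym]) simp
      then show "AE z in std_gaussian. 0 \<le> 2 * H z" by simp
    qed (use int_H in auto)
    finally have II: "I + I \<le> ennreal (2 * integral\<^sup>L std_gaussian H)" .
    then have "I \<noteq> \<top>" by (auto simp: top_unique)
    then obtain i where i: "I = ennreal i" "i \<ge> 0" by (cases I) auto
    have "0 \<le> H z" for z
      by (rule order_trans[OF _ sym]) simp
    then have "integral\<^sup>L std_gaussian H \<ge> 0" by (intro integral_nonneg_AE) auto
    then have "i \<le> integral\<^sup>L std_gaussian H"
      using II i by (simp add: ennreal_plus[symmetric] del: ennreal_plus)
    then have "I \<le> ennreal (integral\<^sup>L std_gaussian H)" using i by (simp add: ennreal_leI)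
    also have "\<dots> \<le> ennreal (u powr q * (1 + 2 * q * h / u * (x \<bullet> f + (2 * q - 1) / 2 * (norm g)\<^sup>2) + D * a\<^sup>2))"
      using E_le by (rule ennreal_leI)
    finally show "(\<integral>\<^sup>+z. ennreal ((1 + (norm (x + h *\<^sub>R f + g *v (sqrt h *\<^sub>R z)))\<^sup>2) powr q) \<partial>std_gaussian) \<le>
        ennreal ((1 + (norm x)\<^sup>2) powr q *
          (1 + 2 * q * h / (1 + (norm x)\<^sup>2) * (x \<bullet> f + (2 * q - 1) / 2 * (norm g)\<^sup>2) + D * a\<^sup>2))"
      unfolding I_def V_def m_def Z_def u_def .
  qed
qed

section \<open>Increments of Brownian motion after a stopping time\<close>

text \<open>The approximation is strictly above \<open>s\<close>: it is never 0, and if \<open>s\<close> is a stopping time then the event that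
the approximation equals a given dyadic number belongs to the past of that number.\<close>

definition dyadic_above :: "nat \<Rightarrow> real \<Rightarrow> real" where
  "dyadic_above k s = real (nat \<lfloor>2 ^ k * s\<rfloor> + 1) / 2 ^ k"

lemma dyadic_above_bounds:
  assumes "0 \<le> s"
  shows "s < dyadic_above k s" "dyadic_above k s \<le> s + 1 / 2 ^ k"
proof -
  have f: "real (nat \<lfloor>2 ^ k * s\<rfloor>) = of_int \<lfloor>2 ^ k * s\<rfloor>" using assms by (intro of_nat_nat) auto
  have "2 ^ k * s < real (nat \<lfloor>2 ^ k * s\<rfloor>) + 1" "real (nat \<lfloor>2 ^ k * s\<rfloor>) \<le> 2 ^ k * s"
    unfolding f by linarith+
  then show "s < dyadic_above k s" "dyadic_above k s \<le> s + 1 / 2 ^ k"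
    unfolding dyadic_above_def by (simp_all add: field_simps)
qed

lemma dyadic_above_pos: "0 < dyadic_above k s"
  by (simp add: dyadic_above_def add_nonneg_pos)

lemma dyadic_above_tendsto:
  assumes "0 \<le> s"
  shows "(\<lambda>k. dyadic_above k s) \<longlonglongrightarrow> s"
proof (rule tendsto_sandwich[where f="\<lambda>_. s" and h="\<lambda>k. s + 1 / 2 ^ k"])
  have "(\<lambda>k. s + (1 / 2) ^ k) \<longlonglongrightarrow> s + 0"
    by (intro tendsto_add tendsto_const LIMSEQ_realpow_zero) auto
  then show "(\<lambda>k. s + 1 / 2 ^ k) \<longlonglongrightarrow> s" by (simp add: power_one_over)
qed (use dyadic_above_bounds[OF assms] in \<open>auto simp: less_imp_le\<close>)

text \<open>A random time with countably many values is harmless; path continuity covers the limit. The cap at \<open>t\<close>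
keeps the approximating times within the period in which \<open>X\<close> is measurable with respect to \<open>N\<close>.\<close>

lemma measurable_at_random_time:
  fixes X :: "real \<Rightarrow> 'w \<Rightarrow> 'b::metric_space"
  assumes X: "\<And>s. 0 \<le> s \<Longrightarrow> s \<le> t \<Longrightarrow> X s \<in> N \<rightarrow>\<^sub>M borel"
    and cont: "\<And>\<omega>. \<omega> \<in> space N \<Longrightarrow> continuous_on {0..} (\<lambda>s. X s \<omega>)"
    and S: "S \<in> N \<rightarrow>\<^sub>M borel" "\<And>\<omega>. \<omega> \<in> space N \<Longrightarrow> 0 \<le> S \<omega> \<and> S \<omega> \<le> t" and t: "0 \<le> t"
  shows "(\<lambda>\<omega>. X (S \<omega>) \<omega>) \<in> N \<rightarrow>\<^sub>M borel"
proof (rule borel_measurable_LIMSEQ_metric)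
  fix k
  show "(\<lambda>\<omega>. X (min t (dyadic_above k (S \<omega>))) \<omega>) \<in> N \<rightarrow>\<^sub>M borel"
    unfolding dyadic_above_def
  proof (rule measurable_compose_countable[where f="\<lambda>i. X (min t (real (i + 1) / 2 ^ k))"])
    show "X (min t (real (i + 1) / 2 ^ k)) \<in> N \<rightarrow>\<^sub>M borel" for i using t by (intro X) auto
    show "(\<lambda>\<omega>. nat \<lfloor>2 ^ k * S \<omega>\<rfloor>) \<in> N \<rightarrow>\<^sub>M count_space UNIV" using S(1) by measurable
  qed
next
  fix \<omega> assume \<omega>: "\<omega> \<in> space N"
  have "(\<lambda>k. min t (dyadic_above k (S \<omega>))) \<longlonglongrightarrow> min t (S \<omega>)"
    using S(2)[OF \<omega>] by (intro tendsto_min tendsto_const dyadic_above_tendsto) auto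
  then have "(\<lambda>k. min t (dyadic_above k (S \<omega>))) \<longlonglongrightarrow> S \<omega>" using S(2)[OF \<omega>] by (simp add: min_absorb2)
  then show "(\<lambda>k. X (min t (dyadic_above k (S \<omega>))) \<omega>) \<longlonglongrightarrow> X (S \<omega>) \<omega>"
    using S(2)[OF \<omega>] t dyadic_above_pos[of _ "S \<omega>"]
    by (intro continuous_on_tendsto_compose[OF cont[OF \<omega>]]) (auto simp: less_imp_le)
qed

lemma nn_integral_partition:
  fixes F :: "'w \<Rightarrow> ennreal" and \<kappa> :: "'w \<Rightarrow> nat"
  assumes "\<And>n. (\<lambda>\<omega>. F \<omega> * indicator {n} (\<kappa> \<omega>)) \<in> borel_measurable M"
  shows "(\<integral>\<^sup>+\<omega>. F \<omega> \<partial>M) = (\<Sum>n. \<integral>\<^sup>+\<omega>. F \<omega> * indicator {n} (\<kappa> \<omega>) \<partial>M)"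
    and "F \<in> borel_measurable M"
proof -
  have "(\<Sum>n. F \<omega> * indicator {n} (\<kappa> \<omega>)) = F \<omega>" for \<omega>
    by (subst suminf_finite[of "{\<kappa> \<omega>}"]) (auto simp: indicator_def)
  then have eq: "F = (\<lambda>\<omega>. \<Sum>n. F \<omega> * indicator {n} (\<kappa> \<omega>))" by simp
  show "(\<integral>\<^sup>+\<omega>. F \<omega> \<partial>M) = (\<Sum>n. \<integral>\<^sup>+\<omega>. F \<omega> * indicator {n} (\<kappa> \<omega>) \<partial>M)"
    by (subst eq) (rule nn_integral_suminf[OF assms])
  show "F \<in> borel_measurable M"
    by (subst eq) (intro borel_measurable_suminf_order assms)
qed

context brownian_motion
begin

lemma space_F: "0 \<le> t \<Longrightarrow> space (F t) = space M"
  using subalg by (simp add: subalgebra_def)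

lemma sets_F: "0 \<le> t \<Longrightarrow> sets (F t) \<subseteq> sets M"
  using subalg by (simp add: subalgebra_def)

lemma null_sets_F: "0 \<le> t \<Longrightarrow> N \<in> null_sets M \<Longrightarrow> N \<in> sets (F t)"
  using null_sets_init filtration_mono[of 0 t] by auto

lemma measurable_F_M: "0 \<le> t \<Longrightarrow> X \<in> F t \<rightarrow>\<^sub>M N \<Longrightarrow> X \<in> M \<rightarrow>\<^sub>M N"
  by (rule measurable_from_subalg[OF subalg])

lemma measurable_F_mono: "0 \<le> s \<Longrightarrow> s \<le> t \<Longrightarrow> X \<in> F s \<rightarrow>\<^sub>M N \<Longrightarrow> X \<in> F t \<rightarrow>\<^sub>M N"
  using filtration_mono[of s t] space_F[of s] space_F[of t] by (auto simp: measurable_def)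

text \<open>On the exceptional null set the paths are replaced by 0. Null sets belong to \<open>F 0\<close>, so adaptedness survives.\<close>

lemma continuous_version:
  obtains V N where "N \<in> null_sets M" "\<And>t \<omega>. \<omega> \<notin> N \<Longrightarrow> V t \<omega> = W t \<omega>"
    "\<And>t. 0 \<le> t \<Longrightarrow> V t \<in> F t \<rightarrow>\<^sub>M borel"
    "\<And>\<omega>. \<omega> \<in> space M \<Longrightarrow> continuous_on {0..} (\<lambda>t. V t \<omega>)"
proof -
  obtain N where N: "{\<omega>\<in>space M. \<not> continuous_on {0..} (\<lambda>t. W t \<omega>)} \<subseteq> N" "N \<in> null_sets M"
    using continuous_paths by (auto simp: eventually_ae_filter)
  define V where "V t \<omega> = (if \<omega> \<in> N then 0 else W t \<omega>)" for t \<omega>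
  show ?thesis
  proof (rule that[of N V])
    show "V t \<in> F t \<rightarrow>\<^sub>M borel" if "0 \<le> t" for t
      unfolding V_def using null_sets_F[OF that N(2)] adapted[OF that]
      by (intro measurable_If_set) (auto intro: sets.Int)
    show "continuous_on {0..} (\<lambda>t. V t \<omega>)" if "\<omega> \<in> space M" for \<omega>
      using N(1) that by (cases "\<omega> \<in> N") (auto simp: V_def)
  qed (use N in \<open>auto simp: V_def\<close>)
qed

text \<open>The past, seen through \<open>X\<close>, and the increment are independent, so their joint law is a product.\<close>

lemma nn_integral_increment:
  assumes st: "0 \<le> s" "0 < d" and X: "X \<in> F s \<rightarrow>\<^sub>M S" and h: "h \<in> borel_measurable (S \<Otimes>\<^sub>M borel)"
  shows "(\<integral>\<^sup>+\<omega>. h (X \<omega>, W (s + d) \<omega> - W s \<omega>) \<partial>M) =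
    (\<integral>\<^sup>+\<omega>. \<integral>\<^sup>+z. h (X \<omega>, sqrt d *\<^sub>R z) \<partial>std_gaussian \<partial>M)"
proof -
  define I where "I \<omega> = W (s + d) \<omega> - W s \<omega>" for \<omega>
  have dist: "distributed M lborel I (\<lambda>x. ennreal (gaussian_density (sqrt d) x))"
    using normal_increments[of s "s + d"] st unfolding I_def gaussian_density_vec by simp
  then have Im: "I \<in> M \<rightarrow>\<^sub>M borel" by (auto dest: distributed_measurable)
  have distI: "distr M borel I = distr std_gaussian borel (\<lambda>z. sqrt d *\<^sub>R z)"
    using distributed_distr_eq_density[OF dist] st
    by (subst distr_std_gaussian_scale) (auto cong: distr_cong)
  have XM: "X \<in> M \<rightarrow>\<^sub>M S" using measurable_F_M[OF st(1) X] .
  interpret DI: prob_space "distr M borel I" by (rule prob_space_distr) (rule Im)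
  interpret DX: prob_space "distr M S X" by (rule prob_space_distr) (rule XM)
  have indep: "indep_set (sets (F s)) (sets (vimage_algebra (space M) I borel))"
    using indep_increments[of s "s + d"] st by (simp add: I_def[abs_def])
  have pair: "distr M S X \<Otimes>\<^sub>M distr M borel I = distr M (S \<Otimes>\<^sub>M borel) (\<lambda>\<omega>. (X \<omega>, I \<omega>))"
  proof (rule pair_measure_eqI[OF DX.sigma_finite_measure_axioms DI.sigma_finite_measure_axioms])
    fix A B assume "A \<in> sets (distr M S X)" "B \<in> sets (distr M borel I)"
    then have AB: "A \<in> sets S" "B \<in> sets borel" by auto
    have XA: "X -` A \<inter> space M \<in> sets (F s)" using measurable_sets[OF X AB(1)] space_F[OF st(1)] by simp
    have IB: "I -` B \<inter> space M \<in> sets (vimage_algebra (space M) I borel)"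
      using AB(2) by (auto simp: sets_vimage_algebra)
    have "emeasure (distr M S X) A * emeasure (distr M borel I) B = ennreal (prob (X -` A \<inter> space M) * prob (I -` B \<inter> space M))"
      using AB XM Im by (simp add: emeasure_distr emeasure_eq_measure ennreal_mult)
    also have "\<dots> = ennreal (prob ((X -` A \<inter> space M) \<inter> (I -` B \<inter> space M)))"
      by (simp only: indep_setD[OF indep XA IB])
    also have "(X -` A \<inter> space M) \<inter> (I -` B \<inter> space M) = (\<lambda>\<omega>. (X \<omega>, I \<omega>)) -` (A \<times> B) \<inter> space M" by auto
    also have "ennreal (prob \<dots>) = emeasure (distr M (S \<Otimes>\<^sub>M borel) (\<lambda>\<omega>. (X \<omega>, I \<omega>))) (A \<times> B)"
      using AB XM Im by (subst emeasure_distr) (auto simp: emeasure_eq_measure)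
    finally show "emeasure (distr M S X) A * emeasure (distr M borel I) B =
      emeasure (distr M (S \<Otimes>\<^sub>M borel) (\<lambda>\<omega>. (X \<omega>, I \<omega>))) (A \<times> B)" .
  qed (simp cong: sets_pair_measure_cong)
  have hx: "(\<lambda>z. h (x, z)) \<in> borel_measurable borel" if "x \<in> space S" for x
    using that h by (auto intro: measurable_compose[OF measurable_Pair1' h])
  have "(\<integral>\<^sup>+\<omega>. h (X \<omega>, I \<omega>) \<partial>M) = (\<integral>\<^sup>+p. h p \<partial>distr M (S \<Otimes>\<^sub>M borel) (\<lambda>\<omega>. (X \<omega>, I \<omega>)))"
    using XM Im h by (subst nn_integral_distr) auto
  also have "\<dots> = (\<integral>\<^sup>+x. \<integral>\<^sup>+z. h (x, z) \<partial>distr M borel I \<partial>distr M S X)"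
    unfolding pair[symmetric] using h by (subst DI.nn_integral_fst) (auto cong: measurable_cong_sets sets_pair_measure_cong)
  also have "\<dots> = (\<integral>\<^sup>+\<omega>. \<integral>\<^sup>+z. h (X \<omega>, z) \<partial>distr M borel I \<partial>M)"
  proof (rule nn_integral_distr[OF XM])
    have "h \<in> borel_measurable (S \<Otimes>\<^sub>M distr M borel I)" using h by (simp cong: measurable_cong_sets sets_pair_measure_cong)
    then show "(\<lambda>x. \<integral>\<^sup>+z. h (x, z) \<partial>distr M borel I) \<in> borel_measurable (distr M S X)"
      using DI.borel_measurable_nn_integral_fst[of h S] by simp
  qed
  also have "\<dots> = (\<integral>\<^sup>+\<omega>. \<integral>\<^sup>+z. h (X \<omega>, sqrt d *\<^sub>R z) \<partial>std_gaussian \<partial>M)"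
    unfolding distI
    by (intro nn_integral_cong nn_integral_distr) (auto intro: hx measurable_space[OF XM])
  finally show ?thesis by (simp add: I_def)
qed

text \<open>Here \<open>T\<close> is a stopping time, \<open>D\<close> and \<open>Y\<close> are known at time \<open>T\<close>, and \<open>A\<close> is an event known at time \<open>T\<close>.
To avoid the sigma-algebra of the past of \<open>T\<close>, this is expressed by measurability on the events \<open>T \<le> t\<close>.
After rounding \<open>T\<close> and \<open>D\<close> up to dyadic values, the space splits into countably many
pieces on which the increment is taken over a deterministic interval, so that \<open>nn_integral_increment\<close>
applies; both sides converge as the rounding is refined, by path continuity and the continuity of \<open>H\<close>.\<close>

lemma strong_markov_increment:
  fixes Y :: "'w \<Rightarrow> 'y::{second_countable_topology, real_normed_vector}" and H :: "'y \<times> (real ^ 'm) \<Rightarrow> ennreal"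
    and V :: "real \<Rightarrow> 'w \<Rightarrow> real ^ 'm"
  assumes N: "N \<in> null_sets M" "\<And>t \<omega>. \<omega> \<notin> N \<Longrightarrow> V t \<omega> = W t \<omega>"
    and V: "\<And>t. 0 \<le> t \<Longrightarrow> V t \<in> F t \<rightarrow>\<^sub>M borel"
      "\<And>\<omega>. \<omega> \<in> space M \<Longrightarrow> continuous_on {0..} (\<lambda>t. V t \<omega>)"
    and T: "\<And>\<omega>. \<omega> \<in> space M \<Longrightarrow> 0 \<le> T \<omega>" and D: "\<And>\<omega>. \<omega> \<in> space M \<Longrightarrow> 0 < D \<omega>"
    and stop: "\<And>t. 0 \<le> t \<Longrightarrow> {\<omega>\<in>space M. T \<omega> \<le> t} \<in> sets (F t)"
    and T_meas: "\<And>t. 0 \<le> t \<Longrightarrow> T \<in> restrict_space (F t) {\<omega>\<in>space M. T \<omega> \<le> t} \<rightarrow>\<^sub>M borel"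
    and D_meas: "\<And>t. 0 \<le> t \<Longrightarrow> D \<in> restrict_space (F t) {\<omega>\<in>space M. T \<omega> \<le> t} \<rightarrow>\<^sub>M borel"
    and Y_meas: "\<And>t. 0 \<le> t \<Longrightarrow> Y \<in> restrict_space (F t) {\<omega>\<in>space M. T \<omega> \<le> t} \<rightarrow>\<^sub>M borel"
    and A: "A \<subseteq> space M" "\<And>t. 0 \<le> t \<Longrightarrow> A \<inter> {\<omega>\<in>space M. T \<omega> \<le> t} \<in> sets (F t)"
    and H: "H \<in> borel_measurable (borel \<Otimes>\<^sub>M borel)" "\<And>y. continuous_on UNIV (\<lambda>w. H (y, w))" "\<And>p. H p \<le> 1"
  shows "(\<integral>\<^sup>+\<omega>. indicator A \<omega> * H (Y \<omega>, V (T \<omega> + D \<omega>) \<omega> - V (T \<omega>) \<omega>) \<partial>M) =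
    (\<integral>\<^sup>+\<omega>. indicator A \<omega> * (\<integral>\<^sup>+z. H (Y \<omega>, sqrt (D \<omega>) *\<^sub>R z) \<partial>std_gaussian) \<partial>M)"
proof -
  define Tk where "Tk k \<omega> = dyadic_above k (T \<omega>)" for k \<omega>
  define Dk where "Dk k \<omega> = dyadic_above k (D \<omega>)" for k \<omega>
  define L where "L k \<omega> = indicator A \<omega> * H (Y \<omega>, V (Tk k \<omega> + Dk k \<omega>) \<omega> - V (Tk k \<omega>) \<omega>)" for k \<omega>
  define R where "R k \<omega> = indicator A \<omega> * (\<integral>\<^sup>+z. H (Y \<omega>, sqrt (Dk k \<omega>) *\<^sub>R z) \<partial>(std_gaussian :: (real ^ 'm) measure))" for k \<omega>
  have discrete: "L k \<in> borel_measurable M \<and> R k \<in> borel_measurable M \<and> (\<integral>\<^sup>+\<omega>. L k \<omega> \<partial>M) = (\<integral>\<^sup>+\<omega>. R k \<omega> \<partial>M)" for k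
  proof -
    define \<kappa> where "\<kappa> \<omega> = prod_encode (nat \<lfloor>2 ^ k * T \<omega>\<rfloor>, nat \<lfloor>2 ^ k * D \<omega>\<rfloor>)" for \<omega>
    have part: "(\<lambda>\<omega>. L k \<omega> * indicator {n} (\<kappa> \<omega>)) \<in> borel_measurable M \<and>
        (\<lambda>\<omega>. R k \<omega> * indicator {n} (\<kappa> \<omega>)) \<in> borel_measurable M \<and>
        (\<integral>\<^sup>+\<omega>. L k \<omega> * indicator {n} (\<kappa> \<omega>) \<partial>M) = (\<integral>\<^sup>+\<omega>. R k \<omega> * indicator {n} (\<kappa> \<omega>) \<partial>M)" for n
    proof -
      obtain i j where n: "n = prod_encode (i, j)" by (metis prod.exhaust prod_decode_inverse)
      define s where "s = real (i + 1) / 2 ^ k"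
      define d where "d = real (j + 1) / 2 ^ k"
      have sd: "0 \<le> s" "0 < d" by (simp_all add: s_def d_def add_pos_nonneg)
      define B where "B = {\<omega>\<in>space M. T \<omega> \<le> s}"
      define E where "E = {\<omega>\<in>A \<inter> B. nat \<lfloor>2 ^ k * T \<omega>\<rfloor> = i \<and> nat \<lfloor>2 ^ k * D \<omega>\<rfloor> = j}"
      have B: "B \<in> sets (F s)" unfolding B_def using stop[OF sd(1)] .
      have spB: "space (restrict_space (F s) B) = B"
        using space_F[OF sd(1)] by (auto simp: space_restrict_space B_def)
      have E: "E \<in> sets (F s)"
      proof -
        have "A \<inter> B \<in> sets (restrict_space (F s) B)"
          using A(2)[OF sd(1)] B by (auto simp: sets_restrict_space_iff B_def)
        moreover have "{\<omega>\<in>space (restrict_space (F s) B). nat \<lfloor>2 ^ k * T \<omega>\<rfloor> = i \<and> nat \<lfloor>2 ^ k * D \<omega>\<rfloor> = j} \<in> sets (restrict_space (F s) B)"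
          using T_meas[OF sd(1)] D_meas[OF sd(1)] unfolding B_def[symmetric] by measurable
        ultimately have "A \<inter> B \<inter> {\<omega>\<in>space (restrict_space (F s) B). nat \<lfloor>2 ^ k * T \<omega>\<rfloor> = i \<and> nat \<lfloor>2 ^ k * D \<omega>\<rfloor> = j} \<in> sets (restrict_space (F s) B)"
          by (rule sets.Int)
        moreover have "A \<inter> B \<inter> {\<omega>\<in>space (restrict_space (F s) B). nat \<lfloor>2 ^ k * T \<omega>\<rfloor> = i \<and> nat \<lfloor>2 ^ k * D \<omega>\<rfloor> = j} = E"
          unfolding spB E_def by auto
        ultimately show ?thesis using B by (auto simp: sets_restrict_space_iff)
      qed
      have E_iff: "\<omega> \<in> E \<longleftrightarrow> \<omega> \<in> A \<and> \<kappa> \<omega> = n" if "\<omega> \<in> space M" for \<omega>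
      proof -
        have "T \<omega> \<le> s" if "nat \<lfloor>2 ^ k * T \<omega>\<rfloor> = i"
          using dyadic_above_bounds(1)[OF T[OF \<open>\<omega> \<in> space M\<close>], of k] that by (simp add: dyadic_above_def s_def)
        then show ?thesis using that by (auto simp: E_def B_def \<kappa>_def n)
      qed
      \<comment> \<open>The indicator makes \<open>E\<close> visible in \<open>h\<close>, and \<open>Y\<close> is set to 0 outside \<open>E\<close>, where it need not be known at time \<open>s\<close>.\<close>
      define X where "X \<omega> = (indicator E \<omega> :: real, if \<omega> \<in> E then Y \<omega> else 0)" for \<omega>
      have X: "X \<in> F s \<rightarrow>\<^sub>M borel \<Otimes>\<^sub>M borel"
      proof -
        have "Y \<in> restrict_space (F s) E \<rightarrow>\<^sub>M borel"
          using Y_meas[OF sd(1)] by (rule measurable_restrict_mono) (auto simp: E_def B_def)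
        then have "(\<lambda>\<omega>. if \<omega> \<in> E then Y \<omega> else 0) \<in> F s \<rightarrow>\<^sub>M borel"
          using E by (subst (asm) measurable_restrict_space_iff[where c=0]) auto
        moreover have "(indicator E :: _ \<Rightarrow> real) \<in> F s \<rightarrow>\<^sub>M borel" using E by simp
        ultimately show ?thesis unfolding X_def by measurable
      qed
      define h where "h p = ennreal (fst (fst p)) * H (snd (fst p), snd p)" for p :: "(real \<times> 'y) \<times> (real ^ 'm)"
      have h: "h \<in> borel_measurable ((borel \<Otimes>\<^sub>M borel) \<Otimes>\<^sub>M borel)"
        unfolding h_def using H(1) by measurable
      have key: "(\<integral>\<^sup>+\<omega>. h (X \<omega>, W (s + d) \<omega> - W s \<omega>) \<partial>M) = (\<integral>\<^sup>+\<omega>. \<integral>\<^sup>+z. h (X \<omega>, sqrt d *\<^sub>R z) \<partial>std_gaussian \<partial>M)"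
        by (rule nn_integral_increment[OF sd X h])
      have L_eq: "L k \<omega> * indicator {n} (\<kappa> \<omega>) = h (X \<omega>, V (s + d) \<omega> - V s \<omega>)" if "\<omega> \<in> space M" for \<omega>
      proof (cases "\<omega> \<in> E")
        case True
        then have "Tk k \<omega> = s" "Dk k \<omega> = d" by (auto simp: E_def Tk_def Dk_def dyadic_above_def s_def d_def)
        then show ?thesis using True E_iff[OF that] by (simp add: L_def h_def X_def)
      next
        case False
        then show ?thesis using E_iff[OF that] by (auto simp: L_def h_def X_def indicator_def)
      qed
      have R_eq: "R k \<omega> * indicator {n} (\<kappa> \<omega>) = (\<integral>\<^sup>+z. h (X \<omega>, sqrt d *\<^sub>R z) \<partial>std_gaussian)" if "\<omega> \<in> space M" for \<omega>
      proof (cases "\<omega> \<in> E")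
        case True
        then have "Dk k \<omega> = d" by (auto simp: E_def Dk_def dyadic_above_def d_def)
        then show ?thesis using True E_iff[OF that] by (simp add: R_def h_def X_def)
      next
        case False
        then show ?thesis using E_iff[OF that] by (auto simp: R_def h_def X_def indicator_def)
      qed
      have V': "V (s + d) \<in> M \<rightarrow>\<^sub>M borel" "V s \<in> M \<rightarrow>\<^sub>M borel"
        using measurable_F_M[OF _ V(1)[of "s + d"]] measurable_F_M[OF sd(1) V(1)[OF sd(1)]] sd by auto
      have XM: "X \<in> M \<rightarrow>\<^sub>M borel \<Otimes>\<^sub>M borel" by (rule measurable_F_M[OF sd(1) X])
      have hL: "(\<lambda>\<omega>. h (X \<omega>, V (s + d) \<omega> - V s \<omega>)) \<in> borel_measurable M"
        by (rule measurable_compose[OF _ h]) (use XM V' in measurable)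
      have hR: "(\<lambda>\<omega>. \<integral>\<^sup>+z. h (X \<omega>, sqrt d *\<^sub>R z) \<partial>std_gaussian) \<in> borel_measurable M"
      proof -
        have "(\<lambda>(\<omega>, z). h (X \<omega>, sqrt d *\<^sub>R z)) \<in> borel_measurable (M \<Otimes>\<^sub>M (std_gaussian :: (real ^ 'm) measure))"
          unfolding case_prod_unfold by (rule measurable_compose[OF _ h]) (use XM in measurable)
        then show ?thesis by (rule std_gaussian.borel_measurable_nn_integral)
      qed
      have "(\<integral>\<^sup>+\<omega>. L k \<omega> * indicator {n} (\<kappa> \<omega>) \<partial>M) = (\<integral>\<^sup>+\<omega>. h (X \<omega>, V (s + d) \<omega> - V s \<omega>) \<partial>M)"
        by (rule nn_integral_cong) (rule L_eq)
      also have "\<dots> = (\<integral>\<^sup>+\<omega>. h (X \<omega>, W (s + d) \<omega> - W s \<omega>) \<partial>M)"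
        by (rule nn_integral_cong_AE) (rule AE_mp[OF AE_not_in[OF N(1)]], simp add: N(2))
      also have "\<dots> = (\<integral>\<^sup>+\<omega>. R k \<omega> * indicator {n} (\<kappa> \<omega>) \<partial>M)"
        unfolding key by (rule nn_integral_cong) (rule R_eq[symmetric])
      finally show ?thesis
        using hL hR L_eq R_eq by (simp cong: measurable_cong)
    qed
    have "(\<integral>\<^sup>+\<omega>. L k \<omega> \<partial>M) = (\<Sum>n. \<integral>\<^sup>+\<omega>. L k \<omega> * indicator {n} (\<kappa> \<omega>) \<partial>M)"
      by (rule nn_integral_partition) (use part in blast)
    also have "\<dots> = (\<Sum>n. \<integral>\<^sup>+\<omega>. R k \<omega> * indicator {n} (\<kappa> \<omega>) \<partial>M)"
      using part by simp
    also have "\<dots> = (\<integral>\<^sup>+\<omega>. R k \<omega> \<partial>M)"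
      by (rule nn_integral_partition(1)[symmetric]) (use part in blast)
    finally show ?thesis
      using nn_integral_partition(2)[of "L k" \<kappa> M] nn_integral_partition(2)[of "R k" \<kappa> M] part by blast
  qed
  have Tk: "0 \<le> Tk k \<omega>" "0 < Dk k \<omega>" for k \<omega>
    unfolding Tk_def Dk_def by (simp_all add: dyadic_above_pos less_imp_le)
  have L_lim: "(\<lambda>k. L k \<omega>) \<longlonglongrightarrow> indicator A \<omega> * H (Y \<omega>, V (T \<omega> + D \<omega>) \<omega> - V (T \<omega>) \<omega>)"
    if \<omega>: "\<omega> \<in> space M" for \<omega>
  proof -
    have t: "(\<lambda>k. Tk k \<omega>) \<longlonglongrightarrow> T \<omega>" "(\<lambda>k. Dk k \<omega>) \<longlonglongrightarrow> D \<omega>"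
      unfolding Tk_def Dk_def using T[OF \<omega>] D[OF \<omega>] by (auto intro!: dyadic_above_tendsto)
    have "(\<lambda>k. V (Tk k \<omega> + Dk k \<omega>) \<omega> - V (Tk k \<omega>) \<omega>) \<longlonglongrightarrow> V (T \<omega> + D \<omega>) \<omega> - V (T \<omega>) \<omega>"
      using T[OF \<omega>] D[OF \<omega>] Tk less_imp_le[OF Tk(2)]
      by (intro tendsto_diff continuous_on_tendsto_compose[OF V(2)[OF \<omega>]] tendsto_add t) auto
    then have "(\<lambda>k. H (Y \<omega>, V (Tk k \<omega> + Dk k \<omega>) \<omega> - V (Tk k \<omega>) \<omega>)) \<longlonglongrightarrow> H (Y \<omega>, V (T \<omega> + D \<omega>) \<omega> - V (T \<omega>) \<omega>)"
      by (intro continuous_on_tendsto_compose[OF H(2)]) auto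
    then show ?thesis unfolding L_def by (cases "\<omega> \<in> A") auto
  qed
  have R_lim: "(\<lambda>k. R k \<omega>) \<longlonglongrightarrow> indicator A \<omega> * (\<integral>\<^sup>+z. H (Y \<omega>, sqrt (D \<omega>) *\<^sub>R z) \<partial>std_gaussian)"
    if \<omega>: "\<omega> \<in> space M" for \<omega>
  proof -
    have Hy: "(\<lambda>w. H (y, w)) \<in> borel_measurable borel" for y
      by (rule measurable_compose[OF measurable_Pair1' H(1)]) simp
    have "(\<lambda>k. \<integral>\<^sup>+z. H (Y \<omega>, sqrt (Dk k \<omega>) *\<^sub>R z) \<partial>(std_gaussian :: (real ^ 'm) measure)) \<longlonglongrightarrow> (\<integral>\<^sup>+z. H (Y \<omega>, sqrt (D \<omega>) *\<^sub>R z) \<partial>std_gaussian)"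
    proof (rule nn_integral_dominated_convergence[where w="\<lambda>_. 1"])
      show "AE z in std_gaussian. (\<lambda>k. H (Y \<omega>, sqrt (Dk k \<omega>) *\<^sub>R z)) \<longlonglongrightarrow> H (Y \<omega>, sqrt (D \<omega>) *\<^sub>R z)"
        unfolding Dk_def using D[OF \<omega>]
        by (intro AE_I2 continuous_on_tendsto_compose[OF H(2)] tendsto_scaleR tendsto_real_sqrt dyadic_above_tendsto) auto
      show "(\<integral>\<^sup>+z. 1 \<partial>(std_gaussian :: (real ^ 'm) measure)) < \<infinity>"
        using std_gaussian.emeasure_space_1[where 'a="real ^ 'm"] by simp
      show "(\<lambda>z. H (Y \<omega>, sqrt (Dk k \<omega>) *\<^sub>R z)) \<in> borel_measurable std_gaussian" for k
        by (rule measurable_compose[OF _ Hy]) simp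
      show "(\<lambda>z. H (Y \<omega>, sqrt (D \<omega>) *\<^sub>R z)) \<in> borel_measurable std_gaussian"
        by (rule measurable_compose[OF _ Hy]) simp
    qed (use H(3) in auto)
    then show ?thesis unfolding R_def by (cases "\<omega> \<in> A") auto
  qed
  have le1: "L k \<omega> \<le> 1" "R k \<omega> \<le> 1" for k \<omega>
  proof -
    show "L k \<omega> \<le> 1" unfolding L_def using H(3) by (auto simp: indicator_def)
    have "(\<integral>\<^sup>+z. H (Y \<omega>, sqrt (Dk k \<omega>) *\<^sub>R z) \<partial>(std_gaussian :: (real ^ 'm) measure)) \<le> (\<integral>\<^sup>+z. 1 \<partial>(std_gaussian :: (real ^ 'm) measure))"
      by (intro nn_integral_mono H(3))
    then show "R k \<omega> \<le> 1"
      using std_gaussian.emeasure_space_1[where 'a="real ^ 'm"] unfolding R_def by (auto simp: indicator_def)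
  qed
  have lim: "(\<lambda>k. \<integral>\<^sup>+\<omega>. G k \<omega> \<partial>M) \<longlonglongrightarrow> (\<integral>\<^sup>+\<omega>. G' \<omega> \<partial>M)"
    if "\<And>k. G k \<in> borel_measurable M" "\<And>k \<omega>. G k \<omega> \<le> 1" "\<And>\<omega>. \<omega> \<in> space M \<Longrightarrow> (\<lambda>k. G k \<omega>) \<longlonglongrightarrow> G' \<omega>" for G :: "nat \<Rightarrow> 'w \<Rightarrow> ennreal" and G'
  proof (rule nn_integral_dominated_convergence[where w="\<lambda>_. 1"])
    show "G' \<in> borel_measurable M" using that(3,1) by (rule borel_measurable_LIMSEQ_order)
    show "(\<integral>\<^sup>+\<omega>. 1 \<partial>M) < \<infinity>" using emeasure_space_1 by simp
  qed (use that in auto)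
  have "(\<lambda>k. \<integral>\<^sup>+\<omega>. R k \<omega> \<partial>M) \<longlonglongrightarrow> (\<integral>\<^sup>+\<omega>. indicator A \<omega> * H (Y \<omega>, V (T \<omega> + D \<omega>) \<omega> - V (T \<omega>) \<omega>) \<partial>M)"
    using lim[of L, OF _ le1(1) L_lim] discrete by simp
  moreover have "(\<lambda>k. \<integral>\<^sup>+\<omega>. R k \<omega> \<partial>M) \<longlonglongrightarrow> (\<integral>\<^sup>+\<omega>. indicator A \<omega> * (\<integral>\<^sup>+z. H (Y \<omega>, sqrt (D \<omega>) *\<^sub>R z) \<partial>std_gaussian) \<partial>M)"
    using lim[of R, OF _ le1(2) R_lim] discrete by simp
  ultimately show ?thesis by (rule LIMSEQ_unique)
qed

end

section \<open>The scheme as a Markov chain\<close>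

definition em_transition ::
    "(real ^ 'd \<Rightarrow> real ^ 'd) \<Rightarrow> (real ^ 'd \<Rightarrow> real ^ 'm ^ 'd) \<Rightarrow> (real ^ 'd \<Rightarrow> real) \<Rightarrow> real ^ 'd \<Rightarrow> (real ^ 'd) measure"
  where "em_transition f g \<delta> y =
    distr std_gaussian borel (\<lambda>z. (y + \<delta> y *\<^sub>R f y) + g y *v (sqrt (\<delta> y) *\<^sub>R z))"

lemma measurable_matrix_vector_mult[measurable (raw)]:
  fixes A :: "'a \<Rightarrow> real ^ 'm ^ 'd" and v :: "'a \<Rightarrow> real ^ 'm"
  assumes "A \<in> borel_measurable N" "v \<in> borel_measurable N"
  shows "(\<lambda>x. A x *v v x) \<in> borel_measurable N"
proof -
  have "continuous_on UNIV (\<lambda>p. fst p *v (snd p :: real ^ 'm) :: real ^ 'd)"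
    unfolding matrix_vector_mult_def by (intro continuous_intros)
  then have "(\<lambda>p. fst p *v (snd p :: real ^ 'm) :: real ^ 'd) \<in> borel_measurable borel"
    by (rule borel_measurable_continuous_onI)
  from measurable_compose[OF borel_measurable_Pair[OF assms] this] show ?thesis by simp
qed

lemma measurable_em_transition:
  assumes [measurable]: "f \<in> borel_measurable borel" "g \<in> borel_measurable borel" "\<delta> \<in> borel_measurable borel"
  shows "em_transition f g \<delta> \<in> borel \<rightarrow>\<^sub>M prob_algebra borel"
  unfolding em_transition_def
proof (rule measurable_distr_prob_space2[where M=std_gaussian])
  show "(\<lambda>y. std_gaussian) \<in> borel \<rightarrow>\<^sub>M prob_algebra std_gaussian"
    by (rule measurable_const) (simp add: space_prob_algebra std_gaussian.prob_space_axioms)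
  show "(\<lambda>(y, z). (y + \<delta> y *\<^sub>R f y) + g y *v (sqrt (\<delta> y) *\<^sub>R z)) \<in> borel \<Otimes>\<^sub>M std_gaussian \<rightarrow>\<^sub>M borel"
    by measurable
qed

lemma finite_measure_eqI_closed:
  fixes \<mu> \<nu> :: "'a::metric_space measure"
  assumes "finite_measure \<mu>" "sets \<mu> = sets borel" "sets \<nu> = sets borel"
    and eq: "\<And>C. closed C \<Longrightarrow> emeasure \<mu> C = emeasure \<nu> C"
  shows "\<mu> = \<nu>"
proof (rule measure_eqI_generator_eq[where E="Collect closed" and \<Omega>=UNIV and A="\<lambda>_. UNIV"])
  show "Int_stable (Collect closed :: 'a set set)" by (auto simp: Int_stable_def)
  show "sets \<mu> = sigma_sets UNIV (Collect closed)" "sets \<nu> = sigma_sets UNIV (Collect closed)"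
    using assms by (simp_all add: borel_eq_closed)
  show "emeasure \<mu> UNIV \<noteq> \<infinity>" for i :: nat using assms(1) by (simp add: finite_measure.emeasure_finite)
qed (use eq in auto)

text \<open>Continuous functions with values in \<open>[0, 1]\<close> that decrease to the indicator function of a closed nonempty
set.\<close>

definition bump :: "'a::metric_space set \<Rightarrow> nat \<Rightarrow> 'a \<Rightarrow> ennreal" where
  "bump C n x = ennreal (max 0 (1 - real n * infdist x C))"

lemma bump_le_1: "bump C n x \<le> 1"
  by (simp add: bump_def infdist_nonneg)

lemma continuous_on_bump: "continuous_on UNIV (bump C n)"
  unfolding bump_def by (intro continuous_on_ennreal continuous_on_max continuous_intros continuous_on_infdist)

lemma measurable_bump[measurable]: "bump C n \<in> borel_measurable borel"
  by (intro borel_measurable_continuous_onI continuous_on_bump)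

lemma bump_tendsto:
  assumes C: "closed C" "C \<noteq> {}"
  shows "(\<lambda>n. bump C n x) \<longlonglongrightarrow> indicator C x"
proof (cases "x \<in> C")
  case True
  then show ?thesis by (simp add: bump_def)
next
  case False
  then have d: "infdist x C > 0" using C by (simp add: in_closed_iff_infdist_zero less_le infdist_nonneg)
  obtain k where k: "1 \<le> real k * infdist x C" using reals_Archimedean3[OF d] less_imp_le by blast
  have "bump C n x = 0" if "n \<ge> k" for n
  proof -
    have "1 \<le> real n * infdist x C"
      using order_trans[OF k mult_right_mono[of "real k" "real n" "infdist x C"]] that d by simp
    then show ?thesis by (simp add: bump_def)
  qed
  then have "(\<lambda>n. bump C n x) \<longlonglongrightarrow> 0" by (intro tendsto_eventually) (auto simp: eventually_sequentially)
  then show ?thesis using False by simp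
qed

context brownian_motion
begin

text \<open>Both sides are finite measures as functions of \<open>B\<close>, so it is enough to compare them on closed sets.
Closed sets are limits of continuous functions, for which \<open>strong_markov_increment\<close> applies.\<close>

lemma em_step_law:
  fixes f :: "real ^ 'd \<Rightarrow> real ^ 'd" and g :: "real ^ 'd \<Rightarrow> real ^ 'm ^ 'd" and \<delta> :: "real ^ 'd \<Rightarrow> real"
    and V :: "real \<Rightarrow> 'w \<Rightarrow> real ^ 'm"
  assumes fm[measurable]: "f \<in> borel_measurable borel" "g \<in> borel_measurable borel" "\<delta> \<in> borel_measurable borel"
    and \<delta>: "\<And>y. 0 < \<delta> y"
    and N: "N \<in> null_sets M" "\<And>t \<omega>. \<omega> \<notin> N \<Longrightarrow> V t \<omega> = W t \<omega>"
    and V: "\<And>t. 0 \<le> t \<Longrightarrow> V t \<in> F t \<rightarrow>\<^sub>M borel"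
      "\<And>\<omega>. \<omega> \<in> space M \<Longrightarrow> continuous_on {0..} (\<lambda>t. V t \<omega>)"
    and T: "\<And>\<omega>. \<omega> \<in> space M \<Longrightarrow> 0 \<le> T \<omega>"
    and stop: "\<And>t. 0 \<le> t \<Longrightarrow> {\<omega>\<in>space M. T \<omega> \<le> t} \<in> sets (F t)"
    and T_meas: "\<And>t. 0 \<le> t \<Longrightarrow> T \<in> restrict_space (F t) {\<omega>\<in>space M. T \<omega> \<le> t} \<rightarrow>\<^sub>M borel"
    and Y_meas: "\<And>t. 0 \<le> t \<Longrightarrow> Y \<in> restrict_space (F t) {\<omega>\<in>space M. T \<omega> \<le> t} \<rightarrow>\<^sub>M borel"
    and A: "A \<in> sets M" "\<And>t. 0 \<le> t \<Longrightarrow> A \<inter> {\<omega>\<in>space M. T \<omega> \<le> t} \<in> sets (F t)"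
    and YM[measurable]: "Y \<in> M \<rightarrow>\<^sub>M borel"
    and Y'M[measurable]: "Y' \<in> M \<rightarrow>\<^sub>M borel"
    and Y': "\<And>\<omega>. \<omega> \<in> space M \<Longrightarrow> Y' \<omega> = Y \<omega> + \<delta> (Y \<omega>) *\<^sub>R f (Y \<omega>) + g (Y \<omega>) *v (V (T \<omega> + \<delta> (Y \<omega>)) \<omega> - V (T \<omega>) \<omega>)"
    and B: "B \<in> sets borel"
  shows "emeasure M (A \<inter> (Y' -` B \<inter> space M)) = (\<integral>\<^sup>+\<omega>. indicator A \<omega> * emeasure (em_transition f g \<delta> (Y \<omega>)) B \<partial>M)"
proof -
  let ?K = "em_transition f g \<delta>"
  note K = measurable_prob_algebraD[OF measurable_em_transition[OF fm]]
  have [measurable]: "A \<in> sets M" by (rule A(1))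
  have KM: "(\<lambda>\<omega>. ?K (Y \<omega>)) \<in> M \<rightarrow>\<^sub>M subprob_algebra borel" by (rule measurable_compose[OF YM K])
  define MA where "MA = density M (indicator A)"
  have spMA: "space MA = space M" "sets MA = sets M" by (simp_all add: MA_def)
  define \<mu> where "\<mu> = distr MA borel Y'"
  define \<nu> where "\<nu> = MA \<bind> (\<lambda>\<omega>. ?K (Y \<omega>))"
  have KMA: "(\<lambda>\<omega>. ?K (Y \<omega>)) \<in> MA \<rightarrow>\<^sub>M subprob_algebra borel" using KM by (simp add: MA_def)
  have \<mu>_em: "emeasure \<mu> B = emeasure M (A \<inter> (Y' -` B \<inter> space M))" if [measurable]: "B \<in> sets borel" for B
  proof -
    have "emeasure \<mu> B = (\<integral>\<^sup>+\<omega>. indicator A \<omega> * indicator (Y' -` B \<inter> space M) \<omega> \<partial>M)"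
      unfolding \<mu>_def MA_def by (simp add: emeasure_distr emeasure_density)
    also have "\<dots> = (\<integral>\<^sup>+\<omega>. indicator (A \<inter> (Y' -` B \<inter> space M)) \<omega> \<partial>M)"
      by (simp add: indicator_inter_arith)
    finally show ?thesis by simp
  qed
  have \<nu>_em: "emeasure \<nu> B = (\<integral>\<^sup>+\<omega>. indicator A \<omega> * emeasure (?K (Y \<omega>)) B \<partial>M)" if B[measurable]: "B \<in> sets borel" for B
  proof -
    have "emeasure \<nu> B = (\<integral>\<^sup>+\<omega>. emeasure (?K (Y \<omega>)) B \<partial>MA)"
      unfolding \<nu>_def using KMA B not_empty by (intro emeasure_bind) (auto simp: MA_def)
    also have "\<dots> = (\<integral>\<^sup>+\<omega>. indicator A \<omega> * emeasure (?K (Y \<omega>)) B \<partial>M)"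
      unfolding MA_def using measurable_emeasure_kernel[OF KM B] by (intro nn_integral_density) auto
    finally show ?thesis .
  qed
  have fin: "finite_measure \<mu>"
  proof (rule finite_measureI)
    have "emeasure \<mu> (space \<mu>) = emeasure M (A \<inter> (Y' -` UNIV \<inter> space M))" using \<mu>_em[of UNIV] by (simp add: \<mu>_def)
    then show "emeasure \<mu> (space \<mu>) \<noteq> \<infinity>" by simp
  qed
  have bump_eq: "(\<integral>\<^sup>+\<omega>. indicator A \<omega> * bump C n (Y' \<omega>) \<partial>M) =
      (\<integral>\<^sup>+\<omega>. indicator A \<omega> * (\<integral>\<^sup>+y. bump C n y \<partial>?K (Y \<omega>)) \<partial>M)" for C n
  proof -
    define H :: "(real ^ 'd) \<times> (real ^ 'm) \<Rightarrow> ennreal"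
      where "H p = bump C n (fst p + \<delta> (fst p) *\<^sub>R f (fst p) + g (fst p) *v snd p)" for p
    have "(\<integral>\<^sup>+\<omega>. indicator A \<omega> * H (Y \<omega>, V (T \<omega> + \<delta> (Y \<omega>)) \<omega> - V (T \<omega>) \<omega>) \<partial>M) =
       (\<integral>\<^sup>+\<omega>. indicator A \<omega> * (\<integral>\<^sup>+z. H (Y \<omega>, sqrt (\<delta> (Y \<omega>)) *\<^sub>R z) \<partial>std_gaussian) \<partial>M)"
    proof (rule strong_markov_increment[OF N V T _ stop T_meas _ Y_meas _ A(2)])
      show "(\<lambda>\<omega>. \<delta> (Y \<omega>)) \<in> restrict_space (F t) {\<omega>\<in>space M. T \<omega> \<le> t} \<rightarrow>\<^sub>M borel" if "0 \<le> t" for t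
        using Y_meas[OF that] by measurable
      show "H \<in> borel_measurable (borel \<Otimes>\<^sub>M borel)" unfolding H_def by measurable
      show "continuous_on UNIV (\<lambda>w. H (y, w))" for y
        unfolding H_def fst_conv snd_conv
        by (rule continuous_on_compose2[OF continuous_on_bump]) (auto intro!: continuous_intros)
      show "H p \<le> 1" for p unfolding H_def by (rule bump_le_1)
    qed (use \<delta> sets.sets_into_space[OF A(1)] in auto)
    moreover have "(\<integral>\<^sup>+z. H (y, sqrt (\<delta> y) *\<^sub>R z) \<partial>std_gaussian) = (\<integral>\<^sup>+y'. bump C n y' \<partial>?K y)" for y
      unfolding em_transition_def H_def by (subst nn_integral_distr) auto
    moreover have "(\<integral>\<^sup>+\<omega>. indicator A \<omega> * bump C n (Y' \<omega>) \<partial>M) = (\<integral>\<^sup>+\<omega>. indicator A \<omega> * H (Y \<omega>, V (T \<omega> + \<delta> (Y \<omega>)) \<omega> - V (T \<omega>) \<omega>) \<partial>M)"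
      by (rule nn_integral_cong) (simp add: Y' H_def)
    ultimately show ?thesis by simp
  qed
  have closed_eq: "emeasure \<mu> C = emeasure \<nu> C" if C: "closed C" for C
  proof (cases "C = {}")
    case False
    have Cm[measurable]: "C \<in> sets borel" using C by simp
    have "(\<lambda>n. \<integral>\<^sup>+y. bump C n y \<partial>\<mu>) \<longlonglongrightarrow> (\<integral>\<^sup>+y. indicator C y \<partial>\<mu>)"
    proof (rule nn_integral_dominated_convergence[where w="\<lambda>_. 1"])
      show "(\<integral>\<^sup>+y. 1 \<partial>\<mu>) < \<infinity>" using fin by (simp add: finite_measure.emeasure_finite less_top[symmetric])
      show "AE y in \<mu>. (\<lambda>n. bump C n y) \<longlonglongrightarrow> indicator C y" by (intro AE_I2 bump_tendsto C False)
    qed (auto simp: \<mu>_def bump_le_1)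
    moreover have "(\<integral>\<^sup>+y. bump C n y \<partial>\<mu>) = (\<integral>\<^sup>+y. bump C n y \<partial>\<nu>)" for n
    proof -
      have "(\<integral>\<^sup>+y. bump C n y \<partial>\<mu>) = (\<integral>\<^sup>+\<omega>. indicator A \<omega> * bump C n (Y' \<omega>) \<partial>M)"
        unfolding \<mu>_def MA_def by (subst nn_integral_distr) (auto simp: nn_integral_density)
      also have "\<dots> = (\<integral>\<^sup>+\<omega>. indicator A \<omega> * (\<integral>\<^sup>+y. bump C n y \<partial>?K (Y \<omega>)) \<partial>M)" by (rule bump_eq)
      also have "\<dots> = (\<integral>\<^sup>+\<omega>. \<integral>\<^sup>+y. bump C n y \<partial>?K (Y \<omega>) \<partial>MA)"
        unfolding MA_def using measurable_compose[OF KM nn_integral_measurable_subprob_algebra[of "bump C n" borel]]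
        by (intro nn_integral_density[symmetric]) auto
      also have "\<dots> = (\<integral>\<^sup>+y. bump C n y \<partial>\<nu>)"
        unfolding \<nu>_def using KMA by (intro nn_integral_bind[symmetric, where B=borel]) auto
      finally show ?thesis .
    qed
    moreover have "(\<lambda>n. \<integral>\<^sup>+y. bump C n y \<partial>\<nu>) \<longlonglongrightarrow> (\<integral>\<^sup>+y. indicator C y \<partial>\<nu>)"
    proof (rule nn_integral_dominated_convergence[where w="\<lambda>_. 1"])
      have "(\<integral>\<^sup>+y. 1 \<partial>\<nu>) = (\<integral>\<^sup>+\<omega>. \<integral>\<^sup>+y. 1 \<partial>?K (Y \<omega>) \<partial>MA)"
        unfolding \<nu>_def using KMA by (intro nn_integral_bind[where B=borel]) auto
      also have "\<dots> \<le> (\<integral>\<^sup>+\<omega>. 1 \<partial>MA)"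
      proof (rule nn_integral_mono)
        fix \<omega> assume "\<omega> \<in> space MA"
        then have "subprob_space (?K (Y \<omega>))" using measurable_space[OF KMA] by (simp add: space_subprob_algebra)
        then show "(\<integral>\<^sup>+y. 1 \<partial>?K (Y \<omega>)) \<le> 1" by (simp add: subprob_space.emeasure_space_le_1)
      qed
      also have "\<dots> < \<infinity>" unfolding MA_def by (simp add: emeasure_density less_top[symmetric])
      finally show "(\<integral>\<^sup>+y. 1 \<partial>\<nu>) < \<infinity>" .
      have "sets \<nu> = sets borel" unfolding \<nu>_def
        by (rule sets_bind) (use sets_kernel[OF KMA] not_empty in \<open>auto simp: MA_def\<close>)
      then show "bump C n \<in> borel_measurable \<nu>" "(\<lambda>y. indicator C y) \<in> borel_measurable \<nu>" for n
        by (simp_all cong: measurable_cong_sets)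
      show "AE y in \<nu>. (\<lambda>n. bump C n y) \<longlonglongrightarrow> indicator C y" by (intro AE_I2 bump_tendsto C False)
    qed (auto simp: bump_le_1)
    ultimately have "(\<integral>\<^sup>+y. indicator C y \<partial>\<mu>) = (\<integral>\<^sup>+y. indicator C y \<partial>\<nu>)"
      by (metis (no_types, lifting) LIMSEQ_unique ext)
    moreover have "sets \<nu> = sets borel" unfolding \<nu>_def
        by (rule sets_bind) (use sets_kernel[OF KMA] not_empty in \<open>auto simp: MA_def\<close>)
    ultimately show ?thesis by (simp add: \<mu>_def)
  qed simp
  have "\<mu> = \<nu>"
  proof (rule finite_measure_eqI_closed[OF fin])
    show "sets \<mu> = sets borel" by (simp add: \<mu>_def)
    show "sets \<nu> = sets borel" unfolding \<nu>_def
      by (rule sets_bind) (use sets_kernel[OF KMA] not_empty in \<open>auto simp: MA_def\<close>)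
  qed (rule closed_eq)
  then show ?thesis using \<mu>_em[OF B] \<nu>_em[OF B] by simp
qed

text \<open>The grid times are stopping times and the states are known at them; the two claims have to be proved
together, since each grid time depends on the preceding state.\<close>

lemma em_trajectory_adapted:
  fixes f :: "real ^ 'd \<Rightarrow> real ^ 'd" and g :: "real ^ 'd \<Rightarrow> real ^ 'm ^ 'd" and \<delta> :: "real ^ 'd \<Rightarrow> real"
    and V :: "real \<Rightarrow> 'w \<Rightarrow> real ^ 'm" and x :: "real ^ 'd"
  assumes fm[measurable]: "f \<in> borel_measurable borel" "g \<in> borel_measurable borel" "\<delta> \<in> borel_measurable borel"
    and \<delta>: "\<And>y. 0 < \<delta> y"
    and V: "\<forall>t\<ge>0. V t \<in> F t \<rightarrow>\<^sub>M borel" "\<forall>\<omega>\<in>space M. continuous_on {0..} (\<lambda>t. V t \<omega>)"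
  defines "T n \<omega> \<equiv> fst (adaptive_em f g \<delta> V x n \<omega>)" and "Y n \<omega> \<equiv> snd (adaptive_em f g \<delta> V x n \<omega>)"
  shows "0 \<le> T n \<omega>" "T n \<omega> \<le> T (Suc n) \<omega>"
    and "T (Suc n) \<omega> = T n \<omega> + \<delta> (Y n \<omega>)"
    and "Y (Suc n) \<omega> = Y n \<omega> + \<delta> (Y n \<omega>) *\<^sub>R f (Y n \<omega>) + g (Y n \<omega>) *v (V (T n \<omega> + \<delta> (Y n \<omega>)) \<omega> - V (T n \<omega>) \<omega>)"
    and "0 \<le> t \<Longrightarrow> {\<omega>\<in>space M. T n \<omega> \<le> t} \<in> sets (F t)"
    and "0 \<le> t \<Longrightarrow> T n \<in> restrict_space (F t) {\<omega>\<in>space M. T n \<omega> \<le> t} \<rightarrow>\<^sub>M borel"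
    and "0 \<le> t \<Longrightarrow> Y n \<in> restrict_space (F t) {\<omega>\<in>space M. T n \<omega> \<le> t} \<rightarrow>\<^sub>M borel"
proof -
  have TS: "T (Suc n) \<omega> = T n \<omega> + \<delta> (Y n \<omega>)" for n \<omega>
    by (simp add: T_def Y_def case_prod_unfold Let_def)
  have YS: "Y (Suc n) \<omega> = Y n \<omega> + \<delta> (Y n \<omega>) *\<^sub>R f (Y n \<omega>) + g (Y n \<omega>) *v (V (T n \<omega> + \<delta> (Y n \<omega>)) \<omega> - V (T n \<omega>) \<omega>)" for n \<omega>
    by (simp add: T_def Y_def case_prod_unfold Let_def)
  have T0: "0 \<le> T n \<omega>" for n \<omega>
    by (induction n) (use \<delta> in \<open>auto simp: TS intro: add_nonneg_nonneg less_imp_le\<close>, simp add: T_def)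
  show "0 \<le> T n \<omega>" by (rule T0)
  show "T n \<omega> \<le> T (Suc n) \<omega>" using less_imp_le[OF \<delta>] by (simp add: TS)
  show "T (Suc n) \<omega> = T n \<omega> + \<delta> (Y n \<omega>)" by (rule TS)
  show "Y (Suc n) \<omega> = Y n \<omega> + \<delta> (Y n \<omega>) *\<^sub>R f (Y n \<omega>) + g (Y n \<omega>) *v (V (T n \<omega> + \<delta> (Y n \<omega>)) \<omega> - V (T n \<omega>) \<omega>)"
    by (rule YS)
  have main: "{\<omega>\<in>space M. T n \<omega> \<le> t} \<in> sets (F t) \<and>
      T n \<in> restrict_space (F t) {\<omega>\<in>space M. T n \<omega> \<le> t} \<rightarrow>\<^sub>M borel \<and>
      Y n \<in> restrict_space (F t) {\<omega>\<in>space M. T n \<omega> \<le> t} \<rightarrow>\<^sub>M borel" if t: "0 \<le> t" for n t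
  proof (induction n)
    case 0
    have "{\<omega>\<in>space M. T 0 \<omega> \<le> t} = space (F t)" using t space_F[OF t] by (auto simp: T_def)
    moreover have "T 0 = (\<lambda>_. 0)" "Y 0 = (\<lambda>_. x)" by (auto simp: T_def Y_def)
    ultimately show ?case by simp
  next
    case (Suc n)
    let ?B = "{\<omega>\<in>space M. T n \<omega> \<le> t}" and ?B' = "{\<omega>\<in>space M. T (Suc n) \<omega> \<le> t}"
    let ?R = "restrict_space (F t) ?B" and ?R' = "restrict_space (F t) ?B'"
    have B: "?B \<in> sets (F t)" and Tn[measurable]: "T n \<in> ?R \<rightarrow>\<^sub>M borel" and Yn[measurable]: "Y n \<in> ?R \<rightarrow>\<^sub>M borel"
      using Suc by auto
    have sub: "?B' \<subseteq> ?B" using less_imp_le[OF \<delta>] by (auto simp: TS intro: order_trans[rotated])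
    have spR: "space ?R = ?B" and spR': "space ?R' = ?B'" using space_F[OF t] by (auto simp: space_restrict_space)
    have TS': "T (Suc n) = (\<lambda>\<omega>. T n \<omega> + \<delta> (Y n \<omega>))" by (auto simp: TS)
    have TSm[measurable]: "T (Suc n) \<in> ?R \<rightarrow>\<^sub>M borel" unfolding TS' by measurable
    have "{\<omega>\<in>space ?R. T (Suc n) \<omega> \<le> t} \<in> sets ?R" by measurable
    moreover have "{\<omega>\<in>space ?R. T (Suc n) \<omega> \<le> t} = ?B'" unfolding spR using sub by auto
    ultimately have B': "?B' \<in> sets (F t)" using B by (simp add: sets_restrict_space_iff)
    have restr: "X \<in> ?R' \<rightarrow>\<^sub>M borel" if "X \<in> ?R \<rightarrow>\<^sub>M borel" for X :: "'w \<Rightarrow> 'z::topological_space"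
      using that sub by (rule measurable_restrict_mono)
    have VR: "V s \<in> ?R' \<rightarrow>\<^sub>M borel" if "0 \<le> s" "s \<le> t" for s
      by (rule measurable_restrict_space1) (rule measurable_F_mono[OF that V(1)[rule_format, OF that(1)]])
    have at_time: "(\<lambda>\<omega>. V (S \<omega>) \<omega>) \<in> ?R' \<rightarrow>\<^sub>M borel"
      if "S \<in> ?R' \<rightarrow>\<^sub>M borel" "\<And>\<omega>. \<omega> \<in> ?B' \<Longrightarrow> 0 \<le> S \<omega> \<and> S \<omega> \<le> t" for S
      by (rule measurable_at_random_time[OF VR _ that(1) _ t]) (use that(2) V(2) spR' in auto)
    have "(\<lambda>\<omega>. V (T (Suc n) \<omega>) \<omega>) \<in> ?R' \<rightarrow>\<^sub>M borel"
      using restr[OF TSm] T0[of "Suc n"] by (intro at_time) auto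
    then have "(\<lambda>\<omega>. V (T n \<omega> + \<delta> (Y n \<omega>)) \<omega>) \<in> ?R' \<rightarrow>\<^sub>M borel" by (simp only: TS)
    moreover have "(\<lambda>\<omega>. V (T n \<omega>) \<omega>) \<in> ?R' \<rightarrow>\<^sub>M borel"
      using restr[OF Tn] T0[of n] sub by (intro at_time) auto
    ultimately have "(\<lambda>\<omega>. Y n \<omega> + \<delta> (Y n \<omega>) *\<^sub>R f (Y n \<omega>) + g (Y n \<omega>) *v (V (T n \<omega> + \<delta> (Y n \<omega>)) \<omega> - V (T n \<omega>) \<omega>)) \<in> ?R' \<rightarrow>\<^sub>M borel"
      using restr[OF Yn] by measurable
    then have "Y (Suc n) \<in> ?R' \<rightarrow>\<^sub>M borel" by (simp add: YS[abs_def])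
    then show ?case using B' restr[OF TSm] by blast
  qed
  show "0 \<le> t \<Longrightarrow> {\<omega>\<in>space M. T n \<omega> \<le> t} \<in> sets (F t)"
    "0 \<le> t \<Longrightarrow> T n \<in> restrict_space (F t) {\<omega>\<in>space M. T n \<omega> \<le> t} \<rightarrow>\<^sub>M borel"
    "0 \<le> t \<Longrightarrow> Y n \<in> restrict_space (F t) {\<omega>\<in>space M. T n \<omega> \<le> t} \<rightarrow>\<^sub>M borel"
    using main by blast+
qed

text \<open>Each \<open>F t\<close> contains all null sets, so it does not see changes on a null set.\<close>

lemma sets_F_modify:
  assumes t: "0 \<le> t" and N: "N \<in> null_sets M" and S': "S' \<in> sets (F t)" and S: "S \<subseteq> space M" "S - N = S' - N"
  shows "S \<in> sets (F t)"
proof -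
  have "S \<inter> N \<subseteq> N" by simp
  then have "S \<inter> N \<in> null_sets M" using N by (rule complete2)
  then have "S \<inter> N \<in> sets (F t)" "N \<in> sets (F t)" using null_sets_F[OF t] N by auto
  then have "(S' - N) \<union> (S \<inter> N) \<in> sets (F t)" using S' by auto
  moreover have "(S' - N) \<union> (S \<inter> N) = S" using S(2) by auto
  ultimately show ?thesis by simp
qed

text \<open>The state \<open>Y\<^sub>i\<close> is known at \<open>t\<^sub>i \<le> t\<^sub>n\<close> for \<open>i \<le> n\<close>, so the events of the natural filtration at \<open>n\<close> are known
at the stopping time \<open>t\<^sub>n\<close>, and \<open>em_step_law\<close> applies to them. The scheme driven by \<open>W\<close> and the one driven
by its continuous version agree outside a null set.\<close>

theorem em_markov_property:
  fixes f :: "real ^ 'd \<Rightarrow> real ^ 'd" and g :: "real ^ 'd \<Rightarrow> real ^ 'm ^ 'd" and \<delta> :: "real ^ 'd \<Rightarrow> real"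
  assumes fm[measurable]: "f \<in> borel_measurable borel" "g \<in> borel_measurable borel" "\<delta> \<in> borel_measurable borel"
    and \<delta>: "\<And>y. 0 < \<delta> y"
  shows "em_state f g \<delta> W x n \<in> M \<rightarrow>\<^sub>M borel"
    and "A \<in> sets (natural_filtration M (em_state f g \<delta> W x) n) \<Longrightarrow> B \<in> sets borel \<Longrightarrow>
      emeasure M (A \<inter> (em_state f g \<delta> W x (Suc n) -` B \<inter> space M)) =
      (\<integral>\<^sup>+\<omega>. indicator A \<omega> * emeasure (em_transition f g \<delta> (em_state f g \<delta> W x n \<omega>)) B \<partial>M)"
proof -
  obtain V N where N: "N \<in> null_sets M" "\<And>t \<omega>. \<omega> \<notin> N \<Longrightarrow> V t \<omega> = W t \<omega>"
    and V: "\<And>t. 0 \<le> t \<Longrightarrow> V t \<in> F t \<rightarrow>\<^sub>M borel" "\<And>\<omega>. \<omega> \<in> space M \<Longrightarrow> continuous_on {0..} (\<lambda>t. V t \<omega>)"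
    by (rule continuous_version) blast
  define T where "T n \<omega> = fst (adaptive_em f g \<delta> V x n \<omega>)" for n \<omega>
  define Y where "Y n \<omega> = snd (adaptive_em f g \<delta> V x n \<omega>)" for n \<omega>
  let ?X = "em_state f g \<delta> W x"
  have V': "\<forall>t\<ge>0. V t \<in> F t \<rightarrow>\<^sub>M borel" "\<forall>\<omega>\<in>space M. continuous_on {0..} (\<lambda>t. V t \<omega>)"
    using V by auto
  note traj = em_trajectory_adapted[OF fm \<delta> V', where x=x, folded T_def Y_def]
  have "adaptive_em f g \<delta> W x n \<omega> = adaptive_em f g \<delta> V x n \<omega>" if "\<omega> \<notin> N" for n \<omega>
    using N(2)[OF that] by (induction n) simp_all
  then have XY: "?X n \<omega> = Y n \<omega>" if "\<omega> \<notin> N" for n \<omega> using that by (simp add: em_state_def Y_def)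
  have stop: "{\<omega>\<in>space M. Y i \<omega> \<in> B \<and> T i \<omega> \<le> t} \<in> sets (F t)" if "0 \<le> t" "B \<in> sets borel" for i B t
  proof -
    have "Y i -` B \<inter> space (restrict_space (F t) {\<omega>\<in>space M. T i \<omega> \<le> t}) \<in> sets (restrict_space (F t) {\<omega>\<in>space M. T i \<omega> \<le> t})"
      by (rule measurable_sets[OF traj(7)[OF that(1)] that(2)])
    moreover have "Y i -` B \<inter> space (restrict_space (F t) {\<omega>\<in>space M. T i \<omega> \<le> t}) = {\<omega>\<in>space M. Y i \<omega> \<in> B \<and> T i \<omega> \<le> t}"
      using space_F[OF that(1)] by (auto simp: space_restrict_space)
    ultimately show ?thesis using traj(5)[OF that(1), of i] by (simp add: sets_restrict_space_iff)
  qed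
  have YM[measurable]: "Y i \<in> M \<rightarrow>\<^sub>M borel" for i
  proof (rule measurableI)
    fix B :: "(real ^ 'd) set" assume B: "B \<in> sets borel"
    have "{\<omega>\<in>space M. Y i \<omega> \<in> B \<and> T i \<omega> \<le> real k} \<in> sets M" for k :: nat
      by (rule subsetD[OF sets_F[of "real k"] stop[OF _ B]]) simp_all
    then have "(\<Union>k. {\<omega>\<in>space M. Y i \<omega> \<in> B \<and> T i \<omega> \<le> real k}) \<in> sets M" by blast
    moreover have "(\<Union>k. {\<omega>\<in>space M. Y i \<omega> \<in> B \<and> T i \<omega> \<le> real k}) = Y i -` B \<inter> space M"
      using real_arch_simple by auto
    ultimately show "Y i -` B \<inter> space M \<in> sets M" by simp
  qed simp
  have sets_M_modify: "S \<in> sets M" if "S' \<in> sets M" "S \<subseteq> space M" "S - N = S' - N" for S S'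
  proof -
    have "S \<inter> N \<in> sets M" using complete2[OF _ N(1), of "S \<inter> N"] by auto
    then have "(S' - N) \<union> (S \<inter> N) \<in> sets M" using that N(1) by auto
    moreover have "(S' - N) \<union> (S \<inter> N) = S" using that(3) by auto
    ultimately show ?thesis by simp
  qed
  have XM[measurable]: "?X i \<in> M \<rightarrow>\<^sub>M borel" for i
  proof (rule measurableI)
    fix B :: "(real ^ 'd) set" assume B: "B \<in> sets borel"
    show "?X i -` B \<inter> space M \<in> sets M"
      by (rule sets_M_modify[OF measurable_sets[OF YM[of i] B]]) (auto simp: XY)
  qed simp
  then show "?X n \<in> M \<rightarrow>\<^sub>M borel" .
  assume A: "A \<in> sets (natural_filtration M ?X n)" and B: "B \<in> sets borel"
  have T_mono: "T i \<omega> \<le> T j \<omega>" if "i \<le> j" for i j \<omega>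
    using traj(2) that by (rule lift_Suc_mono_le)
  let ?G = "\<Union>i\<in>{..n}. {?X i -` A \<inter> space M | A. A \<in> sets borel}"
  have "?G \<subseteq> Pow (space M)" by auto
  then have "A \<in> sigma_sets (space M) ?G" using A by (simp add: natural_filtration_def)
  then have A_stop: "A \<in> sets M \<and> (\<forall>t\<ge>0. A \<inter> {\<omega>\<in>space M. T n \<omega> \<le> t} \<in> sets (F t))"
  proof (induction rule: sigma_sets.induct)
    case (Basic A)
    then obtain i C where i: "i \<le> n" and C: "C \<in> sets borel" and A: "A = ?X i -` C \<inter> space M" by auto
    have "A \<inter> {\<omega>\<in>space M. T n \<omega> \<le> t} \<in> sets (F t)" if t: "0 \<le> t" for t
    proof (rule sets_F_modify[OF t N(1)])
      show "{\<omega>\<in>space M. Y i \<omega> \<in> C \<and> T i \<omega> \<le> t} \<inter> {\<omega>\<in>space M. T n \<omega> \<le> t} \<in> sets (F t)"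
        using stop[OF t C] traj(5)[OF t] by (rule sets.Int)
      show "A \<inter> {\<omega>\<in>space M. T n \<omega> \<le> t} - N = {\<omega>\<in>space M. Y i \<omega> \<in> C \<and> T i \<omega> \<le> t} \<inter> {\<omega>\<in>space M. T n \<omega> \<le> t} - N"
        unfolding A using XY T_mono[OF i] by (auto intro: order_trans)
    qed auto
    then show ?case using measurable_sets[OF XM[of i] C] unfolding A by blast
  next
    case Empty
    then show ?case by simp
  next
    case (Compl A)
    have "(space M - A) \<inter> {\<omega>\<in>space M. T n \<omega> \<le> t} = {\<omega>\<in>space M. T n \<omega> \<le> t} - A \<inter> {\<omega>\<in>space M. T n \<omega> \<le> t}" for t by auto
    then show ?case using Compl.IH traj(5)[of _ n] by auto
  next
    case (Union A)
    have "(\<Union>i. A i \<inter> {\<omega>\<in>space M. T n \<omega> \<le> t}) \<in> sets (F t)" if "0 \<le> t" for t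
      using Union.IH that by (intro sets.countable_UN) auto
    then have "(\<Union>i. A i) \<inter> {\<omega>\<in>space M. T n \<omega> \<le> t} \<in> sets (F t)" if "0 \<le> t" for t
      using that by (simp add: UN_simps)
    moreover have "(\<Union>i. A i) \<in> sets M" using Union.IH by blast
    ultimately show ?case by blast
  qed
  have ae: "AE \<omega> in M. \<omega> \<notin> N" using N(1) by (rule AE_not_in)
  have "emeasure M (A \<inter> (?X (Suc n) -` B \<inter> space M)) = emeasure M (A \<inter> (Y (Suc n) -` B \<inter> space M))"
  proof (rule emeasure_eq_AE)
    show "AE \<omega> in M. \<omega> \<in> A \<inter> (?X (Suc n) -` B \<inter> space M) \<longleftrightarrow> \<omega> \<in> A \<inter> (Y (Suc n) -` B \<inter> space M)"
      using ae by eventually_elim (auto simp: XY)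
    show "A \<inter> (?X (Suc n) -` B \<inter> space M) \<in> sets M" "A \<inter> (Y (Suc n) -` B \<inter> space M) \<in> sets M"
      using A_stop measurable_sets[OF XM B] measurable_sets[OF YM B] by blast+
  qed
  also have "\<dots> = (\<integral>\<^sup>+\<omega>. indicator A \<omega> * emeasure (em_transition f g \<delta> (Y n \<omega>)) B \<partial>M)"
    by (rule em_step_law[OF fm \<delta> N V traj(1) traj(5) traj(6) traj(7) _ _ YM YM traj(4) B]) (use A_stop in auto)
  also have "\<dots> = (\<integral>\<^sup>+\<omega>. indicator A \<omega> * emeasure (em_transition f g \<delta> (?X n \<omega>)) B \<partial>M)"
    by (rule nn_integral_cong_AE) (rule AE_mp[OF ae], simp add: XY)
  finally show "emeasure M (A \<inter> (?X (Suc n) -` B \<inter> space M)) =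
      (\<integral>\<^sup>+\<omega>. indicator A \<omega> * emeasure (em_transition f g \<delta> (?X n \<omega>)) B \<partial>M)" .
qed

lemma em_kernel_eq_power:
  fixes f :: "real ^ 'd \<Rightarrow> real ^ 'd" and g :: "real ^ 'd \<Rightarrow> real ^ 'm ^ 'd" and \<delta> :: "real ^ 'd \<Rightarrow> real"
  assumes fm: "f \<in> borel_measurable borel" "g \<in> borel_measurable borel" "\<delta> \<in> borel_measurable borel"
    and \<delta>: "\<And>y. 0 < \<delta> y"
  shows "em_kernel M f g \<delta> W n x = kernel_power borel (em_transition f g \<delta>) n x"
proof (induction n)
  case 0
  have "em_kernel M f g \<delta> W 0 x = distr M borel (\<lambda>_. x)"
    by (simp add: em_kernel_def em_state_def[abs_def])
  then show ?case by (simp add: distr_const)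
next
  case (Suc n)
  let ?X = "em_state f g \<delta> W x" and ?K = "em_transition f g \<delta>"
  note X = em_markov_property(1)[OF fm \<delta>, of x]
  note K = measurable_prob_algebraD[OF measurable_em_transition[OF fm]]
  have "em_kernel M f g \<delta> W (Suc n) x = em_kernel M f g \<delta> W n x \<bind> ?K"
  proof (rule measure_eqI)
    have "sets (em_kernel M f g \<delta> W n x \<bind> ?K) = sets borel"
      by (rule sets_bind) (auto simp: em_kernel_def sets_kernel[OF K])
    then show "sets (em_kernel M f g \<delta> W (Suc n) x) = sets (em_kernel M f g \<delta> W n x \<bind> ?K)"
      by (simp add: em_kernel_def)
    fix B assume "B \<in> sets (em_kernel M f g \<delta> W (Suc n) x)"
    then have B: "B \<in> sets borel" by (simp add: em_kernel_def)
    have top: "space M \<in> sets (natural_filtration M ?X n)"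
      using sets.top[of "natural_filtration M ?X n"] by (simp add: natural_filtration_def)
    have "emeasure (em_kernel M f g \<delta> W (Suc n) x) B = emeasure M (space M \<inter> (?X (Suc n) -` B \<inter> space M))"
      using B X by (simp add: em_kernel_def emeasure_distr Int_absorb1)
    also have "\<dots> = (\<integral>\<^sup>+\<omega>. emeasure (?K (?X n \<omega>)) B \<partial>M)"
      unfolding em_markov_property(2)[OF fm \<delta> top B] by (intro nn_integral_cong) simp
    also have "\<dots> = (\<integral>\<^sup>+y. emeasure (?K y) B \<partial>em_kernel M f g \<delta> W n x)"
      unfolding em_kernel_def using X measurable_emeasure_kernel[OF K B] by (subst nn_integral_distr) auto
    also have "\<dots> = emeasure (em_kernel M f g \<delta> W n x \<bind> ?K) B"
      using K B by (intro emeasure_bind[symmetric]) (auto simp: em_kernel_def)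
    finally show "emeasure (em_kernel M f g \<delta> W (Suc n) x) B = emeasure (em_kernel M f g \<delta> W n x \<bind> ?K) B" .
  qed
  then show ?case using Suc by simp
qed

lemma em_kernel_1:
  fixes f :: "real ^ 'd \<Rightarrow> real ^ 'd" and g :: "real ^ 'd \<Rightarrow> real ^ 'm ^ 'd" and \<delta> :: "real ^ 'd \<Rightarrow> real"
  assumes fm: "f \<in> borel_measurable borel" "g \<in> borel_measurable borel" "\<delta> \<in> borel_measurable borel"
    and \<delta>: "\<And>y. 0 < \<delta> y"
  shows "em_kernel M f g \<delta> W 1 = em_transition f g \<delta>"
proof
  fix x
  show "em_kernel M f g \<delta> W 1 x = em_transition f g \<delta> x"
    using measurable_prob_algebraD[OF measurable_em_transition[OF fm]]
    by (simp add: em_kernel_eq_power[OF fm \<delta>] bind_return[where N=borel])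
qed

theorem em_homogeneous_markov_chain:
  fixes f :: "real ^ 'd \<Rightarrow> real ^ 'd" and g :: "real ^ 'd \<Rightarrow> real ^ 'm ^ 'd" and \<delta> :: "real ^ 'd \<Rightarrow> real"
  assumes fm: "f \<in> borel_measurable borel" "g \<in> borel_measurable borel" "\<delta> \<in> borel_measurable borel"
    and \<delta>: "\<And>y. 0 < \<delta> y"
  shows "homogeneous_markov_chain M (em_state f g \<delta> W x) (em_kernel M f g \<delta> W 1)"
  unfolding homogeneous_markov_chain_def em_kernel_1[OF fm \<delta>]
proof (intro conjI allI ballI)
  let ?X = "em_state f g \<delta> W x" and ?K = "em_transition f g \<delta>"
  show K: "?K \<in> borel \<rightarrow>\<^sub>M prob_algebra borel" by (rule measurable_em_transition[OF fm])
  show X: "?X n \<in> M \<rightarrow>\<^sub>M borel" for n by (rule em_markov_property(1)[OF fm \<delta>])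
  fix n and B :: "(real ^ 'd) set" assume B: "B \<in> sets borel"
  let ?N = "natural_filtration M ?X n"
  let ?G = "\<Union>i\<in>{..n}. {?X i -` A \<inter> space M | A. A \<in> sets borel}"
  have G: "?G \<subseteq> Pow (space M)" by auto
  have spN: "space ?N = space M" and setsN: "sets ?N = sigma_sets (space M) ?G"
    using G by (simp_all add: natural_filtration_def)
  have sub: "subalgebra M ?N"
    unfolding subalgebra_def spN setsN using measurable_sets[OF X]
    by (auto intro!: sets.sigma_sets_subset)
  interpret finite_measure_subalgebra M ?N by unfold_locales (rule sub)
  have XN: "?X n \<in> ?N \<rightarrow>\<^sub>M borel"
  proof (rule measurableI)
    show "?X n -` C \<inter> space ?N \<in> sets ?N" if "C \<in> sets borel" for C
      unfolding spN setsN using that by (intro sigma_sets.Basic) auto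
  qed simp
  have prob_K: "prob_space (?K y)" for y using measurable_space[OF K, of y] by (simp add: space_prob_algebra)
  have Kmeas: "(\<lambda>y. measure (?K y) B) \<in> borel_measurable borel"
    using measurable_compose[OF measurable_prob_algebraD[OF K] measurable_measure_subprob_algebra[OF B]] .
  have gN: "(\<lambda>\<omega>. measure (?K (?X n \<omega>)) B) \<in> borel_measurable ?N"
    by (rule measurable_compose[OF XN Kmeas])
  have gM: "(\<lambda>\<omega>. measure (?K (?X n \<omega>)) B) \<in> borel_measurable M"
    by (rule measurable_compose[OF X Kmeas])
  have bnd: "measure (?K y) B \<le> 1" for y using prob_space.prob_le_1[OF prob_K] .
  have SM: "?X (Suc n) -` B \<inter> space M \<in> sets M" by (rule measurable_sets[OF X B])
  show "AE \<omega> in M. real_cond_exp M ?N (indicator (?X (Suc n) -` B \<inter> space M)) \<omega> = measure (?K (?X n \<omega>)) B"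
  proof (rule real_cond_exp_charact)
    show "integrable M (indicator (?X (Suc n) -` B \<inter> space M) :: 'w \<Rightarrow> real)"
      by (rule integrable_real_indicator[OF SM]) (simp add: less_top[symmetric])
    show int: "integrable M (\<lambda>\<omega>. measure (?K (?X n \<omega>)) B)"
      by (rule integrable_const_bound[where B=1]) (use gM bnd in auto)
    show "(\<lambda>\<omega>. measure (?K (?X n \<omega>)) B) \<in> borel_measurable ?N" by (rule gN)
    fix A assume A: "A \<in> sets ?N"
    then have AM[measurable]: "A \<in> sets M" using sub by (auto simp: subalgebra_def)
    have "ennreal (LINT \<omega>:A|M. measure (?K (?X n \<omega>)) B) = (\<integral>\<^sup>+\<omega>. ennreal (indicator A \<omega> * measure (?K (?X n \<omega>)) B) \<partial>M)"
      unfolding set_lebesgue_integral_def real_scaleR_def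
      by (rule nn_integral_eq_integral[symmetric])
        (use integrable_mult_indicator[OF AM int] in auto)
    also have "\<dots> = (\<integral>\<^sup>+\<omega>. indicator A \<omega> * emeasure (?K (?X n \<omega>)) B \<partial>M)"
      by (intro nn_integral_cong)
        (simp add: ennreal_mult' ennreal_indicator finite_measure.emeasure_eq_measure[OF prob_space.finite_measure[OF prob_K]])
    also have "\<dots> = ennreal (measure M (A \<inter> (?X (Suc n) -` B \<inter> space M)))"
      unfolding em_markov_property(2)[OF fm \<delta> A B, symmetric] by (simp add: emeasure_eq_measure)
    finally have "(LINT \<omega>:A|M. measure (?K (?X n \<omega>)) B) = measure M (A \<inter> (?X (Suc n) -` B \<inter> space M))"
      by (subst (asm) ennreal_inj) (auto simp: set_lebesgue_integral_def intro!: integral_nonneg_AE)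
    moreover have "(LINT \<omega>:A|M. indicator (?X (Suc n) -` B \<inter> space M) \<omega>) = measure M (A \<inter> (?X (Suc n) -` B \<inter> space M))"
      unfolding set_lebesgue_integral_def using SM AM
      by (simp add: indicator_inter_arith[symmetric] Int_absorb2)
    ultimately show "(LINT \<omega>:A|M. indicator (?X (Suc n) -` B \<inter> space M) \<omega>) = (LINT \<omega>:A|M. measure (?K (?X n \<omega>)) B)"
      by simp
  qed
qed

end

section \<open>Minorization and drift for the scheme\<close>

lemma loewner_lower_bound:
  fixes g :: "real ^ 'm ^ 'd"
  assumes "loewner_le (lam *\<^sub>R mat 1) (g ** transpose g)"
  shows "lam * (norm v)\<^sup>2 \<le> (norm (transpose g *v v))\<^sup>2"
proof -
  have "0 \<le> v \<bullet> ((g ** transpose g - lam *\<^sub>R mat 1) *v v)"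
    using assms by (simp add: loewner_le_def positive_semidefinite_def)
  also have "\<dots> = v \<bullet> (g *v (transpose g *v v)) - lam * (v \<bullet> v)"
  proof -
    have "(lam *\<^sub>R mat 1) *v v = lam *\<^sub>R v" by (simp add: scaleR_matrix_vector_assoc[symmetric])
    then show ?thesis
      by (simp only: matrix_vector_mult_diff_rdistrib matrix_vector_mul_assoc[symmetric] inner_diff_right inner_scaleR_right)
  qed
  also have "v \<bullet> (g *v (transpose g *v v)) = (transpose g *v v) \<bullet> (transpose g *v v)"
    by (simp add: dot_lmul_matrix[symmetric] transpose_matrix_vector)
  finally show ?thesis by (simp add: power2_norm_eq_inner)
qed

lemma em_noise_map:
  fixes g :: "real ^ 'm ^ 'd"
  assumes "h > 0"
  shows "linear (\<lambda>z. g *v (sqrt h *\<^sub>R z))"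
    and "adjoint (\<lambda>z. g *v (sqrt h *\<^sub>R z)) v = sqrt h *\<^sub>R (transpose g *v v)"
    and "norm (g *v (sqrt h *\<^sub>R z)) \<le> sqrt (h * (norm g)\<^sup>2) * norm z"
proof -
  show "linear (\<lambda>z. g *v (sqrt h *\<^sub>R z))"
    by (rule linearI) (simp_all add: scaleR_add_right matrix_vector_right_distrib matrix_vector_mult_scaleR)
  have "adjoint (\<lambda>z. g *v (sqrt h *\<^sub>R z)) = (\<lambda>v. sqrt h *\<^sub>R (transpose g *v v))"
    by (rule adjoint_unique)
      (simp add: matrix_vector_mult_scaleR inner_commute[of "g *v _"] dot_lmul_matrix[symmetric] transpose_matrix_vector inner_commute)
  then show "adjoint (\<lambda>z. g *v (sqrt h *\<^sub>R z)) v = sqrt h *\<^sub>R (transpose g *v v)" by simp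
  show "norm (g *v (sqrt h *\<^sub>R z)) \<le> sqrt (h * (norm g)\<^sup>2) * norm z"
    using norm_matrix_vector_le[of g "sqrt h *\<^sub>R z"] assms by (simp add: real_sqrt_mult ac_simps)
qed

lemma em_transition_null_iff:
  assumes \<delta>: "\<delta> x > 0" and lam: "lam > 0" and nondeg: "loewner_le (lam *\<^sub>R mat 1) (g x ** transpose (g x))"
    and A: "A \<in> sets borel"
  shows "emeasure (em_transition f g \<delta> x) A = 0 \<longleftrightarrow> emeasure lborel A = 0"
  unfolding em_transition_def
proof (rule gaussian_image_null_iff[OF em_noise_map(1)[OF \<delta>] _ _ A])
  show "0 < \<delta> x * lam" using \<delta> lam by simp
  show "\<delta> x * lam * (norm v)\<^sup>2 \<le> (norm (adjoint (\<lambda>z. g x *v (sqrt (\<delta> x) *\<^sub>R z)) v))\<^sup>2" for v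
    using mult_left_mono[OF loewner_lower_bound[OF nondeg, of v], of "\<delta> x"] \<delta>
    by (simp add: em_noise_map(2)[OF \<delta>] power_mult_distrib)
qed

text \<open>The growth conditions in the form in which \<open>h\<^sup>1\<^sup>-\<^sup>\<gamma>\<close> is the small parameter.\<close>

lemma step_size_scaling:
  fixes f :: "'a::real_normed_vector" and g :: "'b::real_normed_vector"
  assumes h: "0 < h" and f: "norm f * h powr \<gamma> \<le> s" and g: "(norm g)\<^sup>2 * h powr \<gamma> \<le> s\<^sup>2"
  shows "h * norm f \<le> s * h powr (1 - \<gamma>)" "h * (norm g)\<^sup>2 \<le> s\<^sup>2 * h powr (1 - \<gamma>)"
proof -
  have eq: "h = h powr \<gamma> * h powr (1 - \<gamma>)" using h by (simp add: powr_add[symmetric])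
  have "h * norm f = norm f * h powr \<gamma> * h powr (1 - \<gamma>)" by (subst eq) simp
  also have "\<dots> \<le> s * h powr (1 - \<gamma>)" using f by (rule mult_right_mono) simp
  finally show "h * norm f \<le> s * h powr (1 - \<gamma>)" .
  have "h * (norm g)\<^sup>2 = (norm g)\<^sup>2 * h powr \<gamma> * h powr (1 - \<gamma>)" by (subst eq) simp
  also have "\<dots> \<le> s\<^sup>2 * h powr (1 - \<gamma>)" using g by (rule mult_right_mono) simp
  finally show "h * (norm g)\<^sup>2 \<le> s\<^sup>2 * h powr (1 - \<gamma>)" .
qed

lemma em_transition_minorization:
  fixes f :: "real ^ 'd \<Rightarrow> real ^ 'd" and g :: "real ^ 'd \<Rightarrow> real ^ 'm ^ 'd" and \<delta> :: "real ^ 'd \<Rightarrow> real"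
  assumes \<delta>: "\<And>x. 0 < \<delta> x" "\<And>x. \<delta> x \<le> \<delta>max" and \<gamma>: "\<gamma> < 1"
    and f_growth: "\<And>x. norm (f x) * \<delta> x powr \<gamma> \<le> 1 + norm x"
    and g_growth: "\<And>x. (norm (g x))\<^sup>2 * \<delta> x powr \<gamma> \<le> (1 + norm x)\<^sup>2"
    and l: "l > 0" and p: "p \<ge> 0" and \<delta>_lower: "\<And>x. \<delta> x \<ge> l * (1 + (norm x)\<^sup>2) powr (- p / 2)"
    and lam: "lam > 0" and nondeg: "\<And>x. loewner_le (lam *\<^sub>R mat 1) (g x ** transpose (g x))"
    and R: "R \<ge> 0"
  obtains \<epsilon> r :: real where "\<epsilon> > 0" "r > 0"
    "\<And>x A. x \<in> cball 0 R \<Longrightarrow> A \<in> sets borel \<Longrightarrow>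
      ennreal \<epsilon> * emeasure (uniform_measure lborel (cball 0 r)) A \<le> emeasure (em_transition f g \<delta> x) A"
proof -
  define B where "B = \<delta>max powr (1 - \<gamma>)"
  define d0 where "d0 = l * (1 + R\<^sup>2) powr (- p / 2)"
  define r where "r = R + (1 + R) * B + 1"
  have B: "B \<ge> 0" by (simp add: B_def)
  have r: "r > 0" using R B by (simp add: r_def add_nonneg_pos)
  have "1 + R\<^sup>2 > 0" by (simp add: add_pos_nonneg)
  then have d0: "d0 > 0" unfolding d0_def using l by (intro mult_pos_pos) auto
  obtain \<epsilon> where \<epsilon>: "\<epsilon> > 0" and minor: "\<And>(L :: real ^ 'm \<Rightarrow> real ^ 'd) m A.
      linear L \<Longrightarrow> (\<And>v. (d0 * lam) * (norm v)\<^sup>2 \<le> (norm (adjoint L v))\<^sup>2) \<Longrightarrow> (\<And>z. norm (L z) \<le> ((1 + R) * sqrt B) * norm z) \<Longrightarrow>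
      norm m \<le> r \<Longrightarrow> A \<in> sets borel \<Longrightarrow> A \<subseteq> cball 0 r \<Longrightarrow>
      ennreal \<epsilon> * emeasure lborel A \<le> emeasure (distr std_gaussian borel (\<lambda>z. m + L z)) A"
    by (rule gaussian_image_minorization[of "d0 * lam" r "(1 + R) * sqrt B"])
      (use d0 lam r R B in \<open>auto simp: less_imp_le\<close>)
  define vol where "vol = measure lborel (cball (0 :: real ^ 'd) r)"
  have vol: "emeasure lborel (cball (0 :: real ^ 'd) r) = ennreal vol" "vol > 0"
    unfolding vol_def using emeasure_lborel_cball_finite[of "0 :: real ^ 'd" r] content_cball_pos[OF r]
    by (auto simp: emeasure_eq_ennreal_measure less_top)
  show ?thesis
  proof (rule that[of "\<epsilon> * vol" r])
    show "\<epsilon> * vol > 0" "r > 0" using \<epsilon> vol r by auto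
    fix x :: "real ^ 'd" and A :: "(real ^ 'd) set" assume x: "x \<in> cball 0 R" and A[measurable]: "A \<in> sets borel"
    have nx: "norm x \<le> R" using x by simp
    have sB: "\<delta> x powr (1 - \<gamma>) \<le> B" unfolding B_def using \<delta>[of x] \<gamma> by (intro powr_mono2) auto
    note scaled = step_size_scaling[OF \<delta>(1) f_growth g_growth, of x]
    have hf: "\<delta> x * norm (f x) \<le> (1 + R) * B"
      using scaled(1) mult_mono[of "1 + norm x" "1 + R" "\<delta> x powr (1 - \<gamma>)" B] nx sB R by simp
    have hg: "\<delta> x * (norm (g x))\<^sup>2 \<le> ((1 + R) * sqrt B)\<^sup>2"
      using scaled(2) mult_mono[of "(1 + norm x)\<^sup>2" "(1 + R)\<^sup>2" "\<delta> x powr (1 - \<gamma>)" B] nx sB R B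
      by (simp add: power_mult_distrib power_mono)
    have dx: "d0 \<le> \<delta> x"
    proof -
      have "(1 + R\<^sup>2) powr (- p / 2) \<le> (1 + (norm x)\<^sup>2) powr (- p / 2)"
        using nx p by (intro powr_mono2') (auto intro: power_mono add_pos_nonneg)
      then have "d0 \<le> l * (1 + (norm x)\<^sup>2) powr (- p / 2)" unfolding d0_def using l by (intro mult_left_mono) auto
      then show ?thesis using \<delta>_lower[of x] by linarith
    qed
    have "ennreal \<epsilon> * emeasure lborel (cball 0 r \<inter> A) \<le> emeasure (em_transition f g \<delta> x) (cball 0 r \<inter> A)"
      unfolding em_transition_def
    proof (rule minor)
      show "linear (\<lambda>z. g x *v (sqrt (\<delta> x) *\<^sub>R z))" by (rule em_noise_map[OF \<delta>(1)])
      show "d0 * lam * (norm v)\<^sup>2 \<le> (norm (adjoint (\<lambda>z. g x *v (sqrt (\<delta> x) *\<^sub>R z)) v))\<^sup>2" for v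
      proof -
        have "d0 * (lam * (norm v)\<^sup>2) \<le> \<delta> x * (norm (transpose (g x) *v v))\<^sup>2"
          using dx loewner_lower_bound[OF nondeg, of v x] less_imp_le[OF \<delta>(1), of x] lam by (intro mult_mono) auto
        then show ?thesis using less_imp_le[OF \<delta>(1), of x]
          by (simp add: em_noise_map(2)[OF \<delta>(1)] power_mult_distrib mult.assoc)
      qed
      show "norm (g x *v (sqrt (\<delta> x) *\<^sub>R z)) \<le> (1 + R) * sqrt B * norm z" for z
      proof -
        have "sqrt (\<delta> x * (norm (g x))\<^sup>2) \<le> (1 + R) * sqrt B"
          using hg R B by (intro real_le_lsqrt) auto
        then show ?thesis
          using em_noise_map(3)[OF \<delta>(1), of "g x" x z] mult_right_mono[of "sqrt (\<delta> x * (norm (g x))\<^sup>2)" "(1 + R) * sqrt B" "norm z"] by simp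
      qed
      show "norm (x + \<delta> x *\<^sub>R f x) \<le> r"
        using norm_triangle_ineq[of x "\<delta> x *\<^sub>R f x"] hf nx less_imp_le[OF \<delta>(1), of x] by (simp add: r_def)
    qed auto
    also have "\<dots> \<le> emeasure (em_transition f g \<delta> x) A"
      by (intro emeasure_mono) (auto simp: em_transition_def)
    finally have *: "ennreal \<epsilon> * emeasure lborel (cball 0 r \<inter> A) \<le> emeasure (em_transition f g \<delta> x) A" .
    have "ennreal (\<epsilon> * vol) * emeasure (uniform_measure lborel (cball 0 r)) A =
      ennreal \<epsilon> * (ennreal vol * (emeasure lborel (cball 0 r \<inter> A) / ennreal vol))"
      using \<epsilon> vol by (simp add: ennreal_mult mult.assoc)
    also have "ennreal vol * (emeasure lborel (cball 0 r \<inter> A) / ennreal vol) = emeasure lborel (cball 0 r \<inter> A)"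
      using vol mult_divide_eq_ennreal[of "ennreal vol" "emeasure lborel (cball 0 r \<inter> A)"]
      by (simp add: ennreal_times_divide mult.commute)
    finally show "ennreal (\<epsilon> * vol) * emeasure (uniform_measure lborel (cball 0 r)) A \<le> emeasure (em_transition f g \<delta> x) A"
      using * by simp
  qed
qed

text \<open>Far from the origin the leading term of \<open>one_step_moment_bound\<close> is at most \<open>- (3/2) q K6 \<delta> V\<close>, with
\<open>q = p / 2\<close>, and the error \<open>D \<delta>\<^sup>2\<^sup>-\<^sup>2\<^sup>\<gamma> V\<close> is at most \<open>(1/2) q K6 \<delta> V\<close>. The expected decrease is thus at
least \<open>q K6 \<delta> V\<close>, and \<open>\<delta> V \<ge> l\<close> by the lower bound on the step size.\<close>

lemma em_transition_drift:
  fixes f :: "real ^ 'd \<Rightarrow> real ^ 'd" and g :: "real ^ 'd \<Rightarrow> real ^ 'm ^ 'd" and \<delta> :: "real ^ 'd \<Rightarrow> real"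
  assumes p: "p \<ge> 2" and K: "K6 > 0" "K7 \<ge> 0"
    and dissipative: "\<And>x. x \<bullet> f x + (p - 1) / 2 * (norm (g x))\<^sup>2 \<le> - K6 * (norm x)\<^sup>2 + K7"
    and \<delta>: "\<And>x. 0 < \<delta> x" "\<And>x. \<delta> x \<le> \<delta>max" and \<delta>_lim: "(\<delta> \<longlongrightarrow> 0) at_infinity" and \<gamma>: "\<gamma> < 1 / 2"
    and f_growth: "\<And>x. norm (f x) * \<delta> x powr \<gamma> \<le> 1 + norm x"
    and g_growth: "\<And>x. (norm (g x))\<^sup>2 * \<delta> x powr \<gamma> \<le> (1 + norm x)\<^sup>2"
    and l: "l > 0" and \<delta>_lower: "\<And>x. \<delta> x \<ge> l * (1 + (norm x)\<^sup>2) powr (- p / 2)"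
  obtains c b R :: real where "c > 0" "b \<ge> 0" "R \<ge> 0"
    "\<And>x. (\<integral>\<^sup>+y. ennreal ((1 + (norm y)\<^sup>2) powr (p / 2)) \<partial>em_transition f g \<delta> x) + ennreal c \<le>
      ennreal ((1 + (norm x)\<^sup>2) powr (p / 2)) + ennreal b * indicator (cball 0 R) x"
proof -
  define q where "q = p / 2"
  define A where "A = \<delta>max powr (1 - \<gamma>)"
  have q: "q \<ge> 1" using p by (simp add: q_def)
  have A: "A \<ge> 0" by (simp add: A_def)
  have \<delta>max: "\<delta>max > 0" using \<delta>[of 0] by linarith
  obtain D where D: "D \<ge> 0" and step: "\<And>(x :: real ^ 'd) (f :: real ^ 'd) (g :: real ^ 'm ^ 'd) h a. 0 < h \<Longrightarrow> 0 \<le> a \<Longrightarrow> a \<le> A \<Longrightarrow>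
      h * norm f \<le> (1 + norm x) * a \<Longrightarrow> h * (norm g)\<^sup>2 \<le> (1 + norm x)\<^sup>2 * a \<Longrightarrow>
      (\<integral>\<^sup>+z. ennreal ((1 + (norm (x + h *\<^sub>R f + g *v (sqrt h *\<^sub>R z)))\<^sup>2) powr q) \<partial>std_gaussian) \<le>
        ennreal ((1 + (norm x)\<^sup>2) powr q *
          (1 + 2 * q * h / (1 + (norm x)\<^sup>2) * (x \<bullet> f + (2 * q - 1) / 2 * (norm g)\<^sup>2) + D * a\<^sup>2))"
    by (rule one_step_moment_bound[OF q A, where 'd='d and 'm='m]) blast
  define V where "V x = (1 + (norm x)\<^sup>2) powr q" for x :: "real ^ 'd"
  define E where "E x = 2 * q * \<delta> x / (1 + (norm x)\<^sup>2) * (- K6 * (norm x)\<^sup>2 + K7) + D * (\<delta> x powr (1 - \<gamma>))\<^sup>2" for x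
  have sA: "\<delta> x powr (1 - \<gamma>) \<le> A" for x unfolding A_def using \<delta>[of x] \<gamma> by (intro powr_mono2) auto
  have PV: "(\<integral>\<^sup>+y. ennreal (V y) \<partial>em_transition f g \<delta> x) \<le> ennreal (V x * (1 + E x))" for x
  proof -
    have "(\<integral>\<^sup>+y. ennreal (V y) \<partial>em_transition f g \<delta> x) =
       (\<integral>\<^sup>+z. ennreal ((1 + (norm (x + \<delta> x *\<^sub>R f x + g x *v (sqrt (\<delta> x) *\<^sub>R z)))\<^sup>2) powr q) \<partial>std_gaussian)"
      unfolding em_transition_def V_def by (subst nn_integral_distr) measurable
    also have "\<dots> \<le> ennreal (V x * (1 + 2 * q * \<delta> x / (1 + (norm x)\<^sup>2) * (x \<bullet> f x + (2 * q - 1) / 2 * (norm (g x))\<^sup>2) + D * (\<delta> x powr (1 - \<gamma>))\<^sup>2))"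
      unfolding V_def by (rule step[OF \<delta>(1) _ sA step_size_scaling[OF \<delta>(1) f_growth g_growth]]) simp
    also have "\<dots> \<le> ennreal (V x * (1 + E x))"
    proof (intro ennreal_leI mult_left_mono)
      have "2 * q * \<delta> x / (1 + (norm x)\<^sup>2) * (x \<bullet> f x + (2 * q - 1) / 2 * (norm (g x))\<^sup>2) \<le>
          2 * q * \<delta> x / (1 + (norm x)\<^sup>2) * (- K6 * (norm x)\<^sup>2 + K7)"
        using dissipative[of x] q less_imp_le[OF \<delta>(1), of x] by (intro mult_left_mono) (auto simp: q_def)
      then show "1 + 2 * q * \<delta> x / (1 + (norm x)\<^sup>2) * (x \<bullet> f x + (2 * q - 1) / 2 * (norm (g x))\<^sup>2) + D * (\<delta> x powr (1 - \<gamma>))\<^sup>2 \<le> 1 + E x"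
        by (simp add: E_def)
    qed (simp add: V_def)
    finally show ?thesis .
  qed
  \<comment> \<open>Below \<open>\<eta>\<close> the step size makes the error term at most a quarter of the leading term.\<close>
  define \<eta> where "\<eta> = (q * K6 / (2 * (D + 1))) powr (1 / (1 - 2 * \<gamma>))"
  have qK: "q * K6 / (2 * (D + 1)) > 0" using q K D by simp
  have \<eta>: "\<eta> > 0" using qK D q K by (simp add: \<eta>_def)
  have "\<forall>\<^sub>F x in at_infinity. \<delta> x < \<eta>" using order_tendstoD(2)[OF \<delta>_lim \<eta>] .
  then obtain R1 where R1: "\<And>x. norm x \<ge> R1 \<Longrightarrow> \<delta> x < \<eta>" by (auto simp: eventually_at_infinity)
  define R where "R = max R1 (1 + 4 * (K6 + K7) / K6)"
  have R: "R \<ge> 1" using K by (simp add: R_def le_max_iff_disj)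
  \<comment> \<open>The cap at 1 keeps \<open>c \<le> V\<close>, so that the bound survives the truncation at 0 that is
    implicit in the passage to extended nonnegative reals.\<close>
  define c where "c = min 1 (q * K6 * l)"
  define b where "b = (1 + R\<^sup>2) powr q * (1 + 2 * q * \<delta>max * K7 + D * A\<^sup>2) + c"
  have c: "c > 0" using q K l by (simp add: c_def)
  have far: "V x * (1 + E x) + c \<le> V x" if x: "norm x > R" for x
  proof -
    define u where "u = 1 + (norm x)\<^sup>2"
    have u: "u > 0" by (simp add: u_def add_pos_nonneg)
    have "\<delta> x powr (1 - 2 * \<gamma>) \<le> \<eta> powr (1 - 2 * \<gamma>)"
      using R1[of x] x \<gamma> less_imp_le[OF \<delta>(1), of x] by (intro powr_mono2) (auto simp: R_def)
    also have "\<dots> = q * K6 / (2 * (D + 1))"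
    proof -
      have "1 / (1 - 2 * \<gamma>) * (1 - 2 * \<gamma>) = 1" using \<gamma> by simp
      then show ?thesis unfolding \<eta>_def powr_powr using powr_one[OF less_imp_le[OF qK]] by (simp only:)
    qed
    finally have small: "D * \<delta> x powr (1 - 2 * \<gamma>) \<le> q * K6 / 2"
    proof -
      assume *: "\<delta> x powr (1 - 2 * \<gamma>) \<le> q * K6 / (2 * (D + 1))"
      have "D * \<delta> x powr (1 - 2 * \<gamma>) \<le> (D + 1) * (q * K6 / (2 * (D + 1)))"
        using * D by (intro mult_mono) auto
      moreover have "(D + 1) * (q * K6 / (2 * (D + 1))) = q * K6 / 2" using D by (simp add: field_simps)
      ultimately show ?thesis by linarith
    qed
    have sq: "(\<delta> x powr (1 - \<gamma>))\<^sup>2 = \<delta> x * \<delta> x powr (1 - 2 * \<gamma>)"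
    proof -
      have "(\<delta> x powr (1 - \<gamma>))\<^sup>2 = \<delta> x powr (1 + (1 - 2 * \<gamma>))"
        by (simp add: power2_eq_square powr_add[symmetric])
      also have "\<dots> = \<delta> x powr 1 * \<delta> x powr (1 - 2 * \<gamma>)" by (rule powr_add)
      finally show ?thesis using \<delta>(1)[of x] by simp
    qed
    have ratio: "(- K6 * (norm x)\<^sup>2 + K7) / u \<le> - (3 / 4) * K6"
    proof -
      have "4 * (K6 + K7) / K6 \<le> norm x" using x by (simp add: R_def)
      also have "norm x \<le> (norm x)\<^sup>2" using x R mult_left_mono[of 1 "norm x" "norm x"] by (simp add: power2_eq_square)
      finally have "4 * (K6 + K7) \<le> K6 * (norm x)\<^sup>2" using K by (simp add: divide_le_eq ac_simps)
      then have "- K6 * (norm x)\<^sup>2 + K7 \<le> - (3 / 4) * K6 * u" using K by (simp add: u_def distrib_left)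
      then show ?thesis using u by (simp add: divide_le_eq)
    qed
    have "E x = 2 * q * \<delta> x * ((- K6 * (norm x)\<^sup>2 + K7) / u) + \<delta> x * (D * \<delta> x powr (1 - 2 * \<gamma>))"
      unfolding E_def sq u_def by (simp add: mult.left_commute)
    also have "\<dots> \<le> 2 * q * \<delta> x * (- (3 / 4) * K6) + \<delta> x * (q * K6 / 2)"
      using ratio small q less_imp_le[OF \<delta>(1), of x] by (intro add_mono mult_left_mono) auto
    also have "\<dots> = - (q * K6 * \<delta> x)" by simp
    finally have "V x * (1 + E x) \<le> V x * (1 - q * K6 * \<delta> x)" by (intro mult_left_mono) (auto simp: V_def)
    moreover have "c \<le> V x * (q * K6 * \<delta> x)"
    proof -
      have "V x * (l * u powr (- q)) = l" using u by (simp add: V_def u_def[symmetric] powr_minus)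
      moreover have "V x * (l * u powr (- q)) \<le> V x * \<delta> x"
        using mult_left_mono[OF \<delta>_lower[of x], of "V x"] by (simp add: V_def q_def u_def)
      ultimately have "l \<le> V x * \<delta> x" by linarith
      then have "q * K6 * l \<le> q * K6 * (V x * \<delta> x)" using q K by (intro mult_left_mono) auto
      moreover have "c \<le> q * K6 * l" by (simp add: c_def)
      ultimately show ?thesis by (simp add: ac_simps)
    qed
    ultimately show ?thesis by (simp add: right_diff_distrib)
  qed
  have near: "V x * (1 + E x) + c \<le> b" if x: "norm x \<le> R" for x
  proof -
    have u1: "1 + (norm x)\<^sup>2 \<ge> 1" by simp
    have "2 * q * \<delta> x / (1 + (norm x)\<^sup>2) * (- K6 * (norm x)\<^sup>2 + K7) \<le> 2 * q * \<delta> x / (1 + (norm x)\<^sup>2) * K7"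
      using q K less_imp_le[OF \<delta>(1), of x] u1 by (intro mult_left_mono divide_nonneg_nonneg mult_nonneg_nonneg) auto
    also have "\<dots> \<le> 2 * q * \<delta>max * K7"
    proof (rule mult_right_mono)
      have "2 * q * \<delta> x / (1 + (norm x)\<^sup>2) \<le> 2 * q * \<delta> x / 1"
        using u1 q less_imp_le[OF \<delta>(1), of x] by (intro divide_left_mono) (auto intro: add_pos_nonneg)
      also have "\<dots> \<le> 2 * q * \<delta>max" using \<delta>(2)[of x] q by simp
      finally show "2 * q * \<delta> x / (1 + (norm x)\<^sup>2) \<le> 2 * q * \<delta>max" .
    qed (use K in simp)
    finally have "1 + E x \<le> 1 + 2 * q * \<delta>max * K7 + D * A\<^sup>2"
      unfolding E_def using D mult_left_mono[OF power_mono[OF sA[of x], of 2], of D] by simp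
    moreover have "V x \<le> (1 + R\<^sup>2) powr q"
      unfolding V_def using x q by (intro powr_mono2 add_left_mono power_mono) auto
    moreover have "0 \<le> 1 + 2 * q * \<delta>max * K7 + D * A\<^sup>2" using q K D \<delta>max by (intro add_nonneg_nonneg mult_nonneg_nonneg) auto
    moreover have "V x \<ge> 0" by (simp add: V_def)
    ultimately have "V x * (1 + E x) \<le> (1 + R\<^sup>2) powr q * (1 + 2 * q * \<delta>max * K7 + D * A\<^sup>2)"
      by (meson mult_left_mono mult_right_mono order_trans)
    then show ?thesis by (simp add: b_def)
  qed
  show ?thesis
  proof (rule that[of c b R])
    show "b \<ge> 0" unfolding b_def using q K D \<delta>max c by (intro add_nonneg_nonneg mult_nonneg_nonneg) auto
    fix x :: "real ^ 'd"
    have V0: "V x \<ge> 0" by (simp add: V_def)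
    have "(\<integral>\<^sup>+y. ennreal (V y) \<partial>em_transition f g \<delta> x) + ennreal c \<le> ennreal (max 0 (V x * (1 + E x)) + c)"
      using PV[of x] c by (auto simp: ennreal_plus max_def ennreal_neg intro!: add_right_mono split: if_splits)
    also have "\<dots> \<le> ennreal (V x) + ennreal b * indicator (cball 0 R) x"
    proof (cases "norm x \<le> R")
      case True
      have "max 0 (V x * (1 + E x)) + c \<le> b"
      proof -
        have "c \<le> b" unfolding b_def using q K D \<delta>max c by (simp add: mult_nonneg_nonneg)
        then show ?thesis using near[OF True] by (simp add: max_def)
      qed
      then have "ennreal (max 0 (V x * (1 + E x)) + c) \<le> 0 + ennreal b" by (simp add: ennreal_leI)
      also have "\<dots> \<le> ennreal (V x) + ennreal b * indicator (cball 0 R) x" using True by (intro add_mono) auto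
      finally show ?thesis .
    next
      case False
      have "1 \<le> V x" unfolding V_def using q by (intro ge_one_powr_ge_zero) auto
      moreover have "c \<le> 1" by (simp add: c_def)
      ultimately have "c \<le> V x" by linarith
      then have "ennreal (max 0 (V x * (1 + E x)) + c) \<le> ennreal (V x)"
        using far[of x] False by (intro ennreal_leI) (auto simp: max_def)
      then show ?thesis using False by simp
    qed
    finally show "(\<integral>\<^sup>+y. ennreal ((1 + (norm y)\<^sup>2) powr (p / 2)) \<partial>em_transition f g \<delta> x) + ennreal c \<le>
      ennreal ((1 + (norm x)\<^sup>2) powr (p / 2)) + ennreal b * indicator (cball 0 R) x"
      by (simp add: V_def q_def)
  qed (use c R in auto)
qed

section \<open>Ergodicity of the scheme\<close>

lemma continuous_if_lipschitz_on_balls: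
  fixes f :: "'a::real_normed_vector \<Rightarrow> 'b::real_normed_vector"
  assumes "\<And>R. R > 0 \<Longrightarrow> \<exists>C>0. \<forall>x y. max (norm x) (norm y) \<le> R \<longrightarrow> norm (f x - f y) \<le> C * norm (x - y)"
  shows "continuous_on UNIV f"
proof -
  have "isCont f x" for x
  proof -
    obtain C where C: "C > 0" "\<And>u v. max (norm u) (norm v) \<le> norm x + 1 \<Longrightarrow> norm (f u - f v) \<le> C * norm (u - v)"
      using assms[of "norm x + 1"] by (auto simp: add_nonneg_pos)
    have "C-lipschitz_on (ball 0 (norm x + 1)) f"
      by (rule lipschitz_onI) (use C in \<open>auto simp: dist_norm\<close>)
    then have "continuous_on (ball 0 (norm x + 1)) f" by (rule lipschitz_on_continuous_on)
    then show ?thesis by (simp add: continuous_on_eq_continuous_at)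
  qed
  then show ?thesis by (simp add: continuous_on_eq_continuous_at)
qed

lemma tv_dist_le:
  assumes "\<And>A. A \<in> sets borel \<Longrightarrow> \<bar>measure \<mu> A - measure \<nu> A\<bar> \<le> e"
  shows "0 \<le> tv_dist \<mu> \<nu>" "tv_dist \<mu> \<nu> \<le> e"
proof -
  have "bdd_above ((\<lambda>A. \<bar>measure \<mu> A - measure \<nu> A\<bar>) ` sets borel)" using assms by (auto intro!: bdd_aboveI2)
  then have "\<bar>measure \<mu> {} - measure \<nu> {}\<bar> \<le> tv_dist \<mu> \<nu>"
    unfolding tv_dist_def by (intro cSUP_upper) auto
  then show "0 \<le> tv_dist \<mu> \<nu>" by simp
  show "tv_dist \<mu> \<nu> \<le> e" unfolding tv_dist_def by (intro cSUP_least assms) auto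
qed

text \<open>In a cycle of length at least 2 some member \<open>D i\<close> has positive Lebesgue measure; from a point of \<open>D i\<close> the
chain moves to the next member with probability 1, although it should hit \<open>D i\<close> with positive probability.\<close>

lemma period_1_if_charges_positive_sets:
  fixes P :: "nat \<Rightarrow> 'a::euclidean_space \<Rightarrow> 'a measure"
  assumes pos: "\<And>x A. A \<in> sets borel \<Longrightarrow> emeasure lborel A > 0 \<Longrightarrow> emeasure (P 1 x) A > 0"
    and sets: "\<And>x. sets (P 1 x) = sets borel" and prob: "\<And>x. prob_space (P 1 x)"
  shows "chain_period lborel P 1"
  unfolding chain_period_def
proof (intro conjI allI impI)
  have "chain_cycle lborel P 1 (\<lambda>_. UNIV)"
    using prob_space.emeasure_space_1[OF prob] sets_eq_imp_space_eq[OF sets]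
    by (auto simp: chain_cycle_def disjoint_family_on_def)
  then show "\<exists>D. chain_cycle lborel P 1 D" by (rule exI[of _ "\<lambda>_. UNIV"])
  fix j D assume cyc: "chain_cycle lborel P j D"
  show "j \<le> 1"
  proof (rule ccontr)
    assume "\<not> j \<le> 1"
    then have j: "j \<ge> 2" by simp
    have Dm[measurable]: "\<And>i. i < j \<Longrightarrow> D i \<in> sets borel" and disj: "disjoint_family_on D {..<j}"
      and step: "\<And>i x. i < j \<Longrightarrow> x \<in> D i \<Longrightarrow> emeasure (P 1 x) (D (Suc i mod j)) = 1"
      and null: "emeasure lborel (- (\<Union>i<j. D i)) = 0"
      using cyc by (auto simp: chain_cycle_def)
    obtain i where i: "i < j" "emeasure lborel (D i) > 0"
    proof -
      have "\<exists>i<j. emeasure lborel (D i) \<noteq> 0"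
      proof (rule ccontr)
        assume "\<not> (\<exists>i<j. emeasure lborel (D i) \<noteq> 0)"
        then have "(\<Union>i<j. D i) \<in> null_sets lborel" using Dm by (intro null_sets.finite_UN) (auto simp: null_sets_def)
        moreover have "- (\<Union>i<j. D i) \<in> null_sets lborel" using null Dm by (auto simp: null_sets_def)
        ultimately have "(\<Union>i<j. D i) \<union> - (\<Union>i<j. D i) \<in> null_sets lborel" by (rule null_sets.Un)
        moreover have "(\<Union>i<j. D i) \<union> - (\<Union>i<j. D i) = UNIV" by auto
        ultimately have "emeasure lborel (UNIV :: 'a set) = 0" by (metis null_setsD1)
        then show False by simp
      qed
      then show ?thesis using that by (auto simp: zero_less_iff_neq_zero)
    qed
    then obtain x where x: "x \<in> D i" by (metis emeasure_empty less_irrefl ex_in_conv)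
    let ?k = "Suc i mod j"
    have k: "?k < j" "?k \<noteq> i"
    proof -
      show "?k < j" using j by simp
      show "?k \<noteq> i"
      proof (cases "Suc i = j")
        case True then show ?thesis using j by auto
      next
        case False then show ?thesis using i(1) by simp
      qed
    qed
    have "D i \<inter> D ?k = {}" using disj i(1) k by (auto simp: disjoint_family_on_def)
    then have "emeasure (P 1 x) (D i) + emeasure (P 1 x) (D ?k) = emeasure (P 1 x) (D i \<union> D ?k)"
      using Dm[OF i(1)] Dm[OF k(1)] sets[of x] by (intro plus_emeasure) auto
    also have "\<dots> \<le> 1"
      using prob_space.emeasure_le_1[OF prob] by simp
    finally have "1 + emeasure (P 1 x) (D i) \<le> 1 + 0" using step[OF i(1) x] by (simp add: add.commute)
    then have "emeasure (P 1 x) (D i) = 0" by (simp only: ennreal_add_left_cancel_le) auto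
    then show False using pos[OF Dm[OF i(1)] i(2), of x] by simp
  qed
qed

theorem proposition8p7:
  fixes M :: "'w measure" and F :: "real \<Rightarrow> 'w measure" and W :: "real \<Rightarrow> 'w \<Rightarrow> real ^ 'm"
    and f :: "real ^ 'd \<Rightarrow> real ^ 'd" and g :: "real ^ 'd \<Rightarrow> real ^ 'm ^ 'd"
    and \<delta> :: "real ^ 'd \<Rightarrow> real"
    and p K6 K7 \<delta>max \<gamma> l lam :: real
  assumes bm: "brownian_motion M F W"
    and local_lipschitz: "\<forall>R>0. \<exists>C>0. \<forall>x y. max (norm x) (norm y) \<le> R \<longrightarrow>
          norm (f x - f y) + norm (g x - g y) \<le> C * norm (x - y)"
    and constants: "p \<ge> 2" "K6 > 0" "K7 \<ge> 0"
    and dissipative: "\<forall>x. x \<bullet> f x + (p - 1) / 2 * (norm (g x))\<^sup>2 \<le> - K6 * (norm x)\<^sup>2 + K7"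
    and \<delta>max_pos: "\<delta>max > 0"
    and \<delta>_range: "\<forall>x. 0 < \<delta> x \<and> \<delta> x \<le> \<delta>max"
    and \<delta>_cont: "continuous_on UNIV \<delta>"
    and \<delta>_lim: "(\<delta> \<longlongrightarrow> 0) at_infinity"
    and \<gamma>_range: "0 < \<gamma>" "\<gamma> \<le> 1 / 3"
    and f_growth: "\<forall>x. norm (f x) * \<delta> x powr \<gamma> \<le> 1 + norm x"
    and g_growth: "\<forall>x. (norm (g x))\<^sup>2 * \<delta> x powr \<gamma> \<le> (1 + norm x)\<^sup>2"
    and l_pos: "l > 0"
    and \<delta>_lower: "\<forall>x. \<delta> x \<ge> l * (1 + (norm x)\<^sup>2) powr (- p / 2)"
    and lam_pos: "lam > 0"
    and nondegenerate: "\<forall>x. loewner_le (lam *\<^sub>R mat 1) (g x ** transpose (g x))"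
  shows "(\<forall>x0. homogeneous_markov_chain M (em_state f g \<delta> W x0) (em_kernel M f g \<delta> W 1)) \<and>
         irreducible_chain lborel (em_kernel M f g \<delta> W) \<and>
         aperiodic_chain (em_kernel M f g \<delta> W) \<and>
         positive_recurrent_chain (em_kernel M f g \<delta> W) \<and>
         (\<exists>\<mu>. invariant_probability (em_kernel M f g \<delta> W) \<mu> \<and>
              (\<forall>\<nu>. invariant_probability (em_kernel M f g \<delta> W) \<nu> \<longrightarrow> \<nu> = \<mu>) \<and>
              (\<forall>x0. (\<lambda>n. tv_dist (em_kernel M f g \<delta> W n x0) \<mu>) \<longlonglongrightarrow> 0))"
proof -
  interpret brownian_motion M F W by (rule bm)
  let ?P = "em_kernel M f g \<delta> W" and ?K = "em_transition f g \<delta>"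
  have fm: "f \<in> borel_measurable borel" "g \<in> borel_measurable borel" "\<delta> \<in> borel_measurable borel"
  proof -
    have "continuous_on UNIV f"
      by (rule continuous_if_lipschitz_on_balls)
        (use local_lipschitz in \<open>meson add_increasing2 norm_ge_zero order_trans le_add_same_cancel1\<close>)
    then show "f \<in> borel_measurable borel" by (rule borel_measurable_continuous_onI)
    have "continuous_on UNIV g"
      by (rule continuous_if_lipschitz_on_balls)
        (use local_lipschitz in \<open>meson add_increasing2 norm_ge_zero order_trans le_add_same_cancel2\<close>)
    then show "g \<in> borel_measurable borel" by (rule borel_measurable_continuous_onI)
    show "\<delta> \<in> borel_measurable borel" using \<delta>_cont by (rule borel_measurable_continuous_onI)
  qed
  have \<delta>: "\<And>y. 0 < \<delta> y" "\<And>y. \<delta> y \<le> \<delta>max" using \<delta>_range by auto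
  have K: "?K \<in> borel \<rightarrow>\<^sub>M prob_algebra borel" by (rule measurable_em_transition[OF fm])
  have Kx: "prob_space (?K x)" "sets (?K x) = sets borel" for x
    using measurable_space[OF K, of x] by (simp_all add: space_prob_algebra)
  have P: "?P n x = kernel_power borel ?K n x" for n x by (rule em_kernel_eq_power[OF fm \<delta>(1)])
  have P1: "?P 1 = ?K" by (rule em_kernel_1[OF fm \<delta>(1)])
  have null_iff: "emeasure (?K x) A = 0 \<longleftrightarrow> emeasure lborel A = 0" if "A \<in> sets borel" for x A
    by (rule em_transition_null_iff[where f=f and g=g and \<delta>=\<delta>, OF \<delta>(1) lam_pos nondegenerate[rule_format] that])

  obtain c b R :: real where c: "c > 0" and b: "b \<ge> 0" and R: "R \<ge> 0" and drift:
    "\<And>x. (\<integral>\<^sup>+y. ennreal ((1 + (norm y)\<^sup>2) powr (p / 2)) \<partial>?K x) + ennreal c \<le>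
      ennreal ((1 + (norm x)\<^sup>2) powr (p / 2)) + ennreal b * indicator (cball 0 R) x"
    by (rule em_transition_drift[of p K6 K7 f g \<delta> \<delta>max \<gamma> l])
      (use constants dissipative \<delta> \<delta>_lim \<gamma>_range f_growth g_growth l_pos \<delta>_lower in auto)
  obtain \<epsilon> r :: real where \<epsilon>: "\<epsilon> > 0" and r: "r > 0" and minor:
    "\<And>x A. x \<in> cball 0 R \<Longrightarrow> A \<in> sets borel \<Longrightarrow>
      ennreal \<epsilon> * emeasure (uniform_measure lborel (cball 0 r)) A \<le> emeasure (?K x) A"
    by (rule em_transition_minorization[where f=f and g=g and \<delta>=\<delta> and \<delta>max=\<delta>max and \<gamma>=\<gamma>
        and l=l and p=p and lam=lam and R=R])
      (use \<delta> \<gamma>_range f_growth g_growth l_pos constants \<delta>_lower lam_pos nondegenerate R in auto)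
  define \<nu> where "\<nu> = uniform_measure lborel (cball (0 :: real ^ 'd) r)"
  have \<nu>: "prob_space \<nu>" "sets \<nu> = sets borel"
  proof -
    have "emeasure lborel (cball (0 :: real ^ 'd) r) = ennreal (measure lborel (cball (0 :: real ^ 'd) r))"
      using emeasure_lborel_cball_finite[of "0 :: real ^ 'd" r] by (simp add: emeasure_eq_ennreal_measure)
    then show "prob_space \<nu>" unfolding \<nu>_def
      using content_cball_pos[OF r, of "0 :: real ^ 'd"] by (intro prob_space_uniform_measure) auto
  qed (simp add: \<nu>_def)
  interpret \<nu>: prob_space \<nu> by (rule \<nu>(1))
  have minor': "\<And>x A. x \<in> cball 0 R \<Longrightarrow> A \<in> sets borel \<Longrightarrow> ennreal \<epsilon> * emeasure \<nu> A \<le> emeasure (?K x) A"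
    unfolding \<nu>_def by (rule minor)
  have \<epsilon>': "0 < ennreal \<epsilon>" "ennreal \<epsilon> < \<infinity>" using \<epsilon> by auto

  \<comment> \<open>Dividing by \<open>c\<close> normalizes the drift to 1.\<close>
  define V :: "real ^ 'd \<Rightarrow> ennreal" where "V x = ennreal (1 / c) * ennreal ((1 + (norm x)\<^sup>2) powr (p / 2))" for x
  have V_meas: "V \<in> borel_measurable borel" unfolding V_def by measurable
  obtain \<pi> where \<pi>: "prob_space \<pi>" "sets \<pi> = sets borel"
      and inv: "\<And>A. A \<in> sets borel \<Longrightarrow> emeasure \<pi> A = (\<integral>\<^sup>+x. emeasure (?K x) A \<partial>\<pi>)"
      and \<pi>C: "emeasure \<pi> (cball 0 R) > 0"
  proof (rule invariant_probability_from_drift[OF K \<nu> _ \<epsilon>', where C="cball 0 R" and b="ennreal (b / c)" and V=V])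
    show "cball 0 R \<in> sets borel" "ennreal (b / c) < \<infinity>" by auto
    show "V \<in> borel_measurable borel" by (rule V_meas)
    show "(\<integral>\<^sup>+x. V x \<partial>\<nu>) < \<infinity>"
    proof -
      have "AE x in \<nu>. V x \<le> ennreal (1 / c) * ennreal ((1 + r\<^sup>2) powr (p / 2))"
        unfolding \<nu>_def
      proof (rule AE_uniform_measureI)
        show "AE x in lborel. x \<in> cball 0 r \<longrightarrow> V x \<le> ennreal (1 / c) * ennreal ((1 + r\<^sup>2) powr (p / 2))"
          unfolding V_def using constants
          by (intro AE_I2 impI mult_left_mono ennreal_leI powr_mono2 add_left_mono power_mono) auto
      qed simp
      then have "(\<integral>\<^sup>+x. V x \<partial>\<nu>) \<le> (\<integral>\<^sup>+x. ennreal (1 / c) * ennreal ((1 + r\<^sup>2) powr (p / 2)) \<partial>\<nu>)"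
        by (rule nn_integral_mono_AE)
      also have "\<dots> < \<infinity>" by (simp add: \<nu>.emeasure_space_1 ennreal_mult_less_top)
      finally show ?thesis .
    qed
    fix x :: "real ^ 'd"
    have eq: "(\<integral>\<^sup>+y. V y \<partial>?K x) = ennreal (1 / c) * (\<integral>\<^sup>+y. ennreal ((1 + (norm y)\<^sup>2) powr (p / 2)) \<partial>?K x)"
      unfolding V_def by (rule nn_integral_cmult) (simp add: Kx cong: measurable_cong_sets)
    have one: "ennreal (1 / c) * ennreal c = 1" using c by (simp add: ennreal_mult[symmetric])
    have "(\<integral>\<^sup>+y. V y \<partial>?K x) + 1 = ennreal (1 / c) * ((\<integral>\<^sup>+y. ennreal ((1 + (norm y)\<^sup>2) powr (p / 2)) \<partial>?K x) + ennreal c)"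
      unfolding eq one[symmetric] by (simp add: distrib_left)
    also have "\<dots> \<le> ennreal (1 / c) * (ennreal ((1 + (norm x)\<^sup>2) powr (p / 2)) + ennreal b * indicator (cball 0 R) x)"
      using drift[of x] by (rule mult_left_mono) simp
    also have "\<dots> = V x + ennreal (1 / c) * ennreal b * indicator (cball 0 R) x"
      by (simp add: V_def distrib_left mult.assoc)
    also have "ennreal (1 / c) * ennreal b = ennreal (b / c)" using b c by (simp add: ennreal_mult[symmetric])
    finally show "(\<integral>\<^sup>+y. V y \<partial>?K x) + 1 \<le> V x + ennreal (b / c) * indicator (cball 0 R) x" .
  qed (use minor' in auto)
  interpret \<pi>: prob_space \<pi> by (rule \<pi>(1))

  have conv: "\<exists>e. e \<longlonglongrightarrow> 0 \<and> (\<forall>n. \<forall>A\<in>sets borel. \<bar>measure (?P n x) A - measure \<pi> A\<bar> \<le> e n)" for x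
  proof -
    obtain e :: "nat \<Rightarrow> real" where "e \<longlonglongrightarrow> 0" "\<And>n A. A \<in> sets borel \<Longrightarrow> \<bar>measure (kernel_power borel ?K n x) A - measure \<pi> A\<bar> \<le> e n"
    proof (rule kernel_power_tends_to_invariant[OF K \<nu> _ \<epsilon>' _ \<pi> \<pi>C, of x])
      show "cball 0 R \<in> sets borel" by simp
      show "emeasure (?K v) A = 0" if "A \<in> sets borel" "emeasure (?K u) A = 0" for u v A
        using null_iff[OF that(1)] that(2) by simp
    qed (use minor' inv in auto)
    then show ?thesis unfolding P by blast
  qed
  have lim: "(\<lambda>n. measure (?P n x) A) \<longlonglongrightarrow> measure \<pi> A" if A: "A \<in> sets borel" for x A
  proof -
    obtain e where e: "e \<longlonglongrightarrow> 0" "\<And>n. \<bar>measure (?P n x) A - measure \<pi> A\<bar> \<le> e n" using conv A by blast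
    have "(\<lambda>n. measure (?P n x) A - measure \<pi> A) \<longlonglongrightarrow> 0"
      by (rule Lim_null_comparison[OF _ e(1)]) (simp add: e(2))
    then show ?thesis by (simp add: LIM_zero_iff)
  qed
  have Pprob: "prob_space (?P n x)" "sets (?P n x) = sets borel" for n x
    using measurable_space[OF measurable_kernel_power[OF K, of n], of x] unfolding P by (simp_all add: space_prob_algebra)
  have lim_e: "(\<lambda>n. emeasure (?P n x) A) \<longlonglongrightarrow> emeasure \<pi> A" if A: "A \<in> sets borel" for x A
  proof -
    have "(\<lambda>n. ennreal (measure (?P n x) A)) \<longlonglongrightarrow> ennreal (measure \<pi> A)" by (intro tendsto_ennrealI lim A)
    then show ?thesis
      by (simp add: \<pi>.emeasure_eq_measure finite_measure.emeasure_eq_measure[OF prob_space.finite_measure[OF Pprob(1)]])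
  qed

  have irr: "irreducible_chain lborel ?P"
    unfolding irreducible_chain_def
  proof (intro conjI allI ballI impI)
    fix x and A :: "(real ^ 'd) set" assume "A \<in> sets borel" "0 < emeasure lborel A"
    then have "emeasure (?P 1 x) A > 0" unfolding P1 using null_iff[of A x] by (simp add: zero_less_iff_neq_zero)
    then show "\<exists>n\<ge>1. 0 < emeasure (?P n x) A" by blast
  qed simp_all
  have max_irr: "maximal_irreducibility_measure lborel ?P"
    unfolding maximal_irreducibility_measure_def absolutely_continuous_def
  proof (intro conjI irr allI impI subsetI)
    fix \<phi> :: "(real ^ 'd) measure" and A :: "(real ^ 'd) set"
    assume \<phi>: "irreducible_chain \<phi> ?P" and "A \<in> null_sets lborel"
    then have A: "A \<in> sets borel" "emeasure lborel A = 0" by auto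
    have "emeasure (?P n x) A = 0" if n: "n \<ge> 1" for n x
    proof -
      obtain k where k: "n = Suc k" using n by (cases n) auto
      have "sets (kernel_power borel ?K k x) = sets borel" using Pprob(2)[of k x] by (simp add: P)
      then have "emeasure (?P n x) A = (\<integral>\<^sup>+y. emeasure (?K y) A \<partial>kernel_power borel ?K k x)"
        unfolding P k kernel_power.simps using A(1) measurable_prob_algebraD[OF K]
        by (intro emeasure_bind[where N=borel]) (auto cong: measurable_cong_sets dest: sets_eq_imp_space_eq)
      then show ?thesis using null_iff[OF A(1)] A(2) by simp
    qed
    then have "\<not> (0 < emeasure \<phi> A)" using \<phi> A(1) unfolding irreducible_chain_def by (metis less_irrefl)
    then show "A \<in> null_sets \<phi>" using \<phi> A(1) by (auto simp: irreducible_chain_def null_sets_def)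
  qed
  have "chain_period lborel ?P 1"
  proof (rule period_1_if_charges_positive_sets)
    show "0 < emeasure (?P 1 x) A" if "A \<in> sets borel" "0 < emeasure lborel A" for x A
      unfolding P1 using null_iff[of A x] that by (simp add: zero_less_iff_neq_zero)
  qed (rule Pprob)+
  with max_irr have aper: "aperiodic_chain ?P" unfolding aperiodic_chain_def by blast
  have \<pi>_pos: "emeasure \<pi> A > 0" if A: "A \<in> sets borel" "emeasure lborel A > 0" for A
  proof (rule ccontr)
    assume "\<not> emeasure \<pi> A > 0"
    then have "(\<integral>\<^sup>+x. emeasure (?K x) A \<partial>\<pi>) = 0" using inv[OF A(1)] by simp
    moreover have "(\<lambda>x. emeasure (?K x) A) \<in> borel_measurable \<pi>"
      using measurable_emeasure_kernel[OF measurable_prob_algebraD[OF K] A(1)] \<pi>(2) by (simp cong: measurable_cong_sets)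
    ultimately have "AE x in \<pi>. emeasure (?K x) A = 0" by (simp add: nn_integral_0_iff_AE)
    moreover have "emeasure (?K x) A \<noteq> 0" for x using null_iff[OF A(1)] A(2) by simp
    ultimately show False by simp
  qed
  have invP: "invariant_probability ?P \<pi>"
    unfolding invariant_probability_def P1 using \<pi> inv by blast
  have rec: "recurrent_chain ?P"
    unfolding recurrent_chain_def
  proof (intro exI[of _ lborel] conjI max_irr allI ballI impI)
    fix x and A :: "(real ^ 'd) set" assume A: "A \<in> sets borel" "0 < emeasure lborel A"
    show "(\<Sum>n. emeasure (?P (Suc n) x) A) = \<infinity>"
    proof (rule ccontr)
      assume fin: "(\<Sum>n. emeasure (?P (Suc n) x) A) \<noteq> \<infinity>"
      have eq: "emeasure (?P n x) A = ennreal (measure (?P n x) A)" for n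
        by (rule finite_measure.emeasure_eq_measure[OF prob_space.finite_measure[OF Pprob(1)]])
      have "summable (\<lambda>n. measure (?P (Suc n) x) A)"
        using fin unfolding eq by (intro summable_suminf_not_top) auto
      then have "(\<lambda>n. measure (?P (Suc n) x) A) \<longlonglongrightarrow> 0" by (rule summable_LIMSEQ_zero)
      moreover have "(\<lambda>n. measure (?P (Suc n) x) A) \<longlonglongrightarrow> measure \<pi> A" using lim[OF A(1)] by (rule LIMSEQ_Suc)
      ultimately have "measure \<pi> A = 0" by (rule LIMSEQ_unique[rotated])
      then show False using \<pi>_pos[OF A] by (simp add: \<pi>.emeasure_eq_measure)
    qed
  qed
  have uniq: "\<mu> = \<pi>" if "invariant_probability ?P \<mu>" for \<mu>
  proof (rule measure_eqI)
    have \<mu>: "prob_space \<mu>" "sets \<mu> = sets borel" and inv\<mu>: "\<And>A. A \<in> sets borel \<Longrightarrow> emeasure \<mu> A = (\<integral>\<^sup>+x. emeasure (?K x) A \<partial>\<mu>)"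
      using that unfolding invariant_probability_def P1 by auto
    interpret \<mu>: prob_space \<mu> by (rule \<mu>(1))
    show "sets \<mu> = sets \<pi>" using \<mu> \<pi> by simp
    fix A assume "A \<in> sets \<mu>"
    then have A: "A \<in> sets borel" using \<mu> by simp
    have "(\<integral>\<^sup>+x. emeasure (?P n x) A \<partial>\<mu>) = emeasure \<mu> A" for n
      unfolding P by (rule invariant_kernel_power[OF K \<mu> _ A]) (rule inv\<mu>)
    moreover have "(\<lambda>n. \<integral>\<^sup>+x. emeasure (?P n x) A \<partial>\<mu>) \<longlonglongrightarrow> (\<integral>\<^sup>+x. emeasure \<pi> A \<partial>\<mu>)"
    proof (rule nn_integral_dominated_convergence[where w="\<lambda>_. 1"])
      show "(\<lambda>x. emeasure (?P n x) A) \<in> borel_measurable \<mu>" for n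
        unfolding P using measurable_emeasure_kernel[OF measurable_prob_algebraD[OF measurable_kernel_power[OF K]] A] \<mu>(2)
        by (simp cong: measurable_cong_sets)
      show "(\<integral>\<^sup>+x. 1 \<partial>\<mu>) < \<infinity>" by (simp add: \<mu>.emeasure_space_1)
      show "AE x in \<mu>. emeasure (?P n x) A \<le> 1" for n
        by (intro AE_I2 prob_space.emeasure_le_1 Pprob)
    qed (use lim_e[OF A] in auto)
    ultimately have "(\<lambda>n::nat. emeasure \<mu> A) \<longlonglongrightarrow> emeasure \<pi> A" by (simp add: \<mu>.emeasure_space_1)
    then show "emeasure \<mu> A = emeasure \<pi> A" by (simp add: LIMSEQ_const_iff)
  qed
  have tv: "(\<lambda>n. tv_dist (?P n x) \<pi>) \<longlonglongrightarrow> 0" for x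
  proof -
    obtain e where e: "e \<longlonglongrightarrow> 0" "\<And>n A. A \<in> sets borel \<Longrightarrow> \<bar>measure (?P n x) A - measure \<pi> A\<bar> \<le> e n" using conv by blast
    show ?thesis
      by (rule tendsto_sandwich[OF _ _ tendsto_const e(1)]) (use tv_dist_le[OF e(2)] in auto)
  qed
  show ?thesis
    using em_homogeneous_markov_chain[OF fm \<delta>(1)] irr aper rec invP uniq tv
    unfolding positive_recurrent_chain_def by blast
qed

end
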